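(* Let $(X,1)$ and $(Y,1)$ be finite pointed sets with associated free partial groups $\mathbb{X}$ and $\mathbb{Y}$. Then the number of equivalence classes of extensions of $\mathbb{X}$ by $\mathbb{Y}$ is $$\big(|Y^*|!\,2^{|Y^*|}\big)^{|X^*|},$$ where $X^*=X\setminus\{1\}$ and $Y^*=Y\setminus\{1\}$.
   Context: **Partial groups (Chermak's form).** For a nonempty set $\mathcal{M}$ let $\mathbb{W}(\mathcal{M})$ be the free monoid of words in $\mathcal{M}$ ($\circ$ is concatenation, $\mathcal{M}$ is identified with the words of length $1$). A partial group is a set $\mathcal{M}$ with a subset $\mathbb{D}(\mathcal{M})\subseteq\mathbb{W}(\mathcal{M})$ such that $\mathcal{M}\subseteq\mathbb{D}(\mathcal{M})$ and $u\circ v\in\mathbb{D}(\mathcal{M})$ implies $u,v\in\mathbb{D}(\mathcal{M})$; a map $\Pi\colon\mathbb{D}(\mathcal{M})\to\mathcal{M}$ which is the identity on $\mathcal{M}$ and such that $u\circ v\circ w\in\mathbb{D}(\mathcal{M})$ implies $u\circ\Pi(v)\circ w\in\mathbb{D}(\mathcal{M})$ and $\Pi(u\circ v\circ w)=\Pi(u\circ\Pi(v)\circ w)$; and an involutory bijection $x\mapsto x^{-1}$ of $\mathcal{M}$, extended to words by $(x_1,\dots,x_n)^{-1}=(x_n^{-1},\dots,x_1^{-1})$, such that $u\in\mathbb{D}(\mathcal{M})$ implies $u^{-1}\circ u\in\mathbb{D}(\mathcal{M})$ and $\Pi(u^{-1}\circ u)=1$, where $1=\Pi(\emptyset)$. **Simplicial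 form.** A partial group $\mathcal{M}$ is identified with the simplicial set $\mathbb{M}$ with $\mathbb{M}_0=\{*\}$ and $\mathbb{M}_n$ the set of words of length $n$ in $\mathbb{D}(\mathcal{M})$, with faces: $d_0$ and $d_n$ delete the first, resp. last, letter, $d_i(x_1,\dots,x_n)=(x_1,\dots,\Pi(x_i,x_{i+1}),\dots,x_n)$ for $1\le i\le n-1$; and degeneracies $s_i(x_1,\dots,x_n)=(x_1,\dots,x_i,1,x_{i+1},\dots,x_n)$. Homomorphisms of partial groups correspond to simplicial maps. **Free partial groups.** For a pointed set $(X,1)$, let $X^*=X\setminus\{1\}$ and let $\widetilde X^*=\{\tilde x: x\in X^*\}$ be a disjoint copy of $X^*$. The free partial group $\mathbb{X}$ on $(X,1)$ has underlying set $\{1\}\sqcup X^*\sqcup\widetilde X^*$; inversion exchanging $x$ and $\tilde x$ and fixing $1$; domain consisting of all words obtained, for some $x\in X^*$, from a finite (possibly empty) alternating string $(\dots,x,\tilde x,x,\tilde x,\dots)$ by inserting finitely many $1$'s at arbitrary positions (when $X^*=\emptyset$, all words in $1$); and product $\Pi(u)=x$, $1$ or $\tilde x$ according to whether the number of occurrences of $x$ in $u$ is greater than, equal to, or less than the number of occurrences of $\tilde x$. **Extensions.** A fibre bundle of simplicial sets is a surjective simplicial map $f\colon E\to B$ for which there is a simplicial set $F$ (the fibre) such that for every simplex $b\colon\Delta[n]\to B$ there is an isomorphism $F\times\Delta[n]\cong E_b$ over $\Delta[n]$, where $E_b\to\Delta[n]$ is the pullback of $f$ along $b$. For partial groups $\mathbb{M},\mathbb{H}$,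 an extension of $\mathbb{H}$ by $\mathbb{M}$ is a fibre bundle $\tau\colon\mathbb{E}\to\mathbb{H}$ with fibre $\mathbb{M}$, written $\mathbb{M}\to\mathbb{E}\to\mathbb{H}$, where $\mathbb{M}\to\mathbb{E}$ is the inclusion identifying $\mathbb{M}$ with the fibre over the unique vertex of $\mathbb{H}$ (this identification is part of the data). Two extensions $\mathbb{M}\to\mathbb{E}_i\to\mathbb{H}$, $i=1,2$, are equivalent if there is an isomorphism $\psi\colon\mathbb{E}_1\to\mathbb{E}_2$ compatible with the maps from $\mathbb{M}$ and the maps to $\mathbb{H}$ (with the identity on $\mathbb{M}$ and on $\mathbb{H}$). *)

theory Defs
  imports Complex_Main
begin

section \<open>Simplicial sets\<close>

text \<open>
  A simplicial set has a set of \<open>n\<close>-simplices for each \<open>n\<close>, which need not be disjoint for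
  different \<open>n\<close>; accordingly all operations and all maps take the degree of their
  argument as an explicit parameter: \<open>face S n i\<close> is \<open>d\<^sub>i : S\<^sub>n \<rightarrow> S\<^bsub>n-1\<^esub>\<close> (relevant for \<open>n \<ge> 1\<close>)
  and \<open>degen S n i\<close> is \<open>s\<^sub>i : S\<^sub>n \<rightarrow> S\<^bsub>n+1\<^esub>\<close>.  Values outside the simplices are irrelevant.
\<close>

record 'a sset =
  simplices :: "nat \<Rightarrow> 'a set"
  face :: "nat \<Rightarrow> nat \<Rightarrow> 'a \<Rightarrow> 'a"
  degen :: "nat \<Rightarrow> nat \<Rightarrow> 'a \<Rightarrow> 'a"

locale simplicial_set =
  fixes S :: "'a sset"
  assumes face_closed:
    "\<lbrakk>x \<in> simplices S (Suc n); i \<le> Suc n\<rbrakk> \<Longrightarrow> face S (Suc n) i x \<in> simplices S n"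
  and degen_closed:
    "\<lbrakk>x \<in> simplices S n; i \<le> n\<rbrakk> \<Longrightarrow> degen S n i x \<in> simplices S (Suc n)"
  and face_face:
    "\<lbrakk>x \<in> simplices S (Suc (Suc n)); i < j; j \<le> Suc (Suc n)\<rbrakk> \<Longrightarrow>
      face S (Suc n) i (face S (Suc (Suc n)) j x) =
      face S (Suc n) (j - 1) (face S (Suc (Suc n)) i x)"
  and face_degen_less:
    "\<lbrakk>x \<in> simplices S (Suc n); i < j; j \<le> Suc n\<rbrakk> \<Longrightarrow>
      face S (Suc (Suc n)) i (degen S (Suc n) j x) =
      degen S n (j - 1) (face S (Suc n) i x)"
  and face_degen_same:
    "\<lbrakk>x \<in> simplices S n; j \<le> n; i = j \<or> i = Suc j\<rbrakk> \<Longrightarrow>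
      face S (Suc n) i (degen S n j x) = x"
  and face_degen_greater:
    "\<lbrakk>x \<in> simplices S (Suc n); Suc j < i; i \<le> Suc (Suc n)\<rbrakk> \<Longrightarrow>
      face S (Suc (Suc n)) i (degen S (Suc n) j x) =
      degen S n j (face S (Suc n) (i - 1) x)"
  and degen_degen:
    "\<lbrakk>x \<in> simplices S n; i \<le> j; j \<le> n\<rbrakk> \<Longrightarrow>
      degen S (Suc n) i (degen S n j x) = degen S (Suc n) (Suc j) (degen S n i x)"

definition simplicial_map :: "'a sset \<Rightarrow> 'b sset \<Rightarrow> (nat \<Rightarrow> 'a \<Rightarrow> 'b) \<Rightarrow> bool" where
  "simplicial_map S T f \<longleftrightarrow>
     (\<forall>n. \<forall>x\<in>simplices S n. f n x \<in> simplices T n) \<and>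
     (\<forall>n. \<forall>x\<in>simplices S (Suc n). \<forall>i\<le>Suc n.
        f n (face S (Suc n) i x) = face T (Suc n) i (f (Suc n) x)) \<and>
     (\<forall>n. \<forall>x\<in>simplices S n. \<forall>i\<le>n.
        f (Suc n) (degen S n i x) = degen T n i (f n x))"

definition simplicial_iso :: "'a sset \<Rightarrow> 'b sset \<Rightarrow> (nat \<Rightarrow> 'a \<Rightarrow> 'b) \<Rightarrow> bool" where
  "simplicial_iso S T f \<longleftrightarrow>
     simplicial_map S T f \<and>
     (\<exists>g. simplicial_map T S g \<and>
        (\<forall>n. \<forall>x\<in>simplices S n. g n (f n x) = x) \<and>
        (\<forall>n. \<forall>y\<in>simplices T n. f n (g n y) = y))"

text \<open>
  A \<open>k\<close>-simplex of the standard simplex \<open>\<Delta>[n]\<close>, i.e. a monotone map \<open>[k] \<rightarrow> [n]\<close>, is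
  given by its list of values.
\<close>

definition std_simplex :: "nat \<Rightarrow> nat list sset" where
  "std_simplex n = \<lparr>
     simplices = (\<lambda>k. {l. length l = Suc k \<and> sorted l \<and> set l \<subseteq> {..n}}),
     face = (\<lambda>k i l. take i l @ drop (Suc i) l),
     degen = (\<lambda>k i l. take (Suc i) l @ drop i l)\<rparr>"

definition sset_prod :: "'a sset \<Rightarrow> 'b sset \<Rightarrow> ('a \<times> 'b) sset" where
  "sset_prod S T = \<lparr>
     simplices = (\<lambda>n. simplices S n \<times> simplices T n),
     face = (\<lambda>n i. map_prod (face S n i) (face T n i)),
     degen = (\<lambda>n i. map_prod (degen S n i) (degen T n i))\<rparr>"

definition sset_pullback ::
  "'a sset \<Rightarrow> 'b sset \<Rightarrow> (nat \<Rightarrow> 'a \<Rightarrow> 'c) \<Rightarrow> (nat \<Rightarrow> 'b \<Rightarrow> 'c) \<Rightarrow> ('a \<times> 'b) sset" where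
  "sset_pullback S T f g = (sset_prod S T)\<lparr>
     simplices := (\<lambda>n. {(x, y). x \<in> simplices S n \<and> y \<in> simplices T n \<and> f n x = g n y})\<rparr>"

text \<open>The \<open>n\<close>-dimensional degeneracy of a vertex.\<close>

primrec vertex_degen :: "'a sset \<Rightarrow> 'a \<Rightarrow> nat \<Rightarrow> 'a" where
  "vertex_degen S v 0 = v"
| "vertex_degen S v (Suc n) = degen S n 0 (vertex_degen S v n)"

definition fibre_over :: "'e sset \<Rightarrow> 'b sset \<Rightarrow> (nat \<Rightarrow> 'e \<Rightarrow> 'b) \<Rightarrow> 'b \<Rightarrow> 'e sset" where
  "fibre_over E B f v =
     E\<lparr>simplices := (\<lambda>n. {e \<in> simplices E n. f n e = vertex_degen B v n})\<rparr>"

definition fibre_bundle ::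
  "'f sset \<Rightarrow> 'e sset \<Rightarrow> 'b sset \<Rightarrow> (nat \<Rightarrow> 'e \<Rightarrow> 'b) \<Rightarrow> bool" where
  "fibre_bundle F E B f \<longleftrightarrow>
     simplicial_set F \<and> simplicial_set E \<and> simplicial_set B \<and>
     simplicial_map E B f \<and>
     (\<forall>n. f n ` simplices E n = simplices B n) \<and>
     (\<forall>n b. simplicial_map (std_simplex n) B b \<longrightarrow>
        (\<exists>\<phi>. simplicial_iso (sset_prod F (std_simplex n))
                (sset_pullback E (std_simplex n) f b) \<phi> \<and>
             (\<forall>k. \<forall>p\<in>simplices (sset_prod F (std_simplex n)) k. snd (\<phi> k p) = snd p)))"


section \<open>Partial groups\<close>

record 'a pgroup =
  pg_carrier :: "'a set"
  pg_dom :: "'a list set"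
  pg_prod :: "'a list \<Rightarrow> 'a"
  pg_inv :: "'a \<Rightarrow> 'a"

definition pg_one :: "'a pgroup \<Rightarrow> 'a" where
  "pg_one M = pg_prod M []"

definition pg_inv_word :: "'a pgroup \<Rightarrow> 'a list \<Rightarrow> 'a list" where
  "pg_inv_word M u = rev (map (pg_inv M) u)"

locale partial_group =
  fixes M :: "'a pgroup"
  assumes carrier_nonempty: "pg_carrier M \<noteq> {}"
  and dom_words: "pg_dom M \<subseteq> lists (pg_carrier M)"
  and dom_letter: "x \<in> pg_carrier M \<Longrightarrow> [x] \<in> pg_dom M"
  and dom_append: "u @ v \<in> pg_dom M \<Longrightarrow> u \<in> pg_dom M \<and> v \<in> pg_dom M"
  and prod_closed: "u \<in> pg_dom M \<Longrightarrow> pg_prod M u \<in> pg_carrier M"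
  and prod_letter: "x \<in> pg_carrier M \<Longrightarrow> pg_prod M [x] = x"
  and prod_dom: "u @ v @ w \<in> pg_dom M \<Longrightarrow> u @ [pg_prod M v] @ w \<in> pg_dom M"
  and prod_assoc: "u @ v @ w \<in> pg_dom M \<Longrightarrow>
    pg_prod M (u @ v @ w) = pg_prod M (u @ [pg_prod M v] @ w)"
  and inv_closed: "x \<in> pg_carrier M \<Longrightarrow> pg_inv M x \<in> pg_carrier M"
  and inv_inv: "x \<in> pg_carrier M \<Longrightarrow> pg_inv M (pg_inv M x) = x"
  and inv_word_dom: "u \<in> pg_dom M \<Longrightarrow> pg_inv_word M u @ u \<in> pg_dom M"
  and inv_word_prod: "u \<in> pg_dom M \<Longrightarrow> pg_prod M (pg_inv_word M u @ u) = pg_one M"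

definition nerve :: "'a pgroup \<Rightarrow> 'a list sset" where
  "nerve M = \<lparr>
     simplices = (\<lambda>n. {w \<in> pg_dom M. length w = n}),
     face = (\<lambda>n i w.
       if i = 0 then tl w
       else if i = n then butlast w
       else take (i - 1) w @ [pg_prod M [w ! (i - 1), w ! i]] @ drop (Suc i) w),
     degen = (\<lambda>n i w. take i w @ [pg_one M] @ drop i w)\<rparr>"


section \<open>Free partial groups\<close>

datatype 'a free_elem = One | Gen 'a | Bar 'a

fun free_inv :: "'a free_elem \<Rightarrow> 'a free_elem" where
  "free_inv One = One"
| "free_inv (Gen x) = Bar x"
| "free_inv (Bar x) = Gen x"

definition free_carrier :: "'a set \<Rightarrow> 'a \<Rightarrow> 'a free_elem set" where
  "free_carrier X x\<^sub>0 = {One} \<union> Gen ` (X - {x\<^sub>0}) \<union> Bar ` (X - {x\<^sub>0})"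

text \<open>
  A word arises by inserting \<open>One\<close>s into an alternating string in \<open>x\<close> and its formal inverse
  iff deleting all its \<open>One\<close>s yields such a string.
\<close>

definition free_dom :: "'a set \<Rightarrow> 'a \<Rightarrow> 'a free_elem list set" where
  "free_dom X x\<^sub>0 =
     lists {One} \<union>
     {u. \<exists>x\<in>X - {x\<^sub>0}. set u \<subseteq> {One, Gen x, Bar x} \<and> distinct_adj (filter (\<lambda>a. a \<noteq> One) u)}"

text \<open>
  On a word of the domain at most one \<open>x\<close> has different numbers of occurrences of \<open>Gen x\<close>
  and \<open>Bar x\<close>, so the descriptions below are unambiguous there.
\<close>

definition free_prod :: "'a free_elem list \<Rightarrow> 'a free_elem" where
  "free_prod u =
     (if \<exists>x. count_list u (Gen x) > count_list u (Bar x)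
      then Gen (THE x. count_list u (Gen x) > count_list u (Bar x))
      else if \<exists>x. count_list u (Gen x) < count_list u (Bar x)
      then Bar (THE x. count_list u (Gen x) < count_list u (Bar x))
      else One)"

definition free_pgroup :: "'a set \<Rightarrow> 'a \<Rightarrow> 'a free_elem pgroup" where
  "free_pgroup X x\<^sub>0 = \<lparr>
     pg_carrier = free_carrier X x\<^sub>0,
     pg_dom = free_dom X x\<^sub>0,
     pg_prod = free_prod,
     pg_inv = free_inv\<rparr>"


section \<open>Extensions\<close>

text \<open>
  \<open>'m\<close> and \<open>'h\<close> are the types of elements of the partial groups \<open>M\<close> and \<open>H\<close>, \<open>'e\<close> that of
  the simplices of the total space.
\<close>

record ('m, 'h, 'e) extension =
  total :: "'e sset"
  incl :: "nat \<Rightarrow> 'm list \<Rightarrow> 'e"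
  proj :: "nat \<Rightarrow> 'e \<Rightarrow> 'h list"

text \<open>The unique vertex of \<open>nerve H\<close> is the empty word.\<close>

definition is_extension :: "'h pgroup \<Rightarrow> 'm pgroup \<Rightarrow> ('m, 'h, 'e) extension \<Rightarrow> bool" where
  "is_extension H M \<E> \<longleftrightarrow>
     partial_group H \<and> partial_group M \<and>
     fibre_bundle (nerve M) (total \<E>) (nerve H) (proj \<E>) \<and>
     simplicial_iso (nerve M) (fibre_over (total \<E>) (nerve H) (proj \<E>) []) (incl \<E>)"

definition extension_equivalent ::
  "'m pgroup \<Rightarrow> ('m, 'h, 'e) extension \<Rightarrow> ('m, 'h, 'f) extension \<Rightarrow> bool" where
  "extension_equivalent M \<E>\<^sub>1 \<E>\<^sub>2 \<longleftrightarrow>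
     (\<exists>\<psi>. simplicial_iso (total \<E>\<^sub>1) (total \<E>\<^sub>2) \<psi> \<and>
        (\<forall>n. \<forall>w\<in>simplices (nerve M) n. \<psi> n (incl \<E>\<^sub>1 n w) = incl \<E>\<^sub>2 n w) \<and>
        (\<forall>n. \<forall>e\<in>simplices (total \<E>\<^sub>1) n. proj \<E>\<^sub>2 n (\<psi> n e) = proj \<E>\<^sub>1 n e))"

definition extensions :: "'h pgroup \<Rightarrow> 'm pgroup \<Rightarrow> ('m, 'h, 'e) extension set" where
  "extensions H M = {\<E>. is_extension H M \<E>}"

definition extension_rel :: "'h pgroup \<Rightarrow> 'm pgroup \<Rightarrow> ('m, 'h, 'e) extension rel" where
  "extension_rel H M =
     {(\<E>\<^sub>1, \<E>\<^sub>2). \<E>\<^sub>1 \<in> extensions H M \<and> \<E>\<^sub>2 \<in> extensions H M \<and> extension_equivalent M \<E>\<^sub>1 \<E>\<^sub>2}"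

text \<open>
  All extensions form a proper class; here \<open>'e\<close> serves as the universe for their simplices.
  If \<open>'e\<close> is at least as large as each of the sets \<open>simplices (nerve M) n \<times> simplices (nerve H) n\<close>,
  then every extension is equivalent to one with total space in \<open>'e\<close>.  When \<open>M\<close> and \<open>H\<close>
  are finite, these sets are finite, so any infinite type \<open>'e\<close> suffices.
\<close>

definition extension_classes :: "'h pgroup \<Rightarrow> 'm pgroup \<Rightarrow> ('m, 'h, 'e) extension set set" where
  "extension_classes H M = extensions H M // extension_rel H M"

lemma simplicial_iso_refl: "simplicial_iso S S (\<lambda>n x. x)"
  unfolding simplicial_iso_def simplicial_map_def by (intro conjI exI[of _ "\<lambda>n x. x"]) auto

lemma simplicial_map_comp:
  "simplicial_map S T f \<Longrightarrow> simplicial_map T U g \<Longrightarrow> simplicial_map S U (\<lambda>n x. g n (f n x))"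
  unfolding simplicial_map_def by simp

lemma simplicial_map_closed:
  "simplicial_map S T f \<Longrightarrow> x \<in> simplices S n \<Longrightarrow> f n x \<in> simplices T n"
  unfolding simplicial_map_def by blast

lemma simplicial_iso_comp:
  assumes "simplicial_iso S T f" "simplicial_iso T U g"
  shows "simplicial_iso S U (\<lambda>n x. g n (f n x))"
proof -
  obtain f' where f': "simplicial_map T S f'" "\<And>n x. x \<in> simplices S n \<Longrightarrow> f' n (f n x) = x"
    "\<And>n y. y \<in> simplices T n \<Longrightarrow> f n (f' n y) = y"
    using assms(1) unfolding simplicial_iso_def by blast
  obtain g' where g': "simplicial_map U T g'" "\<And>n x. x \<in> simplices T n \<Longrightarrow> g' n (g n x) = x"
    "\<And>n y. y \<in> simplices U n \<Longrightarrow> g n (g' n y) = y"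
    using assms(2) unfolding simplicial_iso_def by blast
  have m: "simplicial_map S T f" "simplicial_map T U g"
    using assms unfolding simplicial_iso_def by blast+
  show ?thesis
    unfolding simplicial_iso_def
  proof (intro conjI exI[of _ "\<lambda>n x. f' n (g' n x)"])
    show "simplicial_map S U (\<lambda>n x. g n (f n x))" using m by (rule simplicial_map_comp)
    show "simplicial_map U S (\<lambda>n x. f' n (g' n x))" using g'(1) f'(1) by (rule simplicial_map_comp)
  qed (auto simp: f' g' simplicial_map_closed[OF m(1)] simplicial_map_closed[OF g'(1)])
qed

lemma extension_equivalent_sym:
  assumes "is_extension H M \<E>\<^sub>1" "extension_equivalent M \<E>\<^sub>1 \<E>\<^sub>2"
  shows "extension_equivalent M \<E>\<^sub>2 \<E>\<^sub>1"
proof -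
  obtain p where p: "simplicial_iso (total \<E>\<^sub>1) (total \<E>\<^sub>2) p"
    "\<And>n w. w \<in> simplices (nerve M) n \<Longrightarrow> p n (incl \<E>\<^sub>1 n w) = incl \<E>\<^sub>2 n w"
    "\<And>n e. e \<in> simplices (total \<E>\<^sub>1) n \<Longrightarrow> proj \<E>\<^sub>2 n (p n e) = proj \<E>\<^sub>1 n e"
    using assms(2) unfolding extension_equivalent_def by blast
  obtain q where q: "simplicial_map (total \<E>\<^sub>2) (total \<E>\<^sub>1) q"
    "\<And>n x. x \<in> simplices (total \<E>\<^sub>1) n \<Longrightarrow> q n (p n x) = x"
    "\<And>n y. y \<in> simplices (total \<E>\<^sub>2) n \<Longrightarrow> p n (q n y) = y"
    using p(1) unfolding simplicial_iso_def by blast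
  have incl: "incl \<E>\<^sub>1 n w \<in> simplices (total \<E>\<^sub>1) n" if "w \<in> simplices (nerve M) n" for n w
    using assms(1) that
    unfolding is_extension_def simplicial_iso_def simplicial_map_def fibre_over_def by auto
  then show ?thesis
    unfolding extension_equivalent_def
  proof (intro exI[of _ q] conjI allI ballI)
    show "simplicial_iso (total \<E>\<^sub>2) (total \<E>\<^sub>1) q"
      using p(1) q unfolding simplicial_iso_def by blast
  next
    fix n w assume "w \<in> simplices (nerve M) n"
    then show "q n (incl \<E>\<^sub>2 n w) = incl \<E>\<^sub>1 n w"
      using incl p(2) q(2) by metis
  next
    fix n e assume "e \<in> simplices (total \<E>\<^sub>2) n"
    then show "proj \<E>\<^sub>1 n (q n e) = proj \<E>\<^sub>2 n e"
      using p(3) q(3) simplicial_map_closed[OF q(1)] by metis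
  qed
qed

lemma extension_equivalent_trans:
  assumes "extension_equivalent M \<E>\<^sub>1 \<E>\<^sub>2" "extension_equivalent M \<E>\<^sub>2 \<E>\<^sub>3"
  shows "extension_equivalent M \<E>\<^sub>1 \<E>\<^sub>3"
proof -
  obtain p where p: "simplicial_iso (total \<E>\<^sub>1) (total \<E>\<^sub>2) p"
    "\<And>n w. w \<in> simplices (nerve M) n \<Longrightarrow> p n (incl \<E>\<^sub>1 n w) = incl \<E>\<^sub>2 n w"
    "\<And>n e. e \<in> simplices (total \<E>\<^sub>1) n \<Longrightarrow> proj \<E>\<^sub>2 n (p n e) = proj \<E>\<^sub>1 n e"
    using assms(1) unfolding extension_equivalent_def by blast
  obtain q where q: "simplicial_iso (total \<E>\<^sub>2) (total \<E>\<^sub>3) q"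
    "\<And>n w. w \<in> simplices (nerve M) n \<Longrightarrow> q n (incl \<E>\<^sub>2 n w) = incl \<E>\<^sub>3 n w"
    "\<And>n e. e \<in> simplices (total \<E>\<^sub>2) n \<Longrightarrow> proj \<E>\<^sub>3 n (q n e) = proj \<E>\<^sub>2 n e"
    using assms(2) unfolding extension_equivalent_def by blast
  have "\<And>n e. e \<in> simplices (total \<E>\<^sub>1) n \<Longrightarrow> p n e \<in> simplices (total \<E>\<^sub>2) n"
    using p(1) unfolding simplicial_iso_def by (blast dest: simplicial_map_closed)
  then show ?thesis
    unfolding extension_equivalent_def
    by (intro exI[of _ "\<lambda>n x. q n (p n x)"] conjI simplicial_iso_comp[OF p(1) q(1)])
      (simp_all add: p q)
qed

lemma equiv_extension_rel: "equiv (extensions H M) (extension_rel H M)"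
proof (rule equivI)
  show "extension_rel H M \<subseteq> extensions H M \<times> extensions H M"
    by (auto simp: extension_rel_def)
  show "refl_on (extensions H M) (extension_rel H M)"
    by (rule refl_onI) (auto simp: extension_rel_def extension_equivalent_def
          intro!: exI[of _ "\<lambda>n x. x"] simplicial_iso_refl)
  show "sym (extension_rel H M)"
    by (rule symI) (auto simp: extension_rel_def extensions_def intro: extension_equivalent_sym)
  show "trans (extension_rel H M)"
    by (rule transI) (auto simp: extension_rel_def intro: extension_equivalent_trans)
qed

end

theory Submission
  imports Defs "HOL-Combinatorics.Permutations" "HOL-Library.Countable_Set"
begin

text \<open>
Let \<open>H\<close> and \<open>M\<close> be partial groups.  A bundle over the nerve of \<open>H\<close> with fibre the nerve of \<open>M\<close> is
governed by the simplicial set of automorphisms of the fibre, whose \<open>n\<close>-simplices are the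
automorphisms of \<open>M \<times> \<Delta>[n]\<close> over \<open>\<Delta>[n]\<close>.  Its edges resemble natural transformations:
each involves an element \<open>c\<close> of \<open>M\<close> such that \<open>(y, c)\<close> is in the domain for every \<open>y\<close>.  Call \<open>M\<close> rigid if
only \<open>c = 1\<close> has this property.  A free partial group is rigid, because \<open>(c, c)\<close> is not in its domain
for \<open>c \<noteq> 1\<close>.

If \<open>M\<close> is rigid, the automorphisms of the fibre form a discrete group \<open>Aut M\<close> (\<open>local_triv_unique\<close>), so
a local trivialisation over a simplex is determined by its restriction to the last vertex, where it
is normalised to be the given inclusion of \<open>M\<close>.  The bundle then behaves like a covering.  Comparing the
normalised trivialisation over an edge \<open>x\<close> with the inclusion at the initial vertex gives an automorphism
\<open>t x\<close>; the map \<open>t\<close> is a homomorphism from \<open>H\<close> to \<open>Aut M\<close>, and the normalised trivialisations assemble into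
an isomorphism from the twisted product of \<open>M\<close> and \<open>H\<close> along \<open>t\<close> to the total space
(\<open>equivalent_twisted_monodromy\<close>).  Conversely each homomorphism \<open>t\<close> yields a twisted product that is an
extension (\<open>is_extension_twisted\<close>), and since equivalences fix the fibre over the base vertex pointwise,
different homomorphisms give inequivalent extensions (\<open>twisted_equivalent_imp_eq\<close>): there is no
conjugation to divide by.  Hence the classes of extensions correspond to the homomorphisms from
\<open>H\<close> to \<open>Aut M\<close> (\<open>card_extension_classes\<close>).

For free partial groups the count is immediate.  A homomorphism on the free partial group on \<open>X\<close> is an
arbitrary choice of an automorphism for every non-trivial element of \<open>X\<close>, and an automorphism of the free
partial group on \<open>Y\<close> is a signed permutation of the non-trivial elements of \<open>Y\<close>; there are \<open>n! 2^n\<close> of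
these if there are \<open>n\<close> such elements.
\<close>

section \<open>Nerves of partial groups\<close>

lemma std_simplices: "simplices (std_simplex n) k = {l. length l = Suc k \<and> sorted l \<and> set l \<subseteq> {..n}}"
  and std_face: "face (std_simplex n) k i l = take i l @ drop (Suc i) l"
  and std_degen: "degen (std_simplex n) k i l = take (Suc i) l @ drop i l"
  by (simp_all add: std_simplex_def)

lemma nerve_simplices: "simplices (nerve M) n = {w \<in> pg_dom M. length w = n}"
  and nerve_degen: "degen (nerve M) n i w = take i w @ [pg_one M] @ drop i w"
  by (simp_all add: nerve_def)

lemma nerve_face_first: "face (nerve M) n 0 w = tl w"
  and nerve_face_last: "face (nerve M) (Suc n) (Suc n) w = butlast w"
  and nerve_face_middle: "0 < i \<Longrightarrow> i \<le> n \<Longrightarrow> face (nerve M) (Suc n) i w =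
    take (i - 1) w @ [pg_prod M [w ! (i - 1), w ! i]] @ drop (Suc i) w"
  by (simp_all add: nerve_def)

lemma prod_simplices: "simplices (sset_prod S T) n = simplices S n \<times> simplices T n"
  and prod_face: "face (sset_prod S T) n i = map_prod (face S n i) (face T n i)"
  and prod_degen: "degen (sset_prod S T) n i = map_prod (degen S n i) (degen T n i)"
  by (simp_all add: sset_prod_def)

lemma split_at:
  assumes "i < length l"
  obtains l1 x l2 where "l = l1 @ x # l2" "length l1 = i"
  using id_take_nth_drop[OF assms] assms by (metis length_take min.absorb2 min.commute less_imp_le)

lemma simplicial_set_std_simplex: "simplicial_set (std_simplex n)"
proof
  fix x k i
  assume x: "x \<in> simplices (std_simplex n) (Suc k)" "i \<le> Suc k"
  then obtain l1 y l2 where "x = l1 @ y # l2" "length l1 = i"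
    by (elim split_at[of i x, rotated]) (auto simp: std_simplices)
  with x show "face (std_simplex n) (Suc k) i x \<in> simplices (std_simplex n) k"
    by (auto simp: std_simplices std_face sorted_append)
next
  fix x k i
  assume x: "x \<in> simplices (std_simplex n) k" "i \<le> k"
  then obtain l1 y l2 where "x = l1 @ y # l2" "length l1 = i"
    by (elim split_at[of i x, rotated]) (auto simp: std_simplices)
  with x show "degen (std_simplex n) k i x \<in> simplices (std_simplex n) (Suc k)"
    by (auto simp: std_simplices std_degen sorted_append)
next
  fix x k i j
  assume "x \<in> simplices (std_simplex n) (Suc (Suc k))" "i < j" "j \<le> Suc (Suc k)"
  then show "face (std_simplex n) (Suc k) i (face (std_simplex n) (Suc (Suc k)) j x) =
      face (std_simplex n) (Suc k) (j - 1) (face (std_simplex n) (Suc (Suc k)) i x)"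
    by (auto simp: std_simplices std_face nth_append intro!: nth_equalityI)
next
  fix x k i j
  assume "x \<in> simplices (std_simplex n) (Suc k)" "i < j" "j \<le> Suc k"
  then show "face (std_simplex n) (Suc (Suc k)) i (degen (std_simplex n) (Suc k) j x) =
      degen (std_simplex n) k (j - 1) (face (std_simplex n) (Suc k) i x)"
    by (auto simp: std_simplices std_face std_degen nth_append Suc_diff_Suc intro!: nth_equalityI)
next
  fix x k i j
  assume "x \<in> simplices (std_simplex n) k" "j \<le> k" "i = j \<or> i = Suc j"
  then show "face (std_simplex n) (Suc k) i (degen (std_simplex n) k j x) = x"
    by (auto simp: std_simplices std_face std_degen nth_append Suc_diff_Suc intro!: nth_equalityI)
next
  fix x k i j
  assume "x \<in> simplices (std_simplex n) (Suc k)" "Suc j < i" "i \<le> Suc (Suc k)"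
  then show "face (std_simplex n) (Suc (Suc k)) i (degen (std_simplex n) (Suc k) j x) =
      degen (std_simplex n) k j (face (std_simplex n) (Suc k) (i - 1) x)"
    by (auto simp: std_simplices std_face std_degen nth_append Suc_diff_Suc intro!: nth_equalityI)
next
  fix x k i j
  assume "x \<in> simplices (std_simplex n) k" "i \<le> j" "j \<le> k"
  then show "degen (std_simplex n) (Suc k) i (degen (std_simplex n) k j x) =
      degen (std_simplex n) (Suc k) (Suc j) (degen (std_simplex n) k i x)"
    by (auto simp: std_simplices std_degen nth_append Suc_diff_Suc intro!: nth_equalityI)
qed

definition slice :: "nat \<Rightarrow> nat \<Rightarrow> 'a list \<Rightarrow> 'a list" where
  "slice i j w = take (j - i) (drop i w)"

lemma slice_append:
  assumes "i \<le> j" "j \<le> k" shows "slice i k w = slice i j w @ slice j k w"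
proof -
  have "k - i = (j - i) + (k - j)" "i + (j - i) = j" using assms by auto
  then show ?thesis by (simp only: slice_def take_add drop_drop add.commute)
qed

lemma slice_same: "slice i i w = []"
  by (simp add: slice_def)

lemma slice_Suc: "i < length w \<Longrightarrow> slice i (Suc i) w = [w ! i]"
  by (simp add: slice_def take_Suc_conv_app_nth)

text \<open>
A simplex \<open>l\<close> of \<open>\<Delta>[n]\<close> acts on a word \<open>w\<close> of length \<open>n\<close> by multiplying out the segments of \<open>w\<close> between
consecutive entries of \<open>l\<close>.  This is the characteristic map \<open>\<Delta>[n] \<rightarrow> nerve M\<close> of the simplex \<open>w\<close>.
\<close>

fun pull :: "'a pgroup \<Rightarrow> 'a list \<Rightarrow> nat list \<Rightarrow> 'a list" where
  "pull M w (i # j # l) = pg_prod M (slice i j w) # pull M w (j # l)"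
| "pull M w [i] = []"
| "pull M w [] = []"

lemma length_pull: "length (pull M w l) = length l - 1"
  by (induction M w l rule: pull.induct) auto

lemma pull_append: "pull M w (l1 @ x # l2) = pull M w (l1 @ [x]) @ pull M w (x # l2)"
  by (induction M w l1 rule: pull.induct) auto

lemma pull_nth: "Suc i < length l \<Longrightarrow> pull M w l ! i = pg_prod M (slice (l ! i) (l ! Suc i) w)"
proof (induction M w l arbitrary: i rule: pull.induct)
  case (1 M w a b l)
  then show ?case by (cases i) auto
qed auto

context partial_group
begin

lemma nil_dom: "[] \<in> pg_dom M"
  using carrier_nonempty dom_letter dom_append[of "[]"] by force

lemma one_closed: "pg_one M \<in> pg_carrier M"
  unfolding pg_one_def by (rule prod_closed[OF nil_dom])

lemma dom_carrier: "w \<in> pg_dom M \<Longrightarrow> set w \<subseteq> pg_carrier M"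
  using dom_words by auto

lemma insert_one_dom: "u @ w \<in> pg_dom M \<Longrightarrow> u @ [pg_one M] @ w \<in> pg_dom M"
  using prod_dom[of u "[]" w] by (simp add: pg_one_def)

lemma prod_append:
  assumes "u @ v \<in> pg_dom M" shows "pg_prod M (u @ v) = pg_prod M [pg_prod M u, pg_prod M v]"
proof -
  have "[pg_prod M u] @ v @ [] \<in> pg_dom M" using prod_dom[of "[]" u v] assms by simp
  from prod_assoc[OF this] show ?thesis using prod_assoc[of "[]" u v] assms by simp
qed

lemma prod_one_left: "x \<in> pg_carrier M \<Longrightarrow> pg_prod M [pg_one M, x] = x"
  using prod_assoc[of "[]" "[]" "[x]"] by (simp add: pg_one_def dom_letter prod_letter)

lemma prod_one_right: "x \<in> pg_carrier M \<Longrightarrow> pg_prod M [x, pg_one M] = x"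
  using prod_assoc[of "[x]" "[]" "[]"] by (simp add: pg_one_def dom_letter prod_letter)

lemma one_left_dom: "x \<in> pg_carrier M \<Longrightarrow> [pg_one M, x] \<in> pg_dom M"
  using insert_one_dom[of "[]" "[x]"] by (simp add: dom_letter)

lemma one_right_dom: "x \<in> pg_carrier M \<Longrightarrow> [x, pg_one M] \<in> pg_dom M"
  using insert_one_dom[of "[x]" "[]"] by (simp add: dom_letter)

lemma slice_dom: "w \<in> pg_dom M \<Longrightarrow> slice i j w \<in> pg_dom M"
  unfolding slice_def by (metis append_take_drop_id dom_append)

text \<open>
The segment of \<open>w\<close> that \<open>l\<close> spans is multiplied out piece by piece, from the left; the prefix \<open>u\<close>
collects the products already formed.
\<close>

lemma pull_dom_aux:
  "sorted (x # l) \<Longrightarrow> u @ slice x (last (x # l)) w \<in> pg_dom M \<Longrightarrow> u @ pull M w (x # l) \<in> pg_dom M"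
proof (induction l arbitrary: u x)
  case Nil
  then show ?case by (simp add: slice_same)
next
  case (Cons y l)
  have "x \<le> y" "y \<le> last (y # l)" using Cons.prems(1) by (auto split: if_splits)
  then have "slice x (last (x # y # l)) w = slice x y w @ slice y (last (y # l)) w"
    using slice_append[of x y "last (y # l)" w] by simp
  then have "(u @ [pg_prod M (slice x y w)]) @ slice y (last (y # l)) w \<in> pg_dom M"
    using Cons.prems(2) prod_dom by simp
  then show ?case using Cons.IH[of y "u @ [pg_prod M (slice x y w)]"] Cons.prems(1) by simp
qed

lemma pull_closed:
  assumes "w \<in> pg_dom M" "l \<in> simplices (std_simplex n) k"
  shows "pull M w l \<in> simplices (nerve M) k"
proof -
  obtain x l' where l: "l = x # l'" using assms(2) by (cases l) (auto simp: std_simplices)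
  show ?thesis
    using pull_dom_aux[of x l' "[]" w] assms slice_dom[OF assms(1)]
    by (auto simp: std_simplices nerve_simplices length_pull l)
qed

text \<open>
The only face that does more than drop a letter merges two adjacent segments, and there the
associativity of the product applies.
\<close>

lemma face_pull:
  assumes w: "w \<in> pg_dom M" and l: "l \<in> simplices (std_simplex n) (Suc k)" and i: "i \<le> Suc k"
  shows "face (nerve M) (Suc k) i (pull M w l) = pull M w (face (std_simplex n) (Suc k) i l)"
proof -
  have len: "length l = Suc (Suc k)" and srt: "sorted l" using l by (auto simp: std_simplices)
  obtain l1 y l2 where l12: "l = l1 @ y # l2" "length l1 = i" using i len by (elim split_at[of i l, rotated]) auto
  consider "i = 0" | "i = Suc k" | "0 < i" "i \<le> k" using i by linarith
  then show ?thesis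
  proof cases
    case 1
    then show ?thesis using l12 len by (cases l2) (auto simp: nerve_face_first std_face)
  next
    case 2
    then have "l2 = []" using l12 len by simp
    moreover obtain l0 x where "l1 = l0 @ [x]" using l12 2 by (cases l1 rule: rev_cases) auto
    ultimately show ?thesis using 2 l12 pull_append[of M w l0 x "[y]"]
      by (simp add: nerve_face_last std_face)
  next
    case 3
    obtain l0 x where l0: "l1 = l0 @ [x]" using l12 3 by (cases l1 rule: rev_cases) auto
    obtain z l3 where l3: "l2 = z # l3" using 3 l12 len by (cases l2) auto
    have ord: "x \<le> y" "y \<le> z" using srt l12 l0 l3 by (auto simp: sorted_append)
    have "pg_prod M (slice x z w) = pg_prod M [pg_prod M (slice x y w), pg_prod M (slice y z w)]"
      using slice_append[OF ord, of w] slice_dom[OF w, of x z] prod_append by metis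
    have [simp]: "i = Suc (length l0)" using l12(2) l0 by simp
    show ?thesis using \<open>pg_prod M (slice x z w) = _\<close> 3 l12(1) l0 l3
        pull_append[of M w l0 x "y # z # l3"] pull_append[of M w l0 x "z # l3"]
      by (simp add: nerve_face_middle std_face nth_append length_pull)
  qed
qed

lemma degen_pull:
  assumes l: "l \<in> simplices (std_simplex n) k" and i: "i \<le> k"
  shows "degen (nerve M) k i (pull M w l) = pull M w (degen (std_simplex n) k i l)"
proof -
  have len: "length l = Suc k" using l by (auto simp: std_simplices)
  obtain l1 y l2 where l12: "l = l1 @ y # l2" "length l1 = i" using i len by (elim split_at[of i l, rotated]) auto
  then show ?thesis
    using pull_append[of M w l1 y l2] pull_append[of M w l1 y "y # l2"]
    by (simp add: nerve_degen std_degen length_pull slice_same pg_one_def)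
qed

lemma simplicial_map_pull:
  "w \<in> pg_dom M \<Longrightarrow> simplicial_map (std_simplex n) (nerve M) (\<lambda>_. pull M w)"
  by (simp add: simplicial_map_def pull_closed face_pull degen_pull)

lemma pull_top:
  assumes "w \<in> simplices (nerve M) n" shows "pull M w [0..<Suc n] = w"
proof (rule nth_equalityI)
  fix i assume "i < length (pull M w [0..<Suc n])"
  then have i: "i < n" by (simp add: length_pull)
  then have "pg_prod M [w ! i] = w ! i"
    using assms dom_carrier[of w] by (intro prod_letter) (auto simp: nerve_simplices)
  then show "pull M w [0..<Suc n] ! i = w ! i"
    using i assms by (simp add: pull_nth slice_Suc nerve_simplices del: upt_Suc)
qed (use assms in \<open>simp add: length_pull nerve_simplices\<close>)

text \<open>
Every simplex is the image of the top simplex of \<open>\<Delta>[n]\<close> under its characteristic map, which commutes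
with faces and degeneracies.  The simplicial identities are thus inherited from \<open>\<Delta>[n]\<close>, where they
are statements about deleting and doubling list entries.
\<close>

lemma simplicial_set_nerve: "simplicial_set (nerve M)"
proof -
  have top: "[0..<Suc n] \<in> simplices (std_simplex n) n" for n
    by (auto simp: std_simplices simp del: upt_Suc)
  have dom: "w \<in> pg_dom M" if "w \<in> simplices (nerve M) n" for w n
    using that by (simp add: nerve_simplices)
  have *: "\<exists>l\<in>simplices (std_simplex n) n. w = pull M w l" if "w \<in> simplices (nerve M) n" for w n
    using top pull_top[OF that] by metis
  note S = simplicial_set_std_simplex
  note cl = simplicial_set.face_closed[OF S] simplicial_set.degen_closed[OF S]
  show ?thesis
  proof
    fix x n i assume a: "x \<in> simplices (nerve M) (Suc n)" "i \<le> Suc n"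
    with *[OF a(1)] show "face (nerve M) (Suc n) i x \<in> simplices (nerve M) n"
      by (metis dom pull_closed face_pull cl(1))
  next
    fix x n i assume a: "x \<in> simplices (nerve M) n" "i \<le> n"
    with *[OF a(1)] show "degen (nerve M) n i x \<in> simplices (nerve M) (Suc n)"
      by (metis dom pull_closed degen_pull cl(2))
  next
    fix x n i j assume a: "x \<in> simplices (nerve M) (Suc (Suc n))" "i < j" "j \<le> Suc (Suc n)"
    from *[OF a(1)] obtain l where l: "l \<in> simplices (std_simplex (Suc (Suc n))) (Suc (Suc n))" "x = pull M x l" by blast
    show "face (nerve M) (Suc n) i (face (nerve M) (Suc (Suc n)) j x) =
      face (nerve M) (Suc n) (j - 1) (face (nerve M) (Suc (Suc n)) i x)"
      apply (subst (1 2) l(2))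
      using a l(1) dom[OF a(1)] simplicial_set.face_face[OF S l(1) a(2,3)]
        face_pull[OF dom[OF a(1)] cl(1)[OF l(1) a(3)], of i]
        face_pull[OF dom[OF a(1)] cl(1)[OF l(1)], of i "j - 1"]
      by (simp add: face_pull)
  next
    fix x n i j assume a: "x \<in> simplices (nerve M) (Suc n)" "i < j" "j \<le> Suc n"
    from *[OF a(1)] obtain l where l: "l \<in> simplices (std_simplex (Suc n)) (Suc n)" "x = pull M x l" by blast
    show "face (nerve M) (Suc (Suc n)) i (degen (nerve M) (Suc n) j x) =
      degen (nerve M) n (j - 1) (face (nerve M) (Suc n) i x)"
      apply (subst (1 2) l(2))
      using a l(1) dom[OF a(1)] simplicial_set.face_degen_less[OF S l(1) a(2,3)]
        face_pull[OF dom[OF a(1)] cl(2)[OF l(1) a(3)], of i]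
        degen_pull[OF cl(1)[OF l(1)], of i "j - 1"]
      by (simp add: face_pull degen_pull)
  next
    fix x n i j assume a: "x \<in> simplices (nerve M) n" "j \<le> n" "i = j \<or> i = Suc j"
    from *[OF a(1)] obtain l where l: "l \<in> simplices (std_simplex n) n" "x = pull M x l" by blast
    show "face (nerve M) (Suc n) i (degen (nerve M) n j x) = x"
      apply (subst (1 2) l(2))
      using a l(1) dom[OF a(1)] simplicial_set.face_degen_same[OF S l(1) a(2,3)]
        face_pull[OF dom[OF a(1)] cl(2)[OF l(1) a(2)], of i]
      by (auto simp: degen_pull)
  next
    fix x n i j assume a: "x \<in> simplices (nerve M) (Suc n)" "Suc j < i" "i \<le> Suc (Suc n)"
    from *[OF a(1)] obtain l where l: "l \<in> simplices (std_simplex (Suc n)) (Suc n)" "x = pull M x l" by blast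
    show "face (nerve M) (Suc (Suc n)) i (degen (nerve M) (Suc n) j x) =
      degen (nerve M) n j (face (nerve M) (Suc n) (i - 1) x)"
      apply (subst (1 2) l(2))
      using a l(1) dom[OF a(1)] simplicial_set.face_degen_greater[OF S l(1) a(2,3)]
        face_pull[OF dom[OF a(1)] cl(2)[OF l(1)], of j i]
        degen_pull[OF cl(1)[OF l(1)], of "i - 1" j]
      by (simp add: face_pull degen_pull)
  next
    fix x n i j assume a: "x \<in> simplices (nerve M) n" "i \<le> j" "j \<le> n"
    from *[OF a(1)] obtain l where l: "l \<in> simplices (std_simplex n) n" "x = pull M x l" by blast
    show "degen (nerve M) (Suc n) i (degen (nerve M) n j x) =
      degen (nerve M) (Suc n) (Suc j) (degen (nerve M) n i x)"
      apply (subst (1 2) l(2))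
      using a l(1) dom[OF a(1)] simplicial_set.degen_degen[OF S l(1) a(2,3)]
        degen_pull[OF cl(2)[OF l(1)], of j i] degen_pull[OF cl(2)[OF l(1)], of i "Suc j"]
      by (simp add: degen_pull)
  qed
qed

lemma vertex_degen_nerve: "vertex_degen (nerve M) [] n = replicate n (pg_one M)"
  by (induction n) (auto simp: nerve_degen)

lemma replicate_one_dom: "replicate n (pg_one M) \<in> pg_dom M"
  by (induction n) (use insert_one_dom[of "[]"] nil_dom in auto)

end

section \<open>Maps between nerves\<close>

lemma tl_butlast_eqI:
  assumes "length u = length v" "length u \<noteq> 1" "tl u = tl v" "butlast u = butlast v"
  shows "u = v"
proof (cases u)
  case Nil
  then show ?thesis using assms(1) by simp
next
  case (Cons a u')
  then obtain b v' where v: "v = b # v'" using assms(1) by (cases v) auto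
  then have "u' = v'" "u' \<noteq> []" using Cons assms by auto
  then show ?thesis using assms(4) Cons v by simp
qed

text \<open>
A word of length at least 2 is determined by its first and its last face, so by induction a simplicial
map into a nerve is determined by its values on edges.
\<close>

lemma nerve_map_eqI:
  assumes S: "\<And>n x i. x \<in> simplices S (Suc n) \<Longrightarrow> i \<le> Suc n \<Longrightarrow> face S (Suc n) i x \<in> simplices S n"
    and f: "simplicial_map S (nerve M) f" and g: "simplicial_map S (nerve M) g"
    and edges: "\<And>x. x \<in> simplices S 1 \<Longrightarrow> f 1 x = g 1 x"
    and x: "x \<in> simplices S n"
  shows "f n x = g n x"
  using x
proof (induction n arbitrary: x)
  case 0
  then show ?case using simplicial_map_closed[OF f] simplicial_map_closed[OF g]
    by (force simp: nerve_simplices)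
next
  case (Suc n)
  show ?case
  proof (cases "n = 0")
    case True
    then show ?thesis using edges Suc.prems by simp
  next
    case False
    have fg: "f (Suc n) x \<in> simplices (nerve M) (Suc n)" "g (Suc n) x \<in> simplices (nerve M) (Suc n)"
      using simplicial_map_closed f g Suc.prems by metis+
    have "face (nerve M) (Suc n) i (f (Suc n) x) = face (nerve M) (Suc n) i (g (Suc n) x)"
      if i: "i \<le> Suc n" for i
    proof -
      have "f n (face S (Suc n) i x) = g n (face S (Suc n) i x)"
        using Suc.IH[OF S[OF Suc.prems i]] .
      then show ?thesis using f g Suc.prems i unfolding simplicial_map_def by metis
    qed
    from this[of 0] this[of "Suc n"] show ?thesis
      using fg False by - (rule tl_butlast_eqI; auto simp: nerve_face_first nerve_face_last nerve_simplices)
  qed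
qed

text \<open>
Automorphisms are represented by permutations of the whole type that fix everything outside the
carrier, so that composition and inverse are those of functions.
\<close>

definition pg_aut :: "'a pgroup \<Rightarrow> ('a \<Rightarrow> 'a) set" where
  "pg_aut M = {a. a permutes pg_carrier M \<and>
     (\<forall>u\<in>lists (pg_carrier M). map a u \<in> pg_dom M \<longleftrightarrow> u \<in> pg_dom M) \<and>
     (\<forall>u\<in>pg_dom M. a (pg_prod M u) = pg_prod M (map a u))}"

context partial_group
begin

lemma aut_permutes: "a \<in> pg_aut M \<Longrightarrow> a permutes pg_carrier M"
  by (simp add: pg_aut_def)

lemma aut_closed: "a \<in> pg_aut M \<Longrightarrow> x \<in> pg_carrier M \<Longrightarrow> a x \<in> pg_carrier M"
  by (simp add: pg_aut_def permutes_in_image)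

lemma aut_dom: "a \<in> pg_aut M \<Longrightarrow> u \<in> pg_dom M \<Longrightarrow> map a u \<in> pg_dom M"
  using dom_words by (auto simp: pg_aut_def)

lemma aut_prod: "a \<in> pg_aut M \<Longrightarrow> u \<in> pg_dom M \<Longrightarrow> a (pg_prod M u) = pg_prod M (map a u)"
  by (simp add: pg_aut_def)

lemma aut_one: "a \<in> pg_aut M \<Longrightarrow> a (pg_one M) = pg_one M"
  using aut_prod[OF _ nil_dom] by (simp add: pg_one_def)

lemma id_aut: "id \<in> pg_aut M"
  by (auto simp: pg_aut_def permutes_id)

lemma inv_aut:
  assumes a: "a \<in> pg_aut M" shows "inv a \<in> pg_aut M"
proof -
  have p: "inv a permutes pg_carrier M" using permutes_inv[OF aut_permutes[OF a]] .
  have [simp]: "a (inv a x) = x" "inv a (a x) = x" for x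
    using permutes_inverses[OF aut_permutes[OF a]] by auto
  have mm [simp]: "map a (map (inv a) u) = u" "map (inv a) (map a u) = u" for u
    by (simp_all add: comp_def)
  have li: "map (inv a) u \<in> lists (pg_carrier M)" if "u \<in> lists (pg_carrier M)" for u
    using that permutes_in_image[OF p] by auto
  have dom: "map (inv a) u \<in> pg_dom M \<longleftrightarrow> u \<in> pg_dom M" if "u \<in> lists (pg_carrier M)" for u
  proof -
    have "map a (map (inv a) u) \<in> pg_dom M \<longleftrightarrow> map (inv a) u \<in> pg_dom M"
      using a li[OF that] unfolding pg_aut_def by blast
    then show ?thesis by (simp only: mm)
  qed
  have "inv a (pg_prod M u) = pg_prod M (map (inv a) u)" if u: "u \<in> pg_dom M" for u
  proof -
    have "map (inv a) u \<in> pg_dom M" using dom u dom_words by blast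
    from aut_prod[OF a this] have "a (pg_prod M (map (inv a) u)) = pg_prod M u" by (simp only: mm)
    then show ?thesis using \<open>\<And>x. inv a (a x) = x\<close> by metis
  qed
  with p dom show ?thesis by (auto simp: pg_aut_def)
qed

lemma simplicial_map_aut:
  assumes a: "a \<in> pg_aut M" shows "simplicial_map (nerve M) (nerve M) (\<lambda>_. map a)"
proof -
  have "map a (face (nerve M) (Suc n) i w) = face (nerve M) (Suc n) i (map a w)"
    if "w \<in> simplices (nerve M) (Suc n)" "i \<le> Suc n" for n i w
  proof -
    consider "i = 0" | "i = Suc n" | "0 < i" "i \<le> n" using \<open>i \<le> Suc n\<close> by linarith
    then show ?thesis
    proof cases
      case 3
      then obtain k where k: "i = Suc k" by (cases i) auto
      have w: "w \<in> pg_dom M" "length w = Suc n" using that by (auto simp: nerve_simplices)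
      have "slice k (Suc (Suc k)) w = slice k (Suc k) w @ slice (Suc k) (Suc (Suc k)) w"
        by (rule slice_append) auto
      then have "[w ! k, w ! Suc k] \<in> pg_dom M"
        using slice_dom[OF w(1), of k "Suc (Suc k)"] 3 k w by (simp add: slice_Suc)
      from aut_prod[OF a this] show ?thesis
        using 3 k w by (simp add: nerve_face_middle take_map drop_map)
    qed (auto simp: nerve_face_first nerve_face_last map_tl map_butlast)
  qed
  then show ?thesis
    using aut_dom[OF a] aut_one[OF a]
    by (auto simp: simplicial_map_def nerve_simplices nerve_degen take_map drop_map)
qed

lemma bij_betw_aut:
  assumes a: "a \<in> pg_aut M" shows "bij_betw (map a) (simplices (nerve M) n) (simplices (nerve M) n)"
  by (rule bij_betw_byWitness[where f' = "map (inv a)"])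
    (use aut_dom[OF a] aut_dom[OF inv_aut[OF a]] permutes_inverses[OF aut_permutes[OF a]] in
      \<open>auto simp: nerve_simplices comp_def\<close>)

text \<open>
As in \<open>nerve_map_eqI\<close>, the first and the last face determine the value on a word letter by letter.
The middle face of a word of length 2 shows that products are respected.
\<close>

lemma nerve_aut_letterwise:
  assumes f: "simplicial_map (nerve M) (nerve M) f"
    and bij: "\<And>n. bij_betw (f n) (simplices (nerve M) n) (simplices (nerve M) n)"
  shows "\<exists>a\<in>pg_aut M. \<forall>n. \<forall>w\<in>simplices (nerve M) n. f n w = map a w"
proof -
  interpret N: simplicial_set "nerve M" by (rule simplicial_set_nerve)
  define a where "a y = (if y \<in> pg_carrier M then hd (f 1 [y]) else y)" for y
  have letter: "[y] \<in> simplices (nerve M) 1 \<longleftrightarrow> y \<in> pg_carrier M" for y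
    using dom_letter dom_carrier[of "[y]"] by (auto simp: nerve_simplices)
  have one: "\<exists>y\<in>pg_carrier M. w = [y]" if "w \<in> simplices (nerve M) 1" for w
    using that dom_carrier[of w] by (cases w) (auto simp: nerve_simplices)
  have f1: "f 1 [y] = [a y]" "a y \<in> pg_carrier M" if "y \<in> pg_carrier M" for y
  proof -
    have "f 1 [y] \<in> simplices (nerve M) 1" using simplicial_map_closed[OF f] letter that by metis
    from one[OF this] show "f 1 [y] = [a y]" "a y \<in> pg_carrier M" using that by (auto simp: a_def)
  qed
  have fw: "f n w = map a w" if "w \<in> simplices (nerve M) n" for n w
    using that
  proof (induction n arbitrary: w)
    case 0
    then show ?case using simplicial_map_closed[OF f 0] by (auto simp: nerve_simplices)
  next
    case (Suc n)
    show ?case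
    proof (cases "n = 0")
      case True
      then show ?thesis using one[of w] Suc.prems f1 by auto
    next
      case False
      have fi: "face (nerve M) (Suc n) i (f (Suc n) w) = map a (face (nerve M) (Suc n) i w)" if i: "i \<le> Suc n" for i
        using Suc.IH[OF N.face_closed[OF Suc.prems i]] f Suc.prems i unfolding simplicial_map_def by metis
      have "length (f (Suc n) w) = Suc n" "length w = Suc n"
        using simplicial_map_closed[OF f Suc.prems] Suc.prems by (auto simp: nerve_simplices)
      with fi[of 0] fi[of "Suc n"] False show ?thesis
        by - (rule tl_butlast_eqI; auto simp: nerve_face_first nerve_face_last map_tl map_butlast)
    qed
  qed
  have inj: "inj_on a (pg_carrier M)"
  proof (rule inj_onI)
    fix x y assume xy: "x \<in> pg_carrier M" "y \<in> pg_carrier M" "a x = a y"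
    then have "f 1 [x] = f 1 [y]" using f1 by simp
    then show "x = y" using bij[of 1] letter xy by (auto simp: bij_betw_def dest: inj_onD)
  qed
  have "a ` pg_carrier M = pg_carrier M"
  proof (intro equalityI subsetI)
    fix z assume "z \<in> pg_carrier M"
    then have "[z] \<in> f 1 ` simplices (nerve M) 1" using bij[of 1] letter by (simp add: bij_betw_def)
    then obtain w where "w \<in> simplices (nerve M) 1" "f 1 w = [z]" by auto
    with one[of w] f1 show "z \<in> a ` pg_carrier M" by auto
  qed (use f1 in auto)
  with inj have perm: "a permutes pg_carrier M"
    by (intro bij_imp_permutes) (auto simp: bij_betw_def a_def)
  have dom: "map a u \<in> pg_dom M" if "u \<in> pg_dom M" for u
    using simplicial_map_closed[OF f, of u "length u"] fw[of u "length u"] that by (simp add: nerve_simplices)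
  have dom': "u \<in> pg_dom M" if u: "u \<in> lists (pg_carrier M)" "map a u \<in> pg_dom M" for u
  proof -
    have "map a u \<in> f (length u) ` simplices (nerve M) (length u)"
      using bij[of "length u"] u by (simp add: bij_betw_def nerve_simplices)
    then obtain v where v: "v \<in> pg_dom M" "map a u = map a v" by (auto simp: nerve_simplices fw)
    moreover have "inj a" using permutes_inj[OF perm] .
    ultimately show ?thesis by (simp add: inj_map_eq_map)
  qed
  have pair: "a (pg_prod M [x, y]) = pg_prod M [a x, a y]" if "[x, y] \<in> pg_dom M" for x y
  proof -
    have s: "[x, y] \<in> simplices (nerve M) (Suc 1)" using that by (simp add: nerve_simplices)
    then have "f 1 (face (nerve M) (Suc 1) 1 [x, y]) = face (nerve M) (Suc 1) 1 (f (Suc 1) [x, y])"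
      using f unfolding simplicial_map_def by auto
    then have "f 1 [pg_prod M [x, y]] = [pg_prod M [a x, a y]]"
      using fw[OF s] by (simp add: nerve_face_middle)
    then show ?thesis using f1 prod_closed[OF that] by simp
  qed
  have "f 1 (degen (nerve M) 0 0 []) = degen (nerve M) 0 0 (f 0 [])"
    using f nil_dom unfolding simplicial_map_def by (auto simp: nerve_simplices)
  then have a1: "a (pg_one M) = pg_one M"
    using fw[of "[]" 0] nil_dom f1[OF one_closed] by (simp add: nerve_simplices nerve_degen)
  have prod: "a (pg_prod M u) = pg_prod M (map a u)" if "u \<in> pg_dom M" for u
    using that
  proof (induction u)
    case Nil
    then show ?case using a1 by (simp add: pg_one_def)
  next
    case (Cons x u)
    have u: "[x] \<in> pg_dom M" "u \<in> pg_dom M" using dom_append[of "[x]" u] Cons.prems by auto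
    have "pg_prod M (x # u) = pg_prod M [x, pg_prod M u]" "[x, pg_prod M u] \<in> pg_dom M"
      using prod_assoc[of "[x]" u "[]"] prod_dom[of "[x]" u "[]"] Cons.prems by auto
    moreover have "pg_prod M (map a (x # u)) = pg_prod M [a x, pg_prod M (map a u)]"
      using prod_assoc[of "[a x]" "map a u" "[]"] dom[OF Cons.prems] by simp
    ultimately show ?case using pair Cons.IH[OF u(2)] by simp
  qed
  from perm dom dom' prod fw show ?thesis by (intro bexI[of _ a]) (auto simp: pg_aut_def)
qed

end

section \<open>Isomorphic extensions\<close>

lemma simplicial_isoI:
  assumes S: "\<And>n x i. x \<in> simplices S (Suc n) \<Longrightarrow> i \<le> Suc n \<Longrightarrow> face S (Suc n) i x \<in> simplices S n"
    "\<And>n x i. x \<in> simplices S n \<Longrightarrow> i \<le> n \<Longrightarrow> degen S n i x \<in> simplices S (Suc n)"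
    and f: "simplicial_map S T f" and bij: "\<And>n. bij_betw (f n) (simplices S n) (simplices T n)"
  shows "simplicial_iso S T f"
proof -
  define g where "g n = inv_into (simplices S n) (f n)" for n
  have gf: "g n (f n x) = x" if "x \<in> simplices S n" for n x
    using bij_betw_inv_into_left[OF bij that] by (simp add: g_def)
  have fg: "f n (g n y) = y" if "y \<in> simplices T n" for n y
    using bij_betw_inv_into_right[OF bij that] by (simp add: g_def)
  have gc: "g n y \<in> simplices S n" if "y \<in> simplices T n" for n y
    using bij_betwE[OF bij_betw_inv_into[OF bij]] that by (simp add: g_def)
  have "g n (face T (Suc n) i y) = face S (Suc n) i (g (Suc n) y)"
    if "y \<in> simplices T (Suc n)" "i \<le> Suc n" for n i y
    using f that gf[OF S(1)[OF gc[OF that(1)] that(2)]] fg[OF that(1)] gc[OF that(1)]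
    unfolding simplicial_map_def by metis
  moreover have "g (Suc n) (degen T n i y) = degen S n i (g n y)"
    if "y \<in> simplices T n" "i \<le> n" for n i y
    using f that gf[OF S(2)[OF gc[OF that(1)] that(2)]] fg[OF that(1)] gc[OF that(1)]
    unfolding simplicial_map_def by metis
  ultimately have "simplicial_map T S g" using gc by (auto simp: simplicial_map_def)
  then show ?thesis using f gf fg unfolding simplicial_iso_def by blast
qed

lemma simplicial_iso_bij: "simplicial_iso S T f \<Longrightarrow> bij_betw (f n) (simplices S n) (simplices T n)"
  unfolding simplicial_iso_def simplicial_map_def
  by (elim conjE exE, rule bij_betw_byWitness) auto

lemma sset_pullback_simps:
  "simplices (sset_pullback S T f g) n = {(x, y). x \<in> simplices S n \<and> y \<in> simplices T n \<and> f n x = g n y}"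
  "face (sset_pullback S T f g) n i = map_prod (face S n i) (face T n i)"
  "degen (sset_pullback S T f g) n i = map_prod (degen S n i) (degen T n i)"
  by (simp_all add: sset_pullback_def sset_prod_def)

lemma fibre_over_simps:
  "simplices (fibre_over E B f v) n = {e \<in> simplices E n. f n e = vertex_degen B v n}"
  "face (fibre_over E B f v) = face E" "degen (fibre_over E B f v) = degen E"
  by (simp_all add: fibre_over_def)

lemma simplicial_map_face:
  "simplicial_map S T f \<Longrightarrow> x \<in> simplices S (Suc n) \<Longrightarrow> i \<le> Suc n \<Longrightarrow>
    f n (face S (Suc n) i x) = face T (Suc n) i (f (Suc n) x)"
  by (simp add: simplicial_map_def)

lemma simplicial_map_degen:
  "simplicial_map S T f \<Longrightarrow> x \<in> simplices S n \<Longrightarrow> i \<le> n \<Longrightarrow>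
    f (Suc n) (degen S n i x) = degen T n i (f n x)"
  by (simp add: simplicial_map_def)

lemma is_extension_iso:
  assumes ext: "is_extension H M \<E>\<^sub>1"
    and \<psi>: "simplicial_iso (total \<E>\<^sub>1) (total \<E>\<^sub>2) \<psi>" and S: "simplicial_set (total \<E>\<^sub>2)"
    and incl: "\<And>n w. incl \<E>\<^sub>2 n w = \<psi> n (incl \<E>\<^sub>1 n w)"
    and proj: "\<And>n e. e \<in> simplices (total \<E>\<^sub>1) n \<Longrightarrow> proj \<E>\<^sub>2 n (\<psi> n e) = proj \<E>\<^sub>1 n e"
  shows "is_extension H M \<E>\<^sub>2"
proof -
  obtain g where \<psi>m: "simplicial_map (total \<E>\<^sub>1) (total \<E>\<^sub>2) \<psi>" and g: "simplicial_map (total \<E>\<^sub>2) (total \<E>\<^sub>1) g"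
    and g\<psi>: "\<And>n x. x \<in> simplices (total \<E>\<^sub>1) n \<Longrightarrow> g n (\<psi> n x) = x"
    and \<psi>g: "\<And>n y. y \<in> simplices (total \<E>\<^sub>2) n \<Longrightarrow> \<psi> n (g n y) = y"
    using \<psi> unfolding simplicial_iso_def by blast
  note \<psi>c = simplicial_map_closed[OF \<psi>m] and gc = simplicial_map_closed[OF g]
  have proj': "proj \<E>\<^sub>1 n (g n y) = proj \<E>\<^sub>2 n y" if "y \<in> simplices (total \<E>\<^sub>2) n" for n y
    using proj[OF gc[OF that]] \<psi>g[OF that] by simp
  have fb: "fibre_bundle (nerve M) (total \<E>\<^sub>1) (nerve H) (proj \<E>\<^sub>1)"
    and fi: "simplicial_iso (nerve M) (fibre_over (total \<E>\<^sub>1) (nerve H) (proj \<E>\<^sub>1) []) (incl \<E>\<^sub>1)"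
    using ext by (simp_all add: is_extension_def)
  have pm: "simplicial_map (total \<E>\<^sub>1) (nerve H) (proj \<E>\<^sub>1)" using fb by (simp add: fibre_bundle_def)
  have "simplicial_map (total \<E>\<^sub>2) (nerve H) (\<lambda>n y. proj \<E>\<^sub>1 n (g n y))"
    using simplicial_map_comp[OF g pm] .
  then have pm2: "simplicial_map (total \<E>\<^sub>2) (nerve H) (proj \<E>\<^sub>2)"
    unfolding simplicial_map_def
    by (simp add: proj' simplicial_set.face_closed[OF S] simplicial_set.degen_closed[OF S])
  have surj: "proj \<E>\<^sub>2 n ` simplices (total \<E>\<^sub>2) n = simplices (nerve H) n" for n
  proof -
    have "\<psi> n ` simplices (total \<E>\<^sub>1) n = simplices (total \<E>\<^sub>2) n"
      using simplicial_iso_bij[OF \<psi>] by (simp add: bij_betw_def)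
    then have "proj \<E>\<^sub>2 n ` simplices (total \<E>\<^sub>2) n = (\<lambda>e. proj \<E>\<^sub>2 n (\<psi> n e)) ` simplices (total \<E>\<^sub>1) n"
      by (metis image_image)
    also have "\<dots> = proj \<E>\<^sub>1 n ` simplices (total \<E>\<^sub>1) n"
      by (rule image_cong) (simp_all add: proj)
    finally show ?thesis using fb by (simp add: fibre_bundle_def)
  qed
  have pb: "\<exists>\<phi>. simplicial_iso (sset_prod (nerve M) (std_simplex n))
                (sset_pullback (total \<E>\<^sub>2) (std_simplex n) (proj \<E>\<^sub>2) b) \<phi> \<and>
             (\<forall>k. \<forall>p\<in>simplices (sset_prod (nerve M) (std_simplex n)) k. snd (\<phi> k p) = snd p)"
    if b: "simplicial_map (std_simplex n) (nerve H) b" for n b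
  proof -
    have "\<exists>\<phi>. simplicial_iso (sset_prod (nerve M) (std_simplex n))
                (sset_pullback (total \<E>\<^sub>1) (std_simplex n) (proj \<E>\<^sub>1) b) \<phi> \<and>
             (\<forall>k. \<forall>p\<in>simplices (sset_prod (nerve M) (std_simplex n)) k. snd (\<phi> k p) = snd p)"
      using fb b by (simp add: fibre_bundle_def)
    then obtain \<phi> where \<phi>: "simplicial_iso (sset_prod (nerve M) (std_simplex n))
                (sset_pullback (total \<E>\<^sub>1) (std_simplex n) (proj \<E>\<^sub>1) b) \<phi>"
      "\<forall>k. \<forall>p\<in>simplices (sset_prod (nerve M) (std_simplex n)) k. snd (\<phi> k p) = snd p"
      by (elim exE conjE) 
    have "simplicial_iso (sset_pullback (total \<E>\<^sub>1) (std_simplex n) (proj \<E>\<^sub>1) b)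
       (sset_pullback (total \<E>\<^sub>2) (std_simplex n) (proj \<E>\<^sub>2) b) (\<lambda>n. map_prod (\<psi> n) id)"
      unfolding simplicial_iso_def
    proof (intro conjI exI[of _ "\<lambda>n. map_prod (g n) id"])
      show "simplicial_map (sset_pullback (total \<E>\<^sub>1) (std_simplex n) (proj \<E>\<^sub>1) b)
        (sset_pullback (total \<E>\<^sub>2) (std_simplex n) (proj \<E>\<^sub>2) b) (\<lambda>n. map_prod (\<psi> n) id)"
        by (auto simp: simplicial_map_def sset_pullback_simps \<psi>c proj
            simplicial_map_face[OF \<psi>m] simplicial_map_degen[OF \<psi>m])
      show "simplicial_map (sset_pullback (total \<E>\<^sub>2) (std_simplex n) (proj \<E>\<^sub>2) b)
        (sset_pullback (total \<E>\<^sub>1) (std_simplex n) (proj \<E>\<^sub>1) b) (\<lambda>n. map_prod (g n) id)"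
        by (auto simp: simplicial_map_def sset_pullback_simps gc proj'
            simplicial_map_face[OF g] simplicial_map_degen[OF g])
    qed (auto simp: sset_pullback_simps g\<psi> \<psi>g)
    from simplicial_iso_comp[OF \<phi>(1) this] \<phi>(2) show ?thesis
      by (intro exI[of _ "\<lambda>k x. map_prod (\<psi> k) id (\<phi> k x)"]) auto
  qed
  have "simplicial_iso (fibre_over (total \<E>\<^sub>1) (nerve H) (proj \<E>\<^sub>1) [])
     (fibre_over (total \<E>\<^sub>2) (nerve H) (proj \<E>\<^sub>2) []) \<psi>"
    unfolding simplicial_iso_def
  proof (intro conjI exI[of _ g])
    show "simplicial_map (fibre_over (total \<E>\<^sub>1) (nerve H) (proj \<E>\<^sub>1) [])
      (fibre_over (total \<E>\<^sub>2) (nerve H) (proj \<E>\<^sub>2) []) \<psi>"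
      by (auto simp: simplicial_map_def fibre_over_simps \<psi>c proj
          simplicial_map_face[OF \<psi>m] simplicial_map_degen[OF \<psi>m])
    show "simplicial_map (fibre_over (total \<E>\<^sub>2) (nerve H) (proj \<E>\<^sub>2) [])
      (fibre_over (total \<E>\<^sub>1) (nerve H) (proj \<E>\<^sub>1) []) g"
      by (auto simp: simplicial_map_def fibre_over_simps gc proj'
          simplicial_map_face[OF g] simplicial_map_degen[OF g])
  qed (auto simp: fibre_over_simps g\<psi> \<psi>g)
  from simplicial_iso_comp[OF fi this]
  have "simplicial_iso (nerve M) (fibre_over (total \<E>\<^sub>2) (nerve H) (proj \<E>\<^sub>2) []) (incl \<E>\<^sub>2)"
    by (simp add: incl[abs_def])
  then show ?thesis
    using ext fb S pm2 surj pb by (simp add: is_extension_def fibre_bundle_def)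
qed

definition relabel_sset :: "('p \<Rightarrow> 'e) \<Rightarrow> 'p sset \<Rightarrow> 'e sset" where
  "relabel_sset j S = (let k = inv_into (\<Union>n. simplices S n) j in \<lparr>
     simplices = \<lambda>n. j ` simplices S n,
     face = \<lambda>n i e. j (face S n i (k e)),
     degen = \<lambda>n i e. j (degen S n i (k e))\<rparr>)"

text \<open>
This moves an extension into the type in which the extensions are counted.
\<close>

lemma exists_relabelled_extension:
  fixes \<E> :: "('m, 'h, 'p) extension" and j :: "'p \<Rightarrow> 'e"
  assumes ext: "is_extension H M \<E>" and j: "inj_on j (\<Union>n. simplices (total \<E>) n)"
  shows "\<exists>\<E>' :: ('m, 'h, 'e) extension. is_extension H M \<E>' \<and> extension_equivalent M \<E> \<E>'"
proof -
  let ?U = "\<Union>n. simplices (total \<E>) n"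
  define k where "k = inv_into ?U j"
  have kj [simp]: "k (j x) = x" if "x \<in> simplices (total \<E>) n" for x n
    unfolding k_def by (rule inv_into_f_f[OF j]) (use that in auto)
  define \<E>' where "\<E>' = \<lparr>total = relabel_sset j (total \<E>), incl = \<lambda>n w. j (incl \<E> n w), proj = \<lambda>n e. proj \<E> n (k e)\<rparr>"
  have sim [simp]: "simplices (total \<E>') n = j ` simplices (total \<E>) n"
    "face (total \<E>') n i e = j (face (total \<E>) n i (k e))"
    "degen (total \<E>') n i e = j (degen (total \<E>) n i (k e))" for n i e
    by (simp_all add: \<E>'_def relabel_sset_def Let_def k_def)
  interpret S: simplicial_set "total \<E>" using ext by (simp add: is_extension_def fibre_bundle_def)
  note cl = S.face_closed S.degen_closed
  note kf = kj[OF S.face_closed] kj[OF S.degen_closed]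
  have S': "simplicial_set (total \<E>')"
  proof (unfold_locales, goal_cases)
    case (3 x n i j)
    then show ?case by (auto simp: cl kf S.face_face[OF _ 3(2,3)])
  next
    case (4 x n i j)
    then show ?case by (auto simp: cl kf S.face_degen_less[OF _ 4(2,3)])
  next
    case (5 x n j i)
    then show ?case by (auto simp: cl kf S.face_degen_same)
  next
    case (6 x n j i)
    then show ?case by (auto simp: cl kf S.face_degen_greater[OF _ 6(2,3)])
  next
    case (7 x n i j)
    then show ?case by (auto simp: cl kf S.degen_degen[OF _ 7(2,3)])
  qed (auto simp: cl)
  have iso: "simplicial_iso (total \<E>) (total \<E>') (\<lambda>_. j)"
  proof (rule simplicial_isoI[OF cl])
    show "simplicial_map (total \<E>) (total \<E>') (\<lambda>_. j)" by (auto simp: simplicial_map_def)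
    show "bij_betw j (simplices (total \<E>) n) (simplices (total \<E>') n)" for n
      using inj_on_subset[OF j, of "simplices (total \<E>) n"] by (auto simp: bij_betw_def)
  qed
  have inc: "incl \<E>' n w = j (incl \<E> n w)" for n w by (simp add: \<E>'_def)
  have pro: "proj \<E>' n (j e) = proj \<E> n e" if "e \<in> simplices (total \<E>) n" for n e
    using that by (simp add: \<E>'_def)
  have "is_extension H M \<E>'" by (rule is_extension_iso[OF ext iso S' inc pro])
  moreover have "extension_equivalent M \<E> \<E>'"
    unfolding extension_equivalent_def using iso inc pro by (intro exI[of _ "\<lambda>_. j"]) auto
  ultimately show ?thesis by blast
qed

section \<open>Twisted products\<close>

text \<open>
Homomorphisms from a partial group to a group, as functions with the default value off the carrier, so that
they can be counted.  Words of length 2 suffice, because a word of the domain can be multiplied out in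
steps of length 2.
\<close>

definition aut_homs :: "'h pgroup \<Rightarrow> 'm pgroup \<Rightarrow> ('h \<Rightarrow> 'm \<Rightarrow> 'm) set" where
  "aut_homs H M = {t \<in> pg_carrier H \<rightarrow>\<^sub>E pg_aut M.
     \<forall>a b. [a, b] \<in> pg_dom H \<longrightarrow> t (pg_prod H [a, b]) = t a \<circ> t b}"

text \<open>
The product of the two nerves, except that the last face also lets the last letter of the base word act
on the fibre.  It is the last face that carries the twist because then the fibre coordinate of a simplex
is seen from its last vertex, and dropping that vertex moves the viewpoint along the last edge of the
base simplex; no inverses appear.
\<close>

definition twisted_product :: "'h pgroup \<Rightarrow> 'm pgroup \<Rightarrow> ('h \<Rightarrow> 'm \<Rightarrow> 'm) \<Rightarrow> ('m list \<times> 'h list) sset" where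
  "twisted_product H M t = (sset_prod (nerve M) (nerve H))\<lparr>
     face := \<lambda>n i (w, b). (if i = n then map (t (last b)) (face (nerve M) n i w) else face (nerve M) n i w,
                          face (nerve H) n i b)\<rparr>"

definition twisted_extension :: "'h pgroup \<Rightarrow> 'm pgroup \<Rightarrow> ('h \<Rightarrow> 'm \<Rightarrow> 'm) \<Rightarrow> ('m, 'h, 'm list \<times> 'h list) extension" where
  "twisted_extension H M t = \<lparr>
     total = twisted_product H M t,
     incl = \<lambda>n w. (w, vertex_degen (nerve H) [] n),
     proj = \<lambda>n. snd\<rparr>"

lemma twisted_simplices: "simplices (twisted_product H M t) n = simplices (nerve M) n \<times> simplices (nerve H) n"
  and twisted_face: "i \<noteq> n \<Longrightarrow> face (twisted_product H M t) n i (w, b) = (face (nerve M) n i w, face (nerve H) n i b)"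
  and twisted_face_last: "face (twisted_product H M t) n n (w, b) =
      (map (t (last b)) (face (nerve M) n n w), face (nerve H) n n b)"
  and twisted_degen: "degen (twisted_product H M t) n i (w, b) = (degen (nerve M) n i w, degen (nerve H) n i b)"
  by (simp_all add: twisted_product_def sset_prod_def)

locale partial_group_pair = H: partial_group H + M: partial_group M
  for H :: "'h pgroup" and M :: "'m pgroup"
begin

sublocale NH: simplicial_set "nerve H" by (rule H.simplicial_set_nerve)
sublocale NM: simplicial_set "nerve M" by (rule M.simplicial_set_nerve)

lemma hom_aut: "t \<in> aut_homs H M \<Longrightarrow> x \<in> pg_carrier H \<Longrightarrow> t x \<in> pg_aut M"
  by (auto simp: aut_homs_def)

lemma hom_mult: "t \<in> aut_homs H M \<Longrightarrow> [x, y] \<in> pg_dom H \<Longrightarrow> t (pg_prod H [x, y]) = t x \<circ> t y"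
  by (simp add: aut_homs_def)

lemma hom_one: assumes "t \<in> aut_homs H M" shows "t (pg_one H) = id"
proof -
  have tt: "t (pg_one H) = t (pg_one H) \<circ> t (pg_one H)"
    using hom_mult[OF assms H.one_left_dom[OF H.one_closed]] by (simp add: H.prod_one_left H.one_closed)
  have inj: "inj (t (pg_one H))"
    using permutes_inj[OF M.aut_permutes[OF hom_aut[OF assms H.one_closed]]] .
  show ?thesis
  proof
    fix x
    have "t (pg_one H) (t (pg_one H) x) = t (pg_one H) x" using fun_cong[OF tt, of x] by simp
    then show "t (pg_one H) x = id x" using injD[OF inj] by simp
  qed
qed

lemma last_closed: "b \<in> simplices (nerve H) (Suc n) \<Longrightarrow> last b \<in> pg_carrier H"
  using H.dom_carrier[of b] last_in_set[of b] by (cases b) (auto simp: nerve_simplices)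

lemma last_face:
  assumes "b \<in> simplices (nerve H) (Suc (Suc n))"
  shows "i \<le> n \<Longrightarrow> last (face (nerve H) (Suc (Suc n)) i b) = last b"
    and "last (face (nerve H) (Suc (Suc n)) (Suc n) b) = pg_prod H [b ! n, b ! Suc n]"
    and "last (face (nerve H) (Suc (Suc n)) (Suc (Suc n)) b) = b ! n"
    and "last b = b ! Suc n"
    and "[b ! n, b ! Suc n] \<in> pg_dom H"
proof -
  have b: "b \<in> pg_dom H" "length b = Suc (Suc n)" "b \<noteq> []" using assms by (auto simp: nerve_simplices)
  show "i \<le> n \<Longrightarrow> last (face (nerve H) (Suc (Suc n)) i b) = last b"
  proof (cases "i = 0")
    case True
    moreover have "tl b \<noteq> []" using b by (cases b) auto
    ultimately show ?thesis using b last_tl[of b] by (simp add: nerve_face_first)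
  next
    case False
    assume "i \<le> n"
    then show ?thesis using b False by (simp add: nerve_face_middle)
  qed
  show "last (face (nerve H) (Suc (Suc n)) (Suc n) b) = pg_prod H [b ! n, b ! Suc n]"
    using b by (simp add: nerve_face_middle)
  show "last (face (nerve H) (Suc (Suc n)) (Suc (Suc n)) b) = b ! n"
    using b by (simp add: nerve_face_last last_conv_nth nth_butlast flip: length_greater_0_conv)
  show "last b = b ! Suc n" using b by (simp add: last_conv_nth)
  have "slice n (Suc (Suc n)) b = slice n (Suc n) b @ slice (Suc n) (Suc (Suc n)) b"
    by (rule slice_append) auto
  then show "[b ! n, b ! Suc n] \<in> pg_dom H"
    using H.slice_dom[OF b(1), of n "Suc (Suc n)"] b by (simp add: slice_Suc)
qed

lemma last_degen:
  assumes "b \<in> simplices (nerve H) n"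
  shows "i < n \<Longrightarrow> last (degen (nerve H) n i b) = last b" "last (degen (nerve H) n n b) = pg_one H"
  using assms by (auto simp: nerve_degen nerve_simplices)

context
  fixes t assumes t: "t \<in> aut_homs H M"
begin

lemma map_hom_face:
  "x \<in> pg_carrier H \<Longrightarrow> w \<in> simplices (nerve M) (Suc n) \<Longrightarrow> i \<le> Suc n \<Longrightarrow>
    face (nerve M) (Suc n) i (map (t x) w) = map (t x) (face (nerve M) (Suc n) i w)"
  using simplicial_map_face[OF M.simplicial_map_aut[OF hom_aut[OF t]]] by simp

lemma map_hom_degen:
  "x \<in> pg_carrier H \<Longrightarrow> w \<in> simplices (nerve M) n \<Longrightarrow> i \<le> n \<Longrightarrow>
    degen (nerve M) n i (map (t x) w) = map (t x) (degen (nerve M) n i w)"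
  using simplicial_map_degen[OF M.simplicial_map_aut[OF hom_aut[OF t]]] by simp

lemma map_hom_closed:
  "x \<in> pg_carrier H \<Longrightarrow> w \<in> simplices (nerve M) n \<Longrightarrow> map (t x) w \<in> simplices (nerve M) n"
  using simplicial_map_closed[OF M.simplicial_map_aut[OF hom_aut[OF t]]] by simp

text \<open>
The one identity in which two twists meet is the one for the last two faces; it holds because \<open>t\<close> is
multiplicative on the last two letters of the base word.
\<close>

lemma simplicial_set_twisted_product: "simplicial_set (twisted_product H M t)"
proof (unfold_locales, goal_cases)
  case (1 x n i)
  then show ?case
    by (cases x; cases "i = Suc n")
      (auto simp: twisted_simplices twisted_face twisted_face_last NM.face_closed NH.face_closed map_hom_closed last_closed)
next
  case (2 x n i)
  then show ?case by (cases x) (auto simp: twisted_simplices twisted_degen NM.degen_closed NH.degen_closed)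
next
  case (3 x n i j)
  obtain w b where x: "x = (w, b)" "w \<in> simplices (nerve M) (Suc (Suc n))" "b \<in> simplices (nerve H) (Suc (Suc n))"
    using 3 by (cases x) (auto simp: twisted_simplices)
  note lb = last_closed[OF x(3)] and lf = last_face[OF x(3)]
  note fM = NM.face_face[OF x(2) 3(2,3)] and fH = NH.face_face[OF x(3) 3(2,3)]
  consider "j \<le> Suc n" | "j = Suc (Suc n)" "i \<le> n" | "j = Suc (Suc n)" "i = Suc n" using 3 by linarith
  then show ?case
  proof cases
    case 1
    then show ?thesis using 3 fM fH by (simp add: x twisted_face)
  next
    case 2
    then show ?thesis using 3 fM fH lb lf(1)
      by (simp add: x twisted_face twisted_face_last map_hom_face NM.face_closed)
  next
    case 3
    have "b ! n \<in> pg_carrier H" "b ! Suc n \<in> pg_carrier H" using H.dom_carrier[OF lf(5)] by auto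
    then show ?thesis using 3 fM fH lf(2-5) x(2)
      by (simp add: x(1) twisted_face twisted_face_last map_hom_face NM.face_closed hom_mult[OF t])
  qed
next
  case (4 x n i j)
  obtain w b where x: "x = (w, b)" "w \<in> simplices (nerve M) (Suc n)" "b \<in> simplices (nerve H) (Suc n)"
    using 4 by (cases x) (auto simp: twisted_simplices)
  show ?case using 4 NM.face_degen_less[OF x(2) 4(2,3)] NH.face_degen_less[OF x(3) 4(2,3)]
    by (simp add: x twisted_face twisted_degen)
next
  case (5 x n j i)
  obtain w b where x: "x = (w, b)" "w \<in> simplices (nerve M) n" "b \<in> simplices (nerve H) n"
    using 5 by (cases x) (auto simp: twisted_simplices)
  show ?case
    using 5 NM.face_degen_same[OF x(2) 5(2,3)] NH.face_degen_same[OF x(3) 5(2,3)] last_degen(2)[OF x(3)]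
    by (cases "i = Suc n") (auto simp: x(1) twisted_face twisted_face_last twisted_degen hom_one[OF t])
next
  case (6 x n j i)
  obtain w b where x: "x = (w, b)" "w \<in> simplices (nerve M) (Suc n)" "b \<in> simplices (nerve H) (Suc n)"
    using 6 by (cases x) (auto simp: twisted_simplices)
  have fM: "face (nerve M) (Suc (Suc n)) i (degen (nerve M) (Suc n) j w) = degen (nerve M) n j (face (nerve M) (Suc n) (i - 1) w)"
    and fH: "face (nerve H) (Suc (Suc n)) i (degen (nerve H) (Suc n) j b) = degen (nerve H) n j (face (nerve H) (Suc n) (i - 1) b)"
    using NM.face_degen_greater[OF x(2) 6(2,3)] NH.face_degen_greater[OF x(3) 6(2,3)] by auto
  show ?case
  proof (cases "i = Suc (Suc n)")
    case True
    then show ?thesis using 6 fM fH last_degen(1)[OF x(3), of j] last_closed[OF x(3)] x(2)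
      by (simp add: x(1) twisted_face_last twisted_degen map_hom_degen NM.face_closed)
  next
    case False
    then show ?thesis using 6 fM fH
      by (simp add: x(1) twisted_face twisted_degen)
  qed
next
  case (7 x n i j)
  then show ?case using NM.degen_degen NH.degen_degen
    by (cases x) (auto simp: twisted_simplices twisted_degen)
qed

end

end

section \<open>Local trivialisations\<close>

text \<open>
A trivialisation of the bundle over a simplex \<open>b\<close> of the base, given by its component in the total space.
The next lemma and \<open>pullback_iso_of_local_triv\<close> relate it to isomorphisms \<open>F \<times> \<Delta>[n] \<cong> E\<^sub>b\<close> over \<open>\<Delta>[n]\<close>.
\<close>

definition local_triv ::
  "'m pgroup \<Rightarrow> ('m, 'h, 'e) extension \<Rightarrow> nat \<Rightarrow> (nat \<Rightarrow> nat list \<Rightarrow> 'h list) \<Rightarrow> (nat \<Rightarrow> 'm list \<times> nat list \<Rightarrow> 'e) \<Rightarrow> bool" where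
  "local_triv M \<E> n b \<sigma> \<longleftrightarrow>
     simplicial_map (sset_prod (nerve M) (std_simplex n)) (total \<E>) \<sigma> \<and>
     (\<forall>k. \<forall>l\<in>simplices (std_simplex n) k.
        bij_betw (\<lambda>w. \<sigma> k (w, l)) (simplices (nerve M) k) {e \<in> simplices (total \<E>) k. proj \<E> k e = b k l})"

lemma local_triv_of_pullback_iso:
  assumes \<phi>: "simplicial_iso (sset_prod (nerve M) (std_simplex n)) (sset_pullback (total \<E>) (std_simplex n) (proj \<E>) b) \<phi>"
    and snd: "\<forall>k. \<forall>p\<in>simplices (sset_prod (nerve M) (std_simplex n)) k. snd (\<phi> k p) = snd p"
  shows "local_triv M \<E> n b (\<lambda>k p. fst (\<phi> k p))"
proof -
  let ?P = "sset_prod (nerve M) (std_simplex n)" and ?Q = "sset_pullback (total \<E>) (std_simplex n) (proj \<E>) b"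
  have m: "simplicial_map ?P ?Q \<phi>" using \<phi> by (simp add: simplicial_iso_def)
  have bij: "bij_betw (\<phi> k) (simplices ?P k) (simplices ?Q k)" for k using simplicial_iso_bij[OF \<phi>] .
  have "simplicial_map ?Q (total \<E>) (\<lambda>_. fst)" by (auto simp: simplicial_map_def sset_pullback_simps)
  from simplicial_map_comp[OF m this] have "simplicial_map ?P (total \<E>) (\<lambda>k p. fst (\<phi> k p))" .
  moreover have "bij_betw (\<lambda>w. fst (\<phi> k (w, l))) (simplices (nerve M) k) {e \<in> simplices (total \<E>) k. proj \<E> k e = b k l}"
    if l: "l \<in> simplices (std_simplex n) k" for k l
  proof (rule bij_betw_imageI)
    have pair: "\<phi> k (w, l) = (fst (\<phi> k (w, l)), l)" if "w \<in> simplices (nerve M) k" for w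
      using snd[rule_format, of "(w, l)" k] l that by (simp add: prod_simplices prod_eq_iff)
    show "inj_on (\<lambda>w. fst (\<phi> k (w, l))) (simplices (nerve M) k)"
    proof (rule inj_onI)
      fix v w assume vw: "v \<in> simplices (nerve M) k" "w \<in> simplices (nerve M) k" "fst (\<phi> k (v, l)) = fst (\<phi> k (w, l))"
      then have "\<phi> k (v, l) = \<phi> k (w, l)" using pair by metis
      then show "v = w" using bij[of k] vw l by (auto simp: bij_betw_def prod_simplices dest: inj_onD)
    qed
    show "(\<lambda>w. fst (\<phi> k (w, l))) ` simplices (nerve M) k = {e \<in> simplices (total \<E>) k. proj \<E> k e = b k l}"
    proof (intro equalityI subsetI)
      fix e assume "e \<in> (\<lambda>w. fst (\<phi> k (w, l))) ` simplices (nerve M) k"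
      then obtain w where w: "w \<in> simplices (nerve M) k" "e = fst (\<phi> k (w, l))" by blast
      then have "(e, l) \<in> simplices ?Q k"
        using simplicial_map_closed[OF m, of "(w, l)" k] pair l by (simp add: prod_simplices)
      then show "e \<in> {e \<in> simplices (total \<E>) k. proj \<E> k e = b k l}" by (simp add: sset_pullback_simps)
    next
      fix e assume "e \<in> {e \<in> simplices (total \<E>) k. proj \<E> k e = b k l}"
      then have "(e, l) \<in> \<phi> k ` simplices ?P k" using bij[of k] l by (simp add: bij_betw_def sset_pullback_simps)
      then obtain p where p: "p \<in> simplices ?P k" "\<phi> k p = (e, l)" by auto
      moreover have "snd p = l" using snd[rule_format, OF p(1)] p(2) by simp
      ultimately show "e \<in> (\<lambda>w. fst (\<phi> k (w, l))) ` simplices (nerve M) k"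
        by (cases p) (auto simp: prod_simplices intro!: rev_image_eqI)
    qed
  qed
  ultimately show ?thesis by (simp add: local_triv_def)
qed

lemma local_triv_map: "local_triv M \<E> n b \<sigma> \<Longrightarrow> simplicial_map (sset_prod (nerve M) (std_simplex n)) (total \<E>) \<sigma>"
  unfolding local_triv_def by (rule conjunct1)

lemma local_triv_bij:
  "local_triv M \<E> n b \<sigma> \<Longrightarrow> l \<in> simplices (std_simplex n) k \<Longrightarrow>
    bij_betw (\<lambda>w. \<sigma> k (w, l)) (simplices (nerve M) k) {e \<in> simplices (total \<E>) k. proj \<E> k e = b k l}"
  unfolding local_triv_def by blast

lemma local_triv_closed:
  assumes "local_triv M \<E> n b \<sigma>" "l \<in> simplices (std_simplex n) k" "w \<in> simplices (nerve M) k"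
  shows "\<sigma> k (w, l) \<in> simplices (total \<E>) k" "proj \<E> k (\<sigma> k (w, l)) = b k l"
  using bij_betwE[OF local_triv_bij[OF assms(1,2)]] assms(3) by simp_all

lemma local_triv_face:
  assumes "local_triv M \<E> n b \<sigma>" "l \<in> simplices (std_simplex n) (Suc k)" "w \<in> simplices (nerve M) (Suc k)" "i \<le> Suc k"
  shows "face (total \<E>) (Suc k) i (\<sigma> (Suc k) (w, l)) = \<sigma> k (face (nerve M) (Suc k) i w, face (std_simplex n) (Suc k) i l)"
proof -
  have "(w, l) \<in> simplices (sset_prod (nerve M) (std_simplex n)) (Suc k)" using assms(2,3) by (simp add: prod_simplices)
  from simplicial_map_face[OF local_triv_map[OF assms(1)] this assms(4)] show ?thesis by (simp add: prod_face)
qed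

lemma local_triv_degen:
  assumes "local_triv M \<E> n b \<sigma>" "l \<in> simplices (std_simplex n) k" "w \<in> simplices (nerve M) k" "i \<le> k"
  shows "degen (total \<E>) k i (\<sigma> k (w, l)) = \<sigma> (Suc k) (degen (nerve M) k i w, degen (std_simplex n) k i l)"
proof -
  have "(w, l) \<in> simplices (sset_prod (nerve M) (std_simplex n)) k" using assms(2,3) by (simp add: prod_simplices)
  from simplicial_map_degen[OF local_triv_map[OF assms(1)] this assms(4)] show ?thesis by (simp add: prod_degen)
qed

context partial_group_pair
begin

lemma prod_std_closed:
  "x \<in> simplices (sset_prod (nerve M) (std_simplex n)) (Suc k) \<Longrightarrow> i \<le> Suc k \<Longrightarrow>
    face (sset_prod (nerve M) (std_simplex n)) (Suc k) i x \<in> simplices (sset_prod (nerve M) (std_simplex n)) k"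
  "x \<in> simplices (sset_prod (nerve M) (std_simplex n)) k \<Longrightarrow> i \<le> k \<Longrightarrow>
    degen (sset_prod (nerve M) (std_simplex n)) k i x \<in> simplices (sset_prod (nerve M) (std_simplex n)) (Suc k)"
proof -
  interpret D: simplicial_set "std_simplex n" by (rule simplicial_set_std_simplex)
  assume "i \<le> Suc k" "x \<in> simplices (sset_prod (nerve M) (std_simplex n)) (Suc k)"
  then show "face (sset_prod (nerve M) (std_simplex n)) (Suc k) i x \<in> simplices (sset_prod (nerve M) (std_simplex n)) k"
    by (cases x) (simp add: prod_simplices prod_face NM.face_closed D.face_closed)
next
  interpret D: simplicial_set "std_simplex n" by (rule simplicial_set_std_simplex)
  assume "i \<le> k" "x \<in> simplices (sset_prod (nerve M) (std_simplex n)) k"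
  then show "degen (sset_prod (nerve M) (std_simplex n)) k i x \<in> simplices (sset_prod (nerve M) (std_simplex n)) (Suc k)"
    by (cases x) (simp add: prod_simplices prod_degen NM.degen_closed D.degen_closed)
qed

lemma pullback_iso_of_local_triv:
  assumes \<sigma>: "local_triv M \<E> n b \<sigma>"
  shows "simplicial_iso (sset_prod (nerve M) (std_simplex n)) (sset_pullback (total \<E>) (std_simplex n) (proj \<E>) b)
    (\<lambda>k p. (\<sigma> k p, snd p))"
proof (rule simplicial_isoI[OF prod_std_closed])
  let ?P = "sset_prod (nerve M) (std_simplex n)" and ?Q = "sset_pullback (total \<E>) (std_simplex n) (proj \<E>) b"
  show "simplicial_map ?P ?Q (\<lambda>k p. (\<sigma> k p, snd p))"
    unfolding simplicial_map_def
  proof (intro conjI allI ballI impI)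
    fix k p assume "p \<in> simplices ?P k"
    then show "(\<sigma> k p, snd p) \<in> simplices ?Q k"
      by (cases p) (simp add: prod_simplices sset_pullback_simps local_triv_closed[OF \<sigma>])
  next
    fix k p i assume "p \<in> simplices ?P (Suc k)" "i \<le> Suc k"
    then show "(\<sigma> k (face ?P (Suc k) i p), snd (face ?P (Suc k) i p)) = face ?Q (Suc k) i (\<sigma> (Suc k) p, snd p)"
      by (cases p) (simp add: prod_simplices sset_pullback_simps prod_face local_triv_face[OF \<sigma>])
  next
    fix k p i assume "p \<in> simplices ?P k" "i \<le> k"
    then show "(\<sigma> (Suc k) (degen ?P k i p), snd (degen ?P k i p)) = degen ?Q k i (\<sigma> k p, snd p)"
      by (cases p) (simp add: prod_simplices sset_pullback_simps prod_degen local_triv_degen[OF \<sigma>])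
  qed
  show "bij_betw (\<lambda>p. (\<sigma> k p, snd p)) (simplices ?P k) (simplices ?Q k)" for k
  proof (rule bij_betw_imageI)
    show "inj_on (\<lambda>p. (\<sigma> k p, snd p)) (simplices ?P k)"
    proof (rule inj_onI)
      fix p q assume pq: "p \<in> simplices ?P k" "q \<in> simplices ?P k" "(\<sigma> k p, snd p) = (\<sigma> k q, snd q)"
      then obtain v w l where "p = (v, l)" "q = (w, l)" "l \<in> simplices (std_simplex n) k"
        by (cases p; cases q) (simp add: prod_simplices)
      with pq show "p = q" using inj_onD[OF bij_betw_imp_inj_on[OF local_triv_bij[OF \<sigma>]], of l k v w]
        by (simp add: prod_simplices)
    qed
    show "(\<lambda>p. (\<sigma> k p, snd p)) ` simplices ?P k = simplices ?Q k"
    proof (intro equalityI subsetI)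
      fix q assume "q \<in> simplices ?Q k"
      then obtain e l where q: "q = (e, l)" "l \<in> simplices (std_simplex n) k" "e \<in> {e \<in> simplices (total \<E>) k. proj \<E> k e = b k l}"
        by (auto simp: sset_pullback_simps)
      then have "e \<in> (\<lambda>w. \<sigma> k (w, l)) ` simplices (nerve M) k"
        using bij_betw_imp_surj_on[OF local_triv_bij[OF \<sigma> q(2)]] by simp
      then obtain w where "w \<in> simplices (nerve M) k" "e = \<sigma> k (w, l)" by (rule imageE)
      then show "q \<in> (\<lambda>p. (\<sigma> k p, snd p)) ` simplices ?P k"
        using q by (intro image_eqI[of _ _ "(w, l)"]) (simp_all add: prod_simplices)
    next
      fix q assume "q \<in> (\<lambda>p. (\<sigma> k p, snd p)) ` simplices ?P k"
      then show "q \<in> simplices ?Q k" by (auto simp: prod_simplices sset_pullback_simps local_triv_closed[OF \<sigma>])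
    qed
  qed
qed

end

text \<open>
The letter by which a simplicial map from \<open>\<Delta>[n]\<close> to a nerve labels the edge from \<open>i\<close> to \<open>j\<close>.
\<close>

definition base_edge :: "(nat \<Rightarrow> nat list \<Rightarrow> 'h list) \<Rightarrow> nat \<Rightarrow> nat \<Rightarrow> 'h" where
  "base_edge b i j = hd (b 1 [i, j])"

context partial_group
begin

context
  fixes n and b :: "nat \<Rightarrow> nat list \<Rightarrow> 'a list"
  assumes b: "simplicial_map (std_simplex n) (nerve M) b"
begin

lemma base_edge_eq:
  assumes "i \<le> j" "j \<le> n" shows "b 1 [i, j] = [base_edge b i j]"
  using simplicial_map_closed[OF b, of "[i, j]" 1] assms
  by (cases "b 1 [i, j]") (auto simp: std_simplices nerve_simplices base_edge_def)

lemma base_edge_closed: "i \<le> j \<Longrightarrow> j \<le> n \<Longrightarrow> base_edge b i j \<in> pg_carrier M"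
  using simplicial_map_closed[OF b, of "[i, j]" 1] base_edge_eq[of i j] dom_carrier[of "b 1 [i, j]"]
  by (auto simp: std_simplices nerve_simplices)

lemma base_triangle:
  assumes "i \<le> j" "j \<le> k" "k \<le> n"
  shows "b 2 [i, j, k] = [base_edge b i j, base_edge b j k]"
    and "[base_edge b i j, base_edge b j k] \<in> pg_dom M"
    and "base_edge b i k = pg_prod M [base_edge b i j, base_edge b j k]"
proof -
  have s: "[i, j, k] \<in> simplices (std_simplex n) (Suc 1)" using assms by (auto simp: std_simplices)
  have f: "b 1 (face (std_simplex n) (Suc 1) m [i, j, k]) = face (nerve M) (Suc 1) m (b (Suc 1) [i, j, k])" if "m \<le> Suc 1" for m
    using simplicial_map_face[OF b s that] .
  have l: "b (Suc 1) [i, j, k] \<in> pg_dom M" "length (b (Suc 1) [i, j, k]) = 2"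
    using simplicial_map_closed[OF b s] by (auto simp: nerve_simplices)
  then obtain x y where xy: "b (Suc 1) [i, j, k] = [x, y]" by (auto simp: length_Suc_conv numeral_2_eq_2)
  have "y = base_edge b j k" using f[of 0] base_edge_eq[of j k] assms xy by (simp add: std_face nerve_face_first)
  moreover have "x = base_edge b i j" using f[of "Suc 1"] base_edge_eq[of i j] assms xy
    nerve_face_last[of M 1 "[x, y]"] by (simp add: std_face)
  moreover have "base_edge b i k = pg_prod M [x, y]" using f[of 1] base_edge_eq[of i k] assms xy
    by (simp add: std_face nerve_face_middle)
  ultimately show "b 2 [i, j, k] = [base_edge b i j, base_edge b j k]"
    "[base_edge b i j, base_edge b j k] \<in> pg_dom M"
    "base_edge b i k = pg_prod M [base_edge b i j, base_edge b j k]"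
    using xy l by (simp_all add: numeral_2_eq_2)
qed

lemma last_base:
  "l \<in> simplices (std_simplex n) (Suc k) \<Longrightarrow> last (b (Suc k) l) = base_edge b (l ! k) (l ! Suc k)"
proof (induction k arbitrary: l)
  case 0
  then obtain i j where "l = [i, j]" "i \<le> j" "j \<le> n" by (auto simp: std_simplices length_Suc_conv)
  then show ?case using base_edge_eq[of i j] by simp
next
  case (Suc k)
  have "tl l \<in> simplices (std_simplex n) (Suc k)"
    using simplicial_set.face_closed[OF simplicial_set_std_simplex Suc.prems, of 0]
    by (simp add: std_face drop_Suc)
  from Suc.IH[OF this] have "last (b (Suc k) (tl l)) = base_edge b (l ! Suc k) (l ! Suc (Suc k))"
    using Suc.prems by (simp add: nth_tl std_simplices)
  moreover have "b (Suc k) (tl l) = tl (b (Suc (Suc k)) l)"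
    using simplicial_map_face[OF b Suc.prems, of 0] by (simp add: std_face nerve_face_first drop_Suc)
  moreover have "tl (b (Suc (Suc k)) l) \<noteq> []"
    using simplicial_map_closed[OF b Suc.prems] by (cases "b (Suc (Suc k)) l") (auto simp: nerve_simplices)
  ultimately show ?case by (simp add: last_tl)
qed

end

end

lemma (in simplicial_set) vertex_degen_closed: "v \<in> simplices S 0 \<Longrightarrow> vertex_degen S v n \<in> simplices S n"
  by (induction n) (auto intro: degen_closed)

lemma (in simplicial_set) vertex_degen_face:
  assumes v: "v \<in> simplices S 0"
  shows "i \<le> Suc n \<Longrightarrow> face S (Suc n) i (vertex_degen S v (Suc n)) = vertex_degen S v n"
proof (induction n arbitrary: i)
  case 0
  then show ?case using face_degen_same[OF v, of 0 i] by (simp add: le_Suc_eq)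
next
  case (Suc n)
  show ?case
  proof (cases "i \<le> 1")
    case True
    then show ?thesis using face_degen_same[OF vertex_degen_closed[OF v], of 0 "Suc n" i] by (simp add: le_Suc_eq)
  next
    case False
    then show ?thesis
      using face_degen_greater[OF vertex_degen_closed[OF v], of 0 i n] Suc.IH[of "i - 1"] Suc.prems by simp
  qed
qed

lemma (in simplicial_set) vertex_degen_degen:
  assumes v: "v \<in> simplices S 0"
  shows "i \<le> n \<Longrightarrow> degen S n i (vertex_degen S v n) = vertex_degen S v (Suc n)"
proof (induction n arbitrary: i)
  case (Suc n)
  show ?case
  proof (cases i)
    case (Suc j)
    then show ?thesis
      using degen_degen[OF vertex_degen_closed[OF v], of 0 j n] Suc.IH[of j] Suc.prems by simp
  qed simp
qed simp

context partial_group_pair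
begin

text \<open>
The fibre over a simplex \<open>l\<close> of \<open>\<Delta>[n]\<close> is transported along the edge from the last vertex of \<open>l\<close> to \<open>n\<close>.
This cancels the twist of the last face, since transport is multiplicative on the triangle formed by
the last two vertices of \<open>l\<close> and \<open>n\<close>.
\<close>

lemma twisted_local_triv:
  assumes t: "t \<in> aut_homs H M" and b: "simplicial_map (std_simplex n) (nerve H) b"
  shows "local_triv M (twisted_extension H M t) n b (\<lambda>k (w, l). (map (t (base_edge b (last l) n)) w, b k l))"
proof -
  let ?\<sigma> = "\<lambda>k (w, l). (map (t (base_edge b (last l) n)) w, b k l)"
  let ?P = "sset_prod (nerve M) (std_simplex n)" and ?T = "twisted_product H M t"
  have lst: "last l \<le> n" if "l \<in> simplices (std_simplex n) k" for l k
  proof -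
    have "l \<noteq> []" "set l \<subseteq> {..n}" using that by (auto simp: std_simplices)
    then show ?thesis using last_in_set by fastforce
  qed
  have ec: "base_edge b (last l) n \<in> pg_carrier H" if "l \<in> simplices (std_simplex n) k" for l k
    using H.base_edge_closed[OF b lst[OF that]] by simp
  have "simplicial_map ?P ?T ?\<sigma>"
    unfolding simplicial_map_def
  proof (intro conjI allI ballI impI)
    fix k x assume "x \<in> simplices ?P k"
    then show "?\<sigma> k x \<in> simplices ?T k"
      using map_hom_closed[OF t ec] simplicial_map_closed[OF b] by (auto simp: prod_simplices twisted_simplices)
  next
    fix k x i assume "x \<in> simplices ?P (Suc k)" and i: "i \<le> Suc k"
    then obtain w l where x: "x = (w, l)" "w \<in> simplices (nerve M) (Suc k)" "l \<in> simplices (std_simplex n) (Suc k)"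
      by (auto simp: prod_simplices)
    have len: "length l = Suc (Suc k)" and srt: "sorted l" using x(3) by (auto simp: std_simplices)
    have fb: "b k (face (std_simplex n) (Suc k) i l) = face (nerve H) (Suc k) i (b (Suc k) l)"
      by (rule simplicial_map_face[OF b x(3) i])
    show "?\<sigma> k (face ?P (Suc k) i x) = face ?T (Suc k) i (?\<sigma> (Suc k) x)"
    proof (cases "i = Suc k")
      case False
      have "last (face (std_simplex n) (Suc k) i l) = last l" using False i len by (simp add: std_face)
      then show ?thesis using False i fb ec[OF x(3)] x(2)
        by (simp add: x(1) prod_face twisted_face map_hom_face[OF t])
    next
      case True
      have ll: "last l = l ! Suc k" using len by (simp add: last_conv_nth flip: length_greater_0_conv)
      have "last (face (std_simplex n) (Suc k) i l) = l ! k"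
        using True len by (simp add: std_face take_Suc_conv_app_nth)
      moreover have "l ! k \<le> l ! Suc k" using srt len by (simp add: sorted_iff_nth_mono)
      ultimately have "t (base_edge b (last (face (std_simplex n) (Suc k) i l)) n) =
          t (last (b (Suc k) l)) \<circ> t (base_edge b (last l) n)"
        using H.base_triangle[OF b, of "l ! k" "l ! Suc k" n] lst[OF x(3)] H.last_base[OF b x(3)] ll
        by (simp add: hom_mult[OF t])
      then show ?thesis using True fb ec[OF x(3)] x(2)
        by (simp add: x(1) prod_face twisted_face_last map_hom_face[OF t])
    qed
  next
    fix k x i assume "x \<in> simplices ?P k" and i: "i \<le> k"
    then obtain w l where x: "x = (w, l)" "w \<in> simplices (nerve M) k" "l \<in> simplices (std_simplex n) k"
      by (auto simp: prod_simplices)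
    have "last (degen (std_simplex n) k i l) = last l" using i x(3) by (simp add: std_degen std_simplices)
    then show "?\<sigma> (Suc k) (degen ?P k i x) = degen ?T k i (?\<sigma> k x)"
      using simplicial_map_degen[OF b x(3) i] ec[OF x(3)] x(2) i
      by (simp add: x(1) prod_degen twisted_degen map_hom_degen[OF t])
  qed
  moreover have "bij_betw (\<lambda>w. ?\<sigma> k (w, l)) (simplices (nerve M) k) {e \<in> simplices ?T k. snd e = b k l}"
    if l: "l \<in> simplices (std_simplex n) k" for k l
  proof -
    have "bij_betw (\<lambda>w. (w, b k l)) (simplices (nerve M) k) {e \<in> simplices ?T k. snd e = b k l}"
      using simplicial_map_closed[OF b l] by (auto simp: bij_betw_def inj_on_def twisted_simplices)
    from bij_betw_trans[OF M.bij_betw_aut[OF hom_aut[OF t ec[OF l]]] this]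
    show ?thesis by (simp add: comp_def)
  qed
  ultimately show ?thesis by (simp add: local_triv_def twisted_extension_def)
qed

lemma is_extension_twisted:
  assumes t: "t \<in> aut_homs H M" shows "is_extension H M (twisted_extension H M t)"
proof -
  let ?E = "twisted_extension H M t" and ?T = "twisted_product H M t"
  have E: "total ?E = ?T" "proj ?E = (\<lambda>_. snd)" "\<And>n w. incl ?E n w = (w, vertex_degen (nerve H) [] n)"
    by (simp_all add: twisted_extension_def)
  note vd = H.vertex_degen_nerve
  have v: "vertex_degen (nerve H) [] n \<in> simplices (nerve H) n" for n
    by (simp add: vd nerve_simplices H.replicate_one_dom)
  have ne: "replicate n (pg_one M) \<in> simplices (nerve M) n" for n
    by (simp add: nerve_simplices M.replicate_one_dom)
  have pm: "simplicial_map ?T (nerve H) (\<lambda>_. snd)"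
    unfolding simplicial_map_def
  proof (intro conjI allI ballI impI)
    fix n x i assume "x \<in> simplices ?T (Suc n)" "i \<le> Suc n"
    then show "snd (face ?T (Suc n) i x) = face (nerve H) (Suc n) i (snd x)"
      by (cases x; cases "i = Suc n") (auto simp: twisted_face twisted_face_last)
  qed (auto simp: twisted_simplices twisted_degen)
  have "snd ` simplices ?T n = simplices (nerve H) n" for n
    using ne[of n] by (force simp: twisted_simplices)
  moreover have "\<exists>\<phi>. simplicial_iso (sset_prod (nerve M) (std_simplex n))
                (sset_pullback ?T (std_simplex n) (\<lambda>_. snd) b) \<phi> \<and>
             (\<forall>k. \<forall>p\<in>simplices (sset_prod (nerve M) (std_simplex n)) k. snd (\<phi> k p) = snd p)"
    if "simplicial_map (std_simplex n) (nerve H) b" for n b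
    using pullback_iso_of_local_triv[OF twisted_local_triv[OF t that]] unfolding E by force
  ultimately have "fibre_bundle (nerve M) ?T (nerve H) (\<lambda>_. snd)"
    using simplicial_set_twisted_product[OF t] NH.simplicial_set_axioms NM.simplicial_set_axioms pm
    by (simp add: fibre_bundle_def)
  moreover have "simplicial_iso (nerve M) (fibre_over ?T (nerve H) (\<lambda>_. snd) []) (incl ?E)"
  proof (rule simplicial_isoI)
    have v0: "[] \<in> simplices (nerve H) 0" using v[of 0] by simp
    note vf = NH.vertex_degen_face[OF v0] and vdg = NH.vertex_degen_degen[OF v0]
    have "face ?T (Suc n) i (w, vertex_degen (nerve H) [] (Suc n)) = (face (nerve M) (Suc n) i w, vertex_degen (nerve H) [] n)"
      if "i \<le> Suc n" for n i w
    proof (cases "i = Suc n")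
      case True
      have "last (vertex_degen (nerve H) [] (Suc n)) = pg_one H" by (simp only: vd last_replicate)
      then show ?thesis using vf[OF that] True
        by (simp add: twisted_face_last hom_one[OF t] del: vertex_degen.simps)
    next
      case False
      then show ?thesis using vf[OF that] by (simp add: twisted_face del: vertex_degen.simps)
    qed
    then show "simplicial_map (nerve M) (fibre_over ?T (nerve H) (\<lambda>_. snd) []) (incl ?E)"
      using v by (auto simp: simplicial_map_def E fibre_over_simps twisted_simplices twisted_degen vdg NM.face_closed NM.degen_closed
          simp del: vertex_degen.simps)
    show "bij_betw (incl ?E n) (simplices (nerve M) n) (simplices (fibre_over ?T (nerve H) (\<lambda>_. snd) []) n)" for n
      using v[of n] by (auto simp: bij_betw_def inj_on_def E fibre_over_simps twisted_simplices)
  qed (simp_all add: NM.face_closed NM.degen_closed)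
  ultimately show ?thesis
    using H.partial_group_axioms M.partial_group_axioms by (simp add: is_extension_def E)
qed

end

section \<open>Rigidity of the fibre\<close>

lemma simplicial_iso_inverse:
  assumes "simplicial_iso S T f"
  obtains g where "simplicial_iso T S g" "\<And>n x. x \<in> simplices S n \<Longrightarrow> g n (f n x) = x"
    "\<And>n y. y \<in> simplices T n \<Longrightarrow> f n (g n y) = y"
  using assms unfolding simplicial_iso_def by blast

lemma simplicial_iso_map: "simplicial_iso S T f \<Longrightarrow> simplicial_map S T f"
  by (simp add: simplicial_iso_def)

lemma std_edge:
  assumes "x \<in> simplices (std_simplex n) 1" obtains i j where "x = [i, j]" "i \<le> j" "j \<le> n"
proof -
  obtain i j where x: "x = [i, j]" using assms by (auto simp: std_simplices length_Suc_conv)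
  then show ?thesis using assms that by (simp add: std_simplices)
qed

lemma constant_simplex: "v \<le> n \<Longrightarrow> replicate (Suc k) v \<in> simplices (std_simplex n) k"
  by (auto simp: std_simplices)

lemma constant_simplex_face:
  "i \<le> Suc k \<Longrightarrow> face (std_simplex n) (Suc k) i (replicate (Suc (Suc k)) v) = replicate (Suc k) v"
  by (auto simp: std_face min_def simp flip: replicate_add simp del: replicate_Suc)

lemma constant_simplex_degen:
  "i \<le> k \<Longrightarrow> degen (std_simplex n) k i (replicate (Suc k) v) = replicate (Suc (Suc k)) v"
  by (auto simp: std_degen min_def simp flip: replicate_add simp del: replicate_Suc)

lemma map_std_constant:
  assumes b: "simplicial_map (std_simplex n) S b" and v: "v \<le> n"
  shows "b k (replicate (Suc k) v) = vertex_degen S (b 0 [v]) k"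
proof (induction k)
  case (Suc k)
  have "b (Suc k) (replicate (Suc (Suc k)) v) = degen S k 0 (b k (replicate (Suc k) v))"
    using simplicial_map_degen[OF b constant_simplex[OF v], of 0 k] by (simp add: constant_simplex_degen del: replicate_Suc)
  then show ?case using Suc.IH by simp
qed simp

lemma map_std_simplex:
  assumes \<theta>: "mono_on {..m} \<theta>" "\<theta> ` {..m} \<subseteq> {..n}"
  shows "simplicial_map (std_simplex m) (std_simplex n) (\<lambda>_. map \<theta>)"
proof -
  have "map \<theta> l \<in> simplices (std_simplex n) k" if "l \<in> simplices (std_simplex m) k" for l k
  proof -
    have l: "length l = Suc k" "sorted l" "set l \<subseteq> {..m}" using that by (auto simp: std_simplices)
    have "sorted (map \<theta> l)"
      unfolding sorted_iff_nth_mono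
    proof (intro allI impI)
      fix i j assume ij: "i \<le> j" "j < length (map \<theta> l)"
      then have "l ! i \<le> l ! j" using sorted_nth_mono[OF l(2), of i j] by simp
      moreover have "l ! i \<in> set l" "l ! j \<in> set l" using ij by auto
      then have "l ! i \<in> {..m}" "l ! j \<in> {..m}" using l(3) by blast+
      ultimately show "map \<theta> l ! i \<le> map \<theta> l ! j" using ij \<theta>(1) by (simp add: mono_on_def)
    qed
    moreover have "set (map \<theta> l) \<subseteq> {..n}" using l(3) \<theta>(2) by auto
    ultimately show ?thesis using l(1) by (simp add: std_simplices)
  qed
  then show ?thesis by (simp add: simplicial_map_def std_face std_degen take_map drop_map)
qed

context partial_group
begin

text \<open>
A form of the Yoneda lemma.  By \<open>nerve_map_eqI\<close> it suffices to treat edges.  Intervals are iterated outer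
faces of the top simplex, and the label of a long edge is the product of the labels of short ones.
\<close>

lemma map_std_nerve_eqI:
  assumes f: "simplicial_map (std_simplex m) (nerve M) f" and g: "simplicial_map (std_simplex m) (nerve M) g"
    and top: "f m [0..<Suc m] = g m [0..<Suc m]"
    and l: "l \<in> simplices (std_simplex m) k"
  shows "f k l = g k l"
proof -
  interpret D: simplicial_set "std_simplex m" by (rule simplicial_set_std_simplex)
  have interval: "[i..<Suc j] \<in> simplices (std_simplex m) (j - i)" if "i \<le> j" "j \<le> m" for i j
    using that by (auto simp: std_simplices simp del: upt_Suc)
  have initial: "f j [0..<Suc j] = g j [0..<Suc j]" if "j \<le> m" for j
    using that
  proof (induction rule: inc_induct)
    case (step j)
    have s: "[0..<Suc (Suc j)] \<in> simplices (std_simplex m) (Suc j)" using interval[of 0 "Suc j"] step by simp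
    have "face (std_simplex m) (Suc j) (Suc j) [0..<Suc (Suc j)] = [0..<Suc j]" by (simp add: std_face)
    then show ?case
      using simplicial_map_face[OF f s, of "Suc j"] simplicial_map_face[OF g s, of "Suc j"] step.IH by simp
  qed (rule top)
  have intervals: "f (j - i) [i..<Suc j] = g (j - i) [i..<Suc j]" if "i \<le> j" "j \<le> m" for i j
    using that
  proof (induction i)
    case 0
    then show ?case using initial[of j] by (simp del: upt_Suc)
  next
    case (Suc i)
    have ji: "j - i = Suc (j - Suc i)" using Suc.prems by simp
    have s: "[i..<Suc j] \<in> simplices (std_simplex m) (Suc (j - Suc i))"
      using interval[of i j] Suc.prems ji by simp
    have "face (std_simplex m) (Suc (j - Suc i)) 0 [i..<Suc j] = [Suc i..<Suc j]"
      using Suc.prems by (simp add: std_face upt_conv_Cons del: upt_Suc)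
    then show ?case
      using simplicial_map_face[OF f s, of 0] simplicial_map_face[OF g s, of 0] Suc ji by (simp del: upt_Suc)
  qed
  have edge: "base_edge f i j = base_edge g i j" if "i \<le> j" "j \<le> m" for i j
    using that
  proof (induction j rule: dec_induct)
    case base
    have v: "[i] \<in> simplices (std_simplex m) 0" using base by (simp add: std_simplices)
    have "f 0 [i] = g 0 [i]"
      using simplicial_map_closed[OF f v] simplicial_map_closed[OF g v] by (simp add: nerve_simplices)
    then have "f 1 [i, i] = g 1 [i, i]"
      using simplicial_map_degen[OF f v, of 0] simplicial_map_degen[OF g v, of 0] by (simp add: std_degen)
    then show ?case by (simp add: base_edge_def)
  next
    case (step j)
    have "f 1 [j, Suc j] = g 1 [j, Suc j]" using intervals[of j "Suc j"] step by simp
    then show ?case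
      using base_triangle(3)[OF f, of i j "Suc j"] base_triangle(3)[OF g, of i j "Suc j"] step
      by (simp add: base_edge_def)
  qed
  have edges: "f 1 x = g 1 x" if x: "x \<in> simplices (std_simplex m) 1" for x
  proof -
    obtain i j where "x = [i, j]" "i \<le> j" "j \<le> m" using std_edge[OF x] .
    then show ?thesis using base_edge_eq[OF f, of i j] base_edge_eq[OF g, of i j] edge by simp
  qed
  show ?thesis by (rule nerve_map_eqI[OF D.face_closed f g edges l])
qed

end

lemma local_triv_restrict:
  assumes \<sigma>: "local_triv M \<E> n b \<sigma>" and \<theta>: "mono_on {..m} \<theta>" "\<theta> ` {..m} \<subseteq> {..n}"
  shows "local_triv M \<E> m (\<lambda>k l. b k (map \<theta> l)) (\<lambda>k (w, l). \<sigma> k (w, map \<theta> l))"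
proof -
  note m = map_std_simplex[OF \<theta>]
  note cl = simplicial_map_closed[OF m]
  have "simplicial_map (sset_prod (nerve M) (std_simplex m)) (sset_prod (nerve M) (std_simplex n)) (\<lambda>_ (w, l). (w, map \<theta> l))"
    using cl simplicial_map_face[OF m] simplicial_map_degen[OF m]
    by (simp add: simplicial_map_def prod_simplices prod_face prod_degen)
  from simplicial_map_comp[OF this local_triv_map[OF \<sigma>]]
  have "simplicial_map (sset_prod (nerve M) (std_simplex m)) (total \<E>) (\<lambda>k (w, l). \<sigma> k (w, map \<theta> l))"
    by (simp add: case_prod_unfold)
  then show ?thesis using local_triv_bij[OF \<sigma> cl] by (simp add: local_triv_def)
qed

lemma local_triv_cong:
  assumes \<sigma>: "local_triv M \<E> n b \<sigma>" and b: "\<And>k l. l \<in> simplices (std_simplex n) k \<Longrightarrow> b k l = b' k l"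
  shows "local_triv M \<E> n b' \<sigma>"
  unfolding local_triv_def
proof (intro conjI allI ballI)
  fix k l assume l: "l \<in> simplices (std_simplex n) k"
  show "bij_betw (\<lambda>w. \<sigma> k (w, l)) (simplices (nerve M) k) {e \<in> simplices (total \<E>) k. proj \<E> k e = b' k l}"
    using local_triv_bij[OF \<sigma> l] by (simp only: b[OF l])
qed (rule local_triv_map[OF \<sigma>])

context partial_group
begin

lemma local_triv_aut:
  assumes \<sigma>: "local_triv M \<E> n b \<sigma>" and a: "a \<in> pg_aut M"
  shows "local_triv M \<E> n b (\<lambda>k (w, l). \<sigma> k (map a w, l))"
proof -
  note m = simplicial_map_aut[OF a]
  have "simplicial_map (sset_prod (nerve M) (std_simplex n)) (sset_prod (nerve M) (std_simplex n)) (\<lambda>_ (w, l). (map a w, l))"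
    using simplicial_map_closed[OF m] simplicial_map_face[OF m] simplicial_map_degen[OF m]
    by (simp add: simplicial_map_def prod_simplices prod_face prod_degen)
  from simplicial_map_comp[OF this local_triv_map[OF \<sigma>]]
  have "simplicial_map (sset_prod (nerve M) (std_simplex n)) (total \<E>) (\<lambda>k (w, l). \<sigma> k (map a w, l))"
    by (simp add: case_prod_unfold)
  moreover have "bij_betw (\<lambda>w. \<sigma> k (map a w, l)) (simplices (nerve M) k) {e \<in> simplices (total \<E>) k. proj \<E> k e = b k l}"
    if "l \<in> simplices (std_simplex n) k" for k l
    using bij_betw_trans[OF bij_betw_aut[OF a] local_triv_bij[OF \<sigma> that]] by (simp add: comp_def)
  ultimately show ?thesis by (simp add: local_triv_def)
qed

end

text \<open>
The only element that can be multiplied from the right to every element is the identity.  This is the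
condition under which the automorphisms of the nerve form a discrete simplicial group.
\<close>

definition rigid :: "'a pgroup \<Rightarrow> bool" where
  "rigid M \<longleftrightarrow> (\<forall>c\<in>pg_carrier M. (\<forall>y\<in>pg_carrier M. [y, c] \<in> pg_dom M) \<longrightarrow> c = pg_one M)"

context partial_group
begin

lemma letter_simplex: "[y] \<in> simplices (nerve M) 1 \<longleftrightarrow> y \<in> pg_carrier M"
  using dom_letter dom_carrier[of "[y]"] by (auto simp: nerve_simplices)

lemma edge_letter:
  assumes "w \<in> simplices (nerve M) 1" obtains y where "y \<in> pg_carrier M" "w = [y]"
  using assms dom_carrier[of w] by (cases w) (auto simp: nerve_simplices)

text \<open>
Over an edge from \<open>i\<close> to \<open>j\<close>, let \<open>c\<close> be the image of the degenerate edge \<open>1\<close> of the fibre.  The triangle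
with fibre coordinate \<open>(y, 1)\<close> over the vertices \<open>i, i, j\<close> shows that \<open>c\<close> can follow \<open>h\<^sub>i y\<close> for all \<open>y\<close>,
so \<open>c = 1\<close> by rigidity and surjectivity of \<open>h\<^sub>i\<close>.  The same triangle and its mirror image \<open>(1, y)\<close> over
\<open>i, j, j\<close> then identify the value on \<open>y\<close> over the edge with \<open>h\<^sub>i y\<close> and with \<open>h\<^sub>j y\<close>.
\<close>

lemma rigid_family_constant:
  assumes rigid: "rigid M"
    and h: "simplicial_map (sset_prod (nerve M) (std_simplex n)) (nerve M) h"
    and surj: "\<And>v. v \<le> n \<Longrightarrow> (\<lambda>w. h 1 (w, [v, v])) ` simplices (nerve M) 1 = simplices (nerve M) 1"
    and v: "v \<le> n" and w: "w \<in> simplices (nerve M) k" and l: "l \<in> simplices (std_simplex n) k"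
  shows "h k (w, l) = h k (w, replicate (Suc k) v)"
proof -
  interpret N: simplicial_set "nerve M" by (rule simplicial_set_nerve)
  interpret D: simplicial_set "std_simplex n" by (rule simplicial_set_std_simplex)
  let ?P = "sset_prod (nerve M) (std_simplex n)"
  have edge: "h 1 ([y], [i, j]) = h 1 ([y], [i, i]) \<and> h 1 ([y], [i, j]) = h 1 ([y], [j, j])"
    if ij: "i \<le> j" "j \<le> n" and y: "y \<in> pg_carrier M" for i j y
  proof -
    have edge_in: "h 1 ([z], [p, q]) \<in> simplices (nerve M) 1" if "z \<in> pg_carrier M" "p \<le> q" "q \<le> n" for z p q
      using simplicial_map_closed[OF h, of "([z], [p, q])" 1] that letter_simplex[of z]
      by (simp add: prod_simplices std_simplices)
    have tri: "\<exists>r s. h 1 ([x], [p, q]) = [r] \<and> h 1 ([z], [q, u]) = [s] \<and> [r, s] \<in> pg_dom M \<and>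
        h 1 ([pg_prod M [x, z]], [p, u]) = [pg_prod M [r, s]]"
      if "[x, z] \<in> pg_dom M" "p \<le> q" "q \<le> u" "u \<le> n" for x z p q u
    proof -
      have s: "([x, z], [p, q, u]) \<in> simplices ?P (Suc 1)"
        using that by (simp add: prod_simplices nerve_simplices std_simplices)
      have "h (Suc 1) ([x, z], [p, q, u]) \<in> simplices (nerve M) (Suc 1)" by (rule simplicial_map_closed[OF h s])
      then obtain r t where rt: "h (Suc 1) ([x, z], [p, q, u]) = [r, t]" "[r, t] \<in> pg_dom M"
        by (auto simp: nerve_simplices length_Suc_conv)
      have f: "h 1 (face ?P (Suc 1) i ([x, z], [p, q, u])) = face (nerve M) (Suc 1) i [r, t]" if "i \<le> Suc 1" for i
        using simplicial_map_face[OF h s that] rt(1) by simp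
      have "h 1 ([z], [q, u]) = [t]" using f[of 0] by (simp add: prod_face nerve_face_first std_face)
      moreover have "h 1 ([x], [p, q]) = [r]"
        using f[of "Suc 1"] nerve_face_last[of M 1 "[r, t]"] nerve_face_last[of M 1 "[x, z]"] by (simp add: prod_face std_face)
      moreover have "h 1 ([pg_prod M [x, z]], [p, u]) = [pg_prod M [r, t]]"
        using f[of 1] by (simp add: prod_face nerve_face_middle std_face)
      ultimately show ?thesis using rt by blast
    qed
    obtain c where c: "h 1 ([pg_one M], [i, j]) = [c]" "c \<in> pg_carrier M"
      using edge_in[OF one_closed ij] edge_letter by metis
    have "c = pg_one M"
    proof -
      have "[z, c] \<in> pg_dom M" if z: "z \<in> pg_carrier M" for z
      proof -
        have "[z] \<in> (\<lambda>w. h 1 (w, [i, i])) ` simplices (nerve M) 1" using surj[of i] ij letter_simplex z by simp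
        then obtain w where w: "[z] = h 1 (w, [i, i])" "w \<in> simplices (nerve M) 1" by (rule imageE)
        obtain x where x: "h 1 ([x], [i, i]) = [z]" "x \<in> pg_carrier M" using edge_letter[OF w(2)] w(1) by metis
        from tri[OF one_right_dom[OF x(2)], of i i j] ij x c show ?thesis by auto
      qed
      then show ?thesis using rigid c(2) by (simp add: rigid_def)
    qed
    moreover obtain r where r: "h 1 ([y], [i, i]) = [r]" "r \<in> pg_carrier M"
      using edge_in[OF y, of i i] edge_letter ij by (metis order.refl le_trans)
    moreover obtain s where s: "h 1 ([y], [j, j]) = [s]" "s \<in> pg_carrier M"
      using edge_in[OF y, of j j] edge_letter ij by (metis order.refl)
    ultimately show ?thesis
      using tri[OF one_right_dom[OF y], of i i j] tri[OF one_left_dom[OF y], of i j j] ij c y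
      by (auto simp: prod_one_left prod_one_right)
  qed
  define g where "g k p = h k (fst p, replicate (Suc k) v)" for k and p :: "'a list \<times> nat list"
  have g: "simplicial_map ?P (nerve M) g"
  proof -
    have "simplicial_map ?P ?P (\<lambda>k p. (fst p, replicate (Suc k) v))"
      using constant_simplex[OF v]
      by (auto simp: simplicial_map_def prod_simplices prod_face prod_degen constant_simplex_face constant_simplex_degen
          simp del: replicate_Suc)
    from simplicial_map_comp[OF this h] show ?thesis by (simp add: g_def[abs_def] del: replicate_Suc)
  qed
  have "h k (w, l) = g k (w, l)"
  proof (rule nerve_map_eqI[OF _ h g])
    fix m x i assume "x \<in> simplices ?P (Suc m)" "i \<le> Suc m"
    then show "face ?P (Suc m) i x \<in> simplices ?P m"
      by (cases x) (simp add: prod_simplices prod_face N.face_closed D.face_closed)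
  next
    fix x assume "x \<in> simplices ?P 1"
    then have "fst x \<in> simplices (nerve M) 1" "snd x \<in> simplices (std_simplex n) 1" by (auto simp: prod_simplices)
    then obtain y i j where x: "x = ([y], [i, j])" "y \<in> pg_carrier M" "i \<le> j" "j \<le> n"
      by (metis edge_letter std_edge prod.collapse)
    have "h 1 ([y], [j, j]) = h 1 ([y], [v, v])"
      using edge[of j v y] edge[of v j y] x v by (cases "j \<le> v") auto
    then have "h 1 ([y], [i, j]) = h 1 ([y], [v, v])" using conjunct2[OF edge[OF x(3,4,2)]] by (rule trans[rotated])
    then show "h 1 x = g 1 x" using x(1) by (simp add: g_def)
  next
    show "(w, l) \<in> simplices ?P k" using w l by (simp add: prod_simplices)
  qed
  then show ?thesis by (simp add: g_def)
qed

text \<open>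
Two trivialisations differ by an automorphism of \<open>F \<times> \<Delta>[n]\<close> over \<open>\<Delta>[n]\<close>, which is constant along
\<open>\<Delta>[n]\<close> by \<open>rigid_family_constant\<close> and the identity at the vertex \<open>v\<close>.
\<close>

lemma local_triv_unique:
  assumes rigid: "rigid M" and \<sigma>: "local_triv M \<E> n b \<sigma>" and \<sigma>': "local_triv M \<E> n b \<sigma>'"
    and v: "v \<le> n"
    and agree: "\<And>k w. w \<in> simplices (nerve M) k \<Longrightarrow> \<sigma> k (w, replicate (Suc k) v) = \<sigma>' k (w, replicate (Suc k) v)"
    and w: "w \<in> simplices (nerve M) k" and l: "l \<in> simplices (std_simplex n) k"
  shows "\<sigma> k (w, l) = \<sigma>' k (w, l)"
proof -
  interpret N: simplicial_set "nerve M" by (rule simplicial_set_nerve)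
  interpret D: simplicial_set "std_simplex n" by (rule simplicial_set_std_simplex)
  define h where "h k p = inv_into (simplices (nerve M) k) (\<lambda>w. \<sigma>' k (w, snd p)) (\<sigma> k p)" for k p
  have bij: "bij_betw (\<lambda>w. h k (w, l)) (simplices (nerve M) k) (simplices (nerve M) k)"
    if "l \<in> simplices (std_simplex n) k" for k l
    using bij_betw_trans[OF local_triv_bij[OF \<sigma> that] bij_betw_inv_into[OF local_triv_bij[OF \<sigma>' that]]]
    by (simp add: h_def comp_def)
  have \<sigma>'h: "\<sigma>' k (h k (w, l), l) = \<sigma> k (w, l)"
    if "w \<in> simplices (nerve M) k" "l \<in> simplices (std_simplex n) k" for k w l
    using bij_betw_inv_into_right[OF local_triv_bij[OF \<sigma>' that(2)], of "\<sigma> k (w, l)"]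
      local_triv_closed[OF \<sigma> that(2,1)] by (simp add: h_def)
  have hc: "h k (w, l) \<in> simplices (nerve M) k"
    if "w \<in> simplices (nerve M) k" "l \<in> simplices (std_simplex n) k" for k w l
    using bij_betwE[OF bij[OF that(2)]] that(1) by simp
  have inj: "u = u'" if "\<sigma>' k (u, l) = \<sigma>' k (u', l)" "u \<in> simplices (nerve M) k" "u' \<in> simplices (nerve M) k"
    "l \<in> simplices (std_simplex n) k" for k u u' l
    using inj_onD[OF bij_betw_imp_inj_on[OF local_triv_bij[OF \<sigma>' that(4)]] that(1-3)] .
  have h: "simplicial_map (sset_prod (nerve M) (std_simplex n)) (nerve M) h"
    unfolding simplicial_map_def
  proof (intro conjI allI ballI impI)
    fix k x assume "x \<in> simplices (sset_prod (nerve M) (std_simplex n)) k"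
    then show "h k x \<in> simplices (nerve M) k" by (cases x) (simp add: prod_simplices hc)
  next
    fix k x i assume x0: "x \<in> simplices (sset_prod (nerve M) (std_simplex n)) (Suc k)" and i: "i \<le> Suc k"
    obtain w l where x: "x = (w, l)" "w \<in> simplices (nerve M) (Suc k)" "l \<in> simplices (std_simplex n) (Suc k)"
      using x0 by (cases x) (simp add: prod_simplices)
    note c = N.face_closed[OF x(2) i] D.face_closed[OF x(3) i]
    have "h k (face (nerve M) (Suc k) i w, face (std_simplex n) (Suc k) i l) = face (nerve M) (Suc k) i (h (Suc k) (w, l))"
    proof (rule inj[OF _ hc[OF c] N.face_closed[OF hc[OF x(2,3)] i] c(2)])
      show "\<sigma>' k (h k (face (nerve M) (Suc k) i w, face (std_simplex n) (Suc k) i l), face (std_simplex n) (Suc k) i l) =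
        \<sigma>' k (face (nerve M) (Suc k) i (h (Suc k) (w, l)), face (std_simplex n) (Suc k) i l)"
        unfolding \<sigma>'h[OF c] local_triv_face[OF \<sigma>' x(3) hc[OF x(2,3)] i, symmetric] \<sigma>'h[OF x(2,3)]
        by (rule local_triv_face[OF \<sigma> x(3,2) i, symmetric])
    qed
    then show "h k (face (sset_prod (nerve M) (std_simplex n)) (Suc k) i x) = face (nerve M) (Suc k) i (h (Suc k) x)"
      by (simp add: x(1) prod_face)
  next
    fix k x i assume x0: "x \<in> simplices (sset_prod (nerve M) (std_simplex n)) k" and i: "i \<le> k"
    obtain w l where x: "x = (w, l)" "w \<in> simplices (nerve M) k" "l \<in> simplices (std_simplex n) k"
      using x0 by (cases x) (simp add: prod_simplices)
    note c = N.degen_closed[OF x(2) i] D.degen_closed[OF x(3) i]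
    have "h (Suc k) (degen (nerve M) k i w, degen (std_simplex n) k i l) = degen (nerve M) k i (h k (w, l))"
    proof (rule inj[OF _ hc[OF c] N.degen_closed[OF hc[OF x(2,3)] i] c(2)])
      show "\<sigma>' (Suc k) (h (Suc k) (degen (nerve M) k i w, degen (std_simplex n) k i l), degen (std_simplex n) k i l) =
        \<sigma>' (Suc k) (degen (nerve M) k i (h k (w, l)), degen (std_simplex n) k i l)"
        unfolding \<sigma>'h[OF c] local_triv_degen[OF \<sigma>' x(3) hc[OF x(2,3)] i, symmetric] \<sigma>'h[OF x(2,3)]
        by (rule local_triv_degen[OF \<sigma> x(3,2) i, symmetric])
    qed
    then show "h (Suc k) (degen (sset_prod (nerve M) (std_simplex n)) k i x) = degen (nerve M) k i (h k x)"
      by (simp add: x(1) prod_degen)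
  qed
  have "(\<lambda>w. h 1 (w, [u, u])) ` simplices (nerve M) 1 = simplices (nerve M) 1" if "u \<le> n" for u
    using bij_betw_imp_surj_on[OF bij[of "[u, u]" 1]] that by (simp add: std_simplices)
  from rigid_family_constant[OF rigid h this v w l] have "h k (w, l) = h k (w, replicate (Suc k) v)" by simp
  also have "\<dots> = w"
  proof (rule inj[OF _ hc[OF w constant_simplex[OF v]] w constant_simplex[OF v]])
    show "\<sigma>' k (h k (w, replicate (Suc k) v), replicate (Suc k) v) = \<sigma>' k (w, replicate (Suc k) v)"
      unfolding \<sigma>'h[OF w constant_simplex[OF v]] by (rule agree[OF w])
  qed
  finally show ?thesis using \<sigma>'h[OF w l] by simp
qed

end

section \<open>Monodromy of an extension\<close>

locale rigid_extension = partial_group_pair H M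
  for H :: "'h pgroup" and M :: "'m pgroup" +
  fixes \<E> :: "('m, 'h, 'e) extension"
  assumes is_ext: "is_extension H M \<E>" and rigid: "rigid M"
begin

lemma total_bundle: "fibre_bundle (nerve M) (total \<E>) (nerve H) (proj \<E>)"
  and incl_iso: "simplicial_iso (nerve M) (fibre_over (total \<E>) (nerve H) (proj \<E>) []) (incl \<E>)"
  using is_ext by (simp_all add: is_extension_def)

sublocale E: simplicial_set "total \<E>" using total_bundle by (simp add: fibre_bundle_def)

lemma proj_map: "simplicial_map (total \<E>) (nerve H) (proj \<E>)"
  using total_bundle by (simp add: fibre_bundle_def)

lemma incl_inj: "v \<in> simplices (nerve M) k \<Longrightarrow> w \<in> simplices (nerve M) k \<Longrightarrow> incl \<E> k v = incl \<E> k w \<Longrightarrow> v = w"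
  using bij_betw_imp_inj_on[OF simplicial_iso_bij[OF incl_iso]] by (auto dest: inj_onD)

lemma base_constant:
  assumes b: "simplicial_map (std_simplex n) (nerve H) b" and v: "v \<le> n"
  shows "b k (replicate (Suc k) v) = vertex_degen (nerve H) [] k"
proof -
  have "b 0 [v] \<in> simplices (nerve H) 0" by (rule simplicial_map_closed[OF b]) (use v in \<open>simp add: std_simplices\<close>)
  then show ?thesis using map_std_constant[OF b v, of k] by (simp add: nerve_simplices del: replicate_Suc)
qed

text \<open>
Over a constant simplex the trivialisation lands in the fibre over the base vertex, and the inclusion
translates it into an automorphism of the nerve of \<open>M\<close>.
\<close>

lemma local_triv_vertex:
  assumes \<sigma>: "local_triv M \<E> n b \<sigma>" and b: "simplicial_map (std_simplex n) (nerve H) b" and v: "v \<le> n"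
  shows "\<exists>a\<in>pg_aut M. \<forall>k. \<forall>w\<in>simplices (nerve M) k. \<sigma> k (w, replicate (Suc k) v) = incl \<E> k (map a w)"
proof -
  let ?F = "fibre_over (total \<E>) (nerve H) (proj \<E>) []"
  let ?c = "\<lambda>k w. \<sigma> k (w, replicate (Suc k) v)"
  obtain g where g: "simplicial_iso ?F (nerve M) g" "\<And>k e. e \<in> simplices ?F k \<Longrightarrow> incl \<E> k (g k e) = e"
    using simplicial_iso_inverse[OF incl_iso] by metis
  note l = constant_simplex[OF v]
  have cbij: "bij_betw (?c k) (simplices (nerve M) k) (simplices ?F k)" for k
    using local_triv_bij[OF \<sigma> l] by (simp only: fibre_over_simps base_constant[OF b v])
  have "simplicial_map (nerve M) ?F ?c"
    unfolding simplicial_map_def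
  proof (intro conjI allI ballI impI)
    fix k w i assume w: "w \<in> simplices (nerve M) (Suc k)" and i: "i \<le> Suc k"
    show "?c k (face (nerve M) (Suc k) i w) = face ?F (Suc k) i (?c (Suc k) w)"
      unfolding fibre_over_simps local_triv_face[OF \<sigma> l w i] constant_simplex_face[OF i] ..
  next
    fix k w i assume w: "w \<in> simplices (nerve M) k" and i: "i \<le> k"
    show "?c (Suc k) (degen (nerve M) k i w) = degen ?F k i (?c k w)"
      unfolding fibre_over_simps local_triv_degen[OF \<sigma> l w i] constant_simplex_degen[OF i] ..
  qed (rule bij_betw_apply[OF cbij])
  from simplicial_map_comp[OF this simplicial_iso_map[OF g(1)]]
  have gm: "simplicial_map (nerve M) (nerve M) (\<lambda>k w. g k (?c k w))" .
  have gb: "bij_betw (\<lambda>w. g k (?c k w)) (simplices (nerve M) k) (simplices (nerve M) k)" for k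
    using bij_betw_trans[OF cbij simplicial_iso_bij[OF g(1)]] by (simp add: comp_def del: replicate_Suc)
  from M.nerve_aut_letterwise[OF gm gb] obtain a where
    a: "a \<in> pg_aut M" "\<And>k w. w \<in> simplices (nerve M) k \<Longrightarrow> g k (?c k w) = map a w" by blast
  have "?c k w = incl \<E> k (map a w)" if "w \<in> simplices (nerve M) k" for k w
    using g(2)[OF bij_betw_apply[OF cbij that]] a(2)[OF that] by simp
  with a(1) show ?thesis by blast
qed

lemma exists_normalised_triv:
  assumes b: "simplicial_map (std_simplex n) (nerve H) b"
  shows "\<exists>\<sigma>. local_triv M \<E> n b \<sigma> \<and>
    (\<forall>k. \<forall>w\<in>simplices (nerve M) k. \<sigma> k (w, replicate (Suc k) n) = incl \<E> k w)"
proof -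
  have "\<exists>\<phi>. simplicial_iso (sset_prod (nerve M) (std_simplex n))
                (sset_pullback (total \<E>) (std_simplex n) (proj \<E>) b) \<phi> \<and>
             (\<forall>k. \<forall>p\<in>simplices (sset_prod (nerve M) (std_simplex n)) k. snd (\<phi> k p) = snd p)"
    using total_bundle b by (simp add: fibre_bundle_def)
  then obtain \<phi> where \<phi>: "simplicial_iso (sset_prod (nerve M) (std_simplex n))
                (sset_pullback (total \<E>) (std_simplex n) (proj \<E>) b) \<phi>"
    "\<forall>k. \<forall>p\<in>simplices (sset_prod (nerve M) (std_simplex n)) k. snd (\<phi> k p) = snd p" by (elim exE conjE)
  from local_triv_of_pullback_iso[OF \<phi>] obtain \<sigma> where \<sigma>: "local_triv M \<E> n b \<sigma>" by blast
  from local_triv_vertex[OF \<sigma> b order.refl] obtain a where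
    a: "a \<in> pg_aut M" "\<And>k w. w \<in> simplices (nerve M) k \<Longrightarrow> \<sigma> k (w, replicate (Suc k) n) = incl \<E> k (map a w)"
    by blast
  have "\<sigma> k (map (inv a) w, replicate (Suc k) n) = incl \<E> k w" if "w \<in> simplices (nerve M) k" for k w
    using a(2)[OF bij_betw_apply[OF M.bij_betw_aut[OF M.inv_aut[OF a(1)]] that]]
      permutes_inverses(1)[OF M.aut_permutes[OF a(1)]] by (simp add: comp_def del: replicate_Suc)
  with M.local_triv_aut[OF \<sigma> M.inv_aut[OF a(1)]] show ?thesis
    by (intro exI[of _ "\<lambda>k (w, l). \<sigma> k (map (inv a) w, l)"] conjI) (simp_all del: replicate_Suc)
qed

text \<open>
The trivialisation over the simplex \<open>b\<close> that agrees with the inclusion of \<open>M\<close> at the last vertex; by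
rigidity it is unique on simplices.
\<close>

definition ntriv :: "'h list \<Rightarrow> nat \<Rightarrow> 'm list \<times> nat list \<Rightarrow> 'e" where
  "ntriv b = (SOME \<sigma>. local_triv M \<E> (length b) (\<lambda>_. pull H b) \<sigma> \<and>
     (\<forall>k. \<forall>w\<in>simplices (nerve M) k. \<sigma> k (w, replicate (Suc k) (length b)) = incl \<E> k w))"

lemma ntriv:
  assumes b: "b \<in> simplices (nerve H) n"
  shows "local_triv M \<E> n (\<lambda>_. pull H b) (ntriv b)"
    and "w \<in> simplices (nerve M) k \<Longrightarrow> ntriv b k (w, replicate (Suc k) n) = incl \<E> k w"
proof -
  have n: "b \<in> pg_dom H" "length b = n" using b by (auto simp: nerve_simplices)
  from someI_ex[OF exists_normalised_triv[OF H.simplicial_map_pull[OF n(1), of "length b"]], folded ntriv_def]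
  show "local_triv M \<E> n (\<lambda>_. pull H b) (ntriv b)"
    "w \<in> simplices (nerve M) k \<Longrightarrow> ntriv b k (w, replicate (Suc k) n) = incl \<E> k w"
    unfolding n(2) by blast+
qed

text \<open>
Restricting a normalised trivialisation along a monotone map \<open>\<theta>\<close> gives a trivialisation over the
restricted simplex \<open>c\<close>.  By uniqueness it is the normalised one, up to the automorphism \<open>a\<close> by which the
two differ at the last vertex.
\<close>

lemma ntriv_restrict:
  assumes b: "b \<in> simplices (nerve H) n" and \<theta>: "mono_on {..m} \<theta>" "\<theta> ` {..m} \<subseteq> {..n}"
    and c: "c = pull H b (map \<theta> [0..<Suc m])"
    and a: "a \<in> pg_aut M"
    and last: "\<And>k w. w \<in> simplices (nerve M) k \<Longrightarrow> ntriv b k (w, replicate (Suc k) (\<theta> m)) = incl \<E> k (map a w)"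
    and w: "w \<in> simplices (nerve M) k" and l: "l \<in> simplices (std_simplex m) k"
  shows "ntriv b k (w, map \<theta> l) = ntriv c k (map a w, l)"
proof -
  have bd: "b \<in> pg_dom H" using b by (simp add: nerve_simplices)
  have top: "[0..<Suc m] \<in> simplices (std_simplex m) m" by (auto simp: std_simplices simp del: upt_Suc)
  have bm: "simplicial_map (std_simplex m) (nerve H) (\<lambda>k l. pull H b (map \<theta> l))"
    using simplicial_map_comp[OF map_std_simplex[OF \<theta>] H.simplicial_map_pull[OF bd]] .
  have cs: "c \<in> simplices (nerve H) m" using simplicial_map_closed[OF bm top] c by simp
  then have cm: "simplicial_map (std_simplex m) (nerve H) (\<lambda>_. pull H c)"
    using H.simplicial_map_pull by (simp add: nerve_simplices)
  have "pull H b (map \<theta> [0..<Suc m]) = pull H c [0..<Suc m]" using H.pull_top[OF cs] c by simp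
  from H.map_std_nerve_eqI[OF bm cm this]
  have "pull H b (map \<theta> l) = pull H c l" if "l \<in> simplices (std_simplex m) k" for k l using that .
  from local_triv_cong[OF local_triv_restrict[OF ntriv(1)[OF b] \<theta>] this]
  have 1: "local_triv M \<E> m (\<lambda>_. pull H c) (\<lambda>k (w, l). ntriv b k (w, map \<theta> l))" .
  have 2: "local_triv M \<E> m (\<lambda>_. pull H c) (\<lambda>k (w, l). ntriv c k (map a w, l))"
    by (rule M.local_triv_aut[OF ntriv(1)[OF cs] a])
  have "(\<lambda>k (w, l). ntriv b k (w, map \<theta> l)) k (w, replicate (Suc k) m) =
      (\<lambda>k (w, l). ntriv c k (map a w, l)) k (w, replicate (Suc k) m)" if "w \<in> simplices (nerve M) k" for k w
    using last[OF that] ntriv(2)[OF cs bij_betw_apply[OF M.bij_betw_aut[OF a] that]]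
    by (simp only: prod.case map_replicate)
  from M.local_triv_unique[OF rigid 1 2 order.refl this w l] show ?thesis by simp
qed

lemma ntriv_restrict_last:
  assumes b: "b \<in> simplices (nerve H) n" and \<theta>: "mono_on {..m} \<theta>" "\<theta> ` {..m} \<subseteq> {..n}" "\<theta> m = n"
    and c: "c = pull H b (map \<theta> [0..<Suc m])"
    and w: "w \<in> simplices (nerve M) k" and l: "l \<in> simplices (std_simplex m) k"
  shows "ntriv b k (w, map \<theta> l) = ntriv c k (w, l)"
  using ntriv_restrict[OF b \<theta>(1,2) c M.id_aut _ w l] ntriv(2)[OF b] \<theta>(3) by (simp del: replicate_Suc)

text \<open>
The automorphism of \<open>M\<close> obtained by transport along the edge \<open>x\<close>: the normalised trivialisation over \<open>x\<close>,
read off at the initial vertex.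
\<close>

definition monodromy :: "'h \<Rightarrow> 'm \<Rightarrow> 'm" where
  "monodromy = (\<lambda>x\<in>pg_carrier H. SOME a. a \<in> pg_aut M \<and>
     (\<forall>k. \<forall>w\<in>simplices (nerve M) k. ntriv [x] k (w, replicate (Suc k) 0) = incl \<E> k (map a w)))"

lemma monodromy:
  assumes x: "x \<in> pg_carrier H"
  shows "monodromy x \<in> pg_aut M"
    and "w \<in> simplices (nerve M) k \<Longrightarrow> ntriv [x] k (w, replicate (Suc k) 0) = incl \<E> k (map (monodromy x) w)"
proof -
  have s: "[x] \<in> simplices (nerve H) 1" using H.letter_simplex x by simp
  then have "[x] \<in> pg_dom H" by (simp add: nerve_simplices)
  from local_triv_vertex[OF ntriv(1)[OF s] H.simplicial_map_pull[OF this], of 0]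
  have "\<exists>a. a \<in> pg_aut M \<and>
     (\<forall>k. \<forall>w\<in>simplices (nerve M) k. ntriv [x] k (w, replicate (Suc k) 0) = incl \<E> k (map a w))" by blast
  from someI_ex[OF this]
  have "monodromy x \<in> pg_aut M \<and>
     (\<forall>k. \<forall>w\<in>simplices (nerve M) k. ntriv [x] k (w, replicate (Suc k) 0) = incl \<E> k (map (monodromy x) w))"
    unfolding monodromy_def restrict_apply'[OF x] .
  then show "monodromy x \<in> pg_aut M"
    "w \<in> simplices (nerve M) k \<Longrightarrow> ntriv [x] k (w, replicate (Suc k) 0) = incl \<E> k (map (monodromy x) w)"
    by blast+
qed

lemma ntriv_penultimate:
  assumes b: "b \<in> simplices (nerve H) (Suc n)" and w: "w \<in> simplices (nerve M) k"
  shows "ntriv b k (w, replicate (Suc k) n) = incl \<E> k (map (monodromy (last b)) w)"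
proof -
  \<comment> \<open>The inclusion of the last edge of \<open>\<Delta>[n + 1]\<close>.\<close>
  define \<theta> where "\<theta> i = (if i = 0 then n else Suc n)" for i :: nat
  have len: "n < length b" "length b = Suc n" using b by (auto simp: nerve_simplices)
  have lb: "last b \<in> pg_carrier H" using last_closed[OF b] .
  have "last b = b ! n" using len by (simp add: last_conv_nth flip: length_greater_0_conv)
  then have c: "[last b] = pull H b (map \<theta> [0..<Suc 1])"
    using slice_Suc[OF len(1)] H.prod_letter[OF lb] by (simp add: \<theta>_def)
  have "mono_on {..1} \<theta>" "\<theta> ` {..1} \<subseteq> {..Suc n}" "\<theta> 1 = Suc n" by (auto simp: \<theta>_def mono_on_def)
  from ntriv_restrict_last[OF b this c w constant_simplex[of 0]]
  have "ntriv b k (w, replicate (Suc k) n) = ntriv [last b] k (w, replicate (Suc k) 0)"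
    by (simp add: \<theta>_def map_replicate del: replicate_Suc)
  then show ?thesis using monodromy(2)[OF lb w] by simp
qed

text \<open>
Over the triangle \<open>[x, y]\<close> the value at the vertex 0 is computed in two ways: through the long edge from
0 to 2, and through the edge from 0 to 1 after passing from the vertex 1 to the vertex 2.
\<close>

lemma monodromy_hom: "monodromy \<in> aut_homs H M"
proof -
  have "monodromy (pg_prod H [x, y]) = monodromy x \<circ> monodromy y" if xy: "[x, y] \<in> pg_dom H" for x y
  proof
    fix z
    have c: "x \<in> pg_carrier H" "y \<in> pg_carrier H" "pg_prod H [x, y] \<in> pg_carrier H"
      using H.dom_carrier[OF xy] H.prod_closed[OF xy] by auto
    have b: "[x, y] \<in> simplices (nerve H) (Suc 1)" using xy by (simp add: nerve_simplices)
    show "monodromy (pg_prod H [x, y]) z = (monodromy x \<circ> monodromy y) z"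
    proof (cases "z \<in> pg_carrier M")
      case False
      then show ?thesis using permutes_not_in[OF M.aut_permutes[OF monodromy(1)]] c by simp
    next
      case True
      then have z: "[z] \<in> simplices (nerve M) 1" "[monodromy y z] \<in> simplices (nerve M) 1"
        using M.letter_simplex M.aut_closed[OF monodromy(1)[OF c(2)]] by auto
      \<comment> \<open>The long edge of the triangle.\<close>
      define \<theta> where "\<theta> i = (if i = 0 then 0 else 2 :: nat)" for i :: nat
      have "mono_on {..1} \<theta>" "\<theta> ` {..1} \<subseteq> {..Suc 1}" "\<theta> 1 = Suc 1" by (auto simp: \<theta>_def mono_on_def)
      moreover have "[pg_prod H [x, y]] = pull H [x, y] (map \<theta> [0..<Suc 1])"
        by (simp add: \<theta>_def slice_def)
      ultimately have "ntriv [x, y] 1 ([z], map \<theta> (replicate (Suc 1) 0)) =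
          ntriv [pg_prod H [x, y]] 1 ([z], replicate (Suc 1) 0)"
        by (rule ntriv_restrict_last[OF b _ _ _ _ z(1) constant_simplex]) simp
      then have 1: "ntriv [x, y] 1 ([z], [0, 0]) = incl \<E> 1 [monodromy (pg_prod H [x, y]) z]"
        using monodromy(2)[OF c(3) z(1)] by (simp add: \<theta>_def)
      \<comment> \<open>The initial edge of the triangle.\<close>
      have "mono_on {..1} (\<lambda>i. i)" "(\<lambda>i. i) ` {..1} \<subseteq> {..Suc 1}" by (auto simp: mono_on_def)
      moreover have "[x] = pull H [x, y] (map (\<lambda>i. i) [0..<Suc 1])"
        using H.prod_letter[OF c(1)] by (simp add: slice_def)
      ultimately have "ntriv [x, y] 1 ([z], map (\<lambda>i. i) (replicate (Suc 1) 0)) =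
          ntriv [x] 1 (map (monodromy y) [z], replicate (Suc 1) 0)"
        by (rule ntriv_restrict[OF b _ _ _ monodromy(1)[OF c(2)] _ z(1) constant_simplex])
          (use ntriv_penultimate[OF b] in \<open>simp_all del: replicate_Suc\<close>)
      then have 2: "ntriv [x, y] 1 ([z], [0, 0]) = incl \<E> 1 [monodromy x (monodromy y z)]"
        using monodromy(2)[OF c(1) z(2)] by simp
      have "monodromy x (monodromy y z) \<in> pg_carrier M" "monodromy (pg_prod H [x, y]) z \<in> pg_carrier M"
        using c True monodromy(1) M.aut_closed by metis+
      then have "[monodromy (pg_prod H [x, y]) z] = [monodromy x (monodromy y z)]"
        using 1 2 by (intro incl_inj[of _ 1]) (simp_all only: M.letter_simplex)
      then show ?thesis by simp
    qed
  qed
  then show ?thesis using monodromy(1) by (simp add: aut_homs_def monodromy_def restrict_PiE_iff)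
qed

text \<open>
The isomorphism from the twisted product along the monodromy to the total space.  A fibre coordinate \<open>w\<close>
over \<open>b\<close> is realised by evaluating the normalised trivialisation at the top simplex.
\<close>

definition untwist :: "nat \<Rightarrow> 'm list \<times> 'h list \<Rightarrow> 'e" where
  "untwist n = (\<lambda>(w, b). ntriv b n (w, [0..<Suc n]))"

lemma top_simplex: "[0..<Suc n] \<in> simplices (std_simplex n) n"
  by (auto simp: std_simplices simp del: upt_Suc)

lemma untwist_closed:
  assumes "w \<in> simplices (nerve M) n" "b \<in> simplices (nerve H) n"
  shows "untwist n (w, b) \<in> simplices (total \<E>) n" "proj \<E> n (untwist n (w, b)) = b"
  using local_triv_closed[OF ntriv(1)[OF assms(2)] top_simplex assms(1)] H.pull_top[OF assms(2)]
  by (simp_all add: untwist_def del: upt_Suc)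

text \<open>
Faces and degeneracies that keep the last vertex preserve the normalisation.  The last face makes the
penultimate vertex the last one, and \<open>ntriv_penultimate\<close> produces precisely the twist of the product.
\<close>

lemma simplicial_map_untwist: "simplicial_map (twisted_product H M monodromy) (total \<E>) untwist"
  unfolding simplicial_map_def
proof (intro conjI allI ballI impI)
  fix n x assume "x \<in> simplices (twisted_product H M monodromy) n"
  then show "untwist n x \<in> simplices (total \<E>) n" by (cases x) (simp add: twisted_simplices untwist_closed)
next
  fix n x i assume "x \<in> simplices (twisted_product H M monodromy) (Suc n)" and i: "i \<le> Suc n"
  then obtain w b where x: "x = (w, b)" "w \<in> simplices (nerve M) (Suc n)" "b \<in> simplices (nerve H) (Suc n)"
    by (cases x) (simp add: twisted_simplices)
  have bd: "b \<in> pg_dom H" using x(3) by (simp add: nerve_simplices)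
  \<comment> \<open>The coface map that omits the vertex \<open>i\<close>.\<close>
  define \<theta> where "\<theta> v = (if v < i then v else Suc v)" for v
  have \<theta>: "mono_on {..n} \<theta>" "\<theta> ` {..n} \<subseteq> {..Suc n}" by (auto simp: \<theta>_def mono_on_def)
  have top: "face (std_simplex (Suc n)) (Suc n) i [0..<Suc (Suc n)] = map \<theta> [0..<Suc n]"
    using i by (auto simp: std_face \<theta>_def nth_append simp del: upt_Suc intro!: nth_equalityI)
  have c: "face (nerve H) (Suc n) i b = pull H b (map \<theta> [0..<Suc n])"
    using H.face_pull[OF bd top_simplex i] H.pull_top[OF x(3)] top by simp
  note fw = NM.face_closed[OF x(2) i]
  have "face (total \<E>) (Suc n) i (untwist (Suc n) x) = ntriv b n (face (nerve M) (Suc n) i w, map \<theta> [0..<Suc n])"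
    using local_triv_face[OF ntriv(1)[OF x(3)] top_simplex x(2) i] top by (simp add: untwist_def x(1) del: upt_Suc)
  also have "\<dots> = untwist n (face (twisted_product H M monodromy) (Suc n) i x)"
  proof (cases "i = Suc n")
    case False
    then have "\<theta> n = Suc n" using i by (simp add: \<theta>_def)
    from ntriv_restrict_last[OF x(3) \<theta> this c fw top_simplex] show ?thesis
      using False by (simp add: x(1) untwist_def twisted_face del: upt_Suc)
  next
    case True
    then have "\<theta> n = n" by (simp add: \<theta>_def)
    then have "ntriv b n (face (nerve M) (Suc n) i w, map \<theta> [0..<Suc n]) =
        ntriv (face (nerve H) (Suc n) i b) n (map (monodromy (last b)) (face (nerve M) (Suc n) i w), [0..<Suc n])"
      using ntriv_penultimate[OF x(3)]
      by (intro ntriv_restrict[OF x(3) \<theta> c monodromy(1)[OF last_closed[OF x(3)]] _ fw top_simplex]) simp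
    then show ?thesis using True by (simp add: x(1) untwist_def twisted_face_last del: upt_Suc)
  qed
  finally show "untwist n (face (twisted_product H M monodromy) (Suc n) i x) = face (total \<E>) (Suc n) i (untwist (Suc n) x)" ..
next
  fix n x i assume "x \<in> simplices (twisted_product H M monodromy) n" and i: "i \<le> n"
  then obtain w b where x: "x = (w, b)" "w \<in> simplices (nerve M) n" "b \<in> simplices (nerve H) n"
    by (cases x) (simp add: twisted_simplices)
  \<comment> \<open>The codegeneracy map that repeats the vertex \<open>i\<close>.\<close>
  define \<theta> where "\<theta> v = (if v \<le> i then v else v - 1)" for v
  have \<theta>: "mono_on {..Suc n} \<theta>" "\<theta> ` {..Suc n} \<subseteq> {..n}" "\<theta> (Suc n) = n"
    using i by (auto simp: \<theta>_def mono_on_def)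
  have top: "degen (std_simplex n) n i [0..<Suc n] = map \<theta> [0..<Suc (Suc n)]"
    using i by (auto simp: std_degen \<theta>_def nth_append simp del: upt_Suc intro!: nth_equalityI)
  have c: "degen (nerve H) n i b = pull H b (map \<theta> [0..<Suc (Suc n)])"
    using H.degen_pull[OF top_simplex i, of b] H.pull_top[OF x(3)] top by simp
  have "degen (total \<E>) n i (untwist n x) = ntriv b (Suc n) (degen (nerve M) n i w, map \<theta> [0..<Suc (Suc n)])"
    using local_triv_degen[OF ntriv(1)[OF x(3)] top_simplex x(2) i] top by (simp add: untwist_def x(1) del: upt_Suc)
  also have "\<dots> = untwist (Suc n) (degen (twisted_product H M monodromy) n i x)"
    using ntriv_restrict_last[OF x(3) \<theta> c NM.degen_closed[OF x(2) i] top_simplex]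
    by (simp add: x(1) untwist_def twisted_degen del: upt_Suc)
  finally show "untwist (Suc n) (degen (twisted_product H M monodromy) n i x) = degen (total \<E>) n i (untwist n x)" ..
qed

lemma bij_untwist: "bij_betw (untwist n) (simplices (twisted_product H M monodromy) n) (simplices (total \<E>) n)"
proof (rule bij_betw_imageI)
  show "inj_on (untwist n) (simplices (twisted_product H M monodromy) n)"
  proof (rule inj_onI)
    fix x y assume xy: "x \<in> simplices (twisted_product H M monodromy) n" "y \<in> simplices (twisted_product H M monodromy) n"
      "untwist n x = untwist n y"
    obtain v b w c where x: "x = (v, b)" and y: "y = (w, c)" by (cases x; cases y) auto
    have "b = c" using untwist_closed(2)[of v n b] untwist_closed(2)[of w n c] xy by (simp add: x y twisted_simplices)
    moreover have "v = w"
      using inj_onD[OF bij_betw_imp_inj_on[OF local_triv_bij[OF ntriv(1) top_simplex]], of b n v w] xy \<open>b = c\<close>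
      by (simp add: x y twisted_simplices untwist_def del: upt_Suc)
    ultimately show "x = y" by (simp add: x y)
  qed
  show "untwist n ` simplices (twisted_product H M monodromy) n = simplices (total \<E>) n"
  proof (intro equalityI subsetI)
    fix e assume e: "e \<in> simplices (total \<E>) n"
    define b where "b = proj \<E> n e"
    have b: "b \<in> simplices (nerve H) n" using simplicial_map_closed[OF proj_map e] by (simp add: b_def)
    have "e \<in> {e \<in> simplices (total \<E>) n. proj \<E> n e = pull H b [0..<Suc n]}"
      using e H.pull_top[OF b] by (simp add: b_def)
    then have "e \<in> (\<lambda>w. ntriv b n (w, [0..<Suc n])) ` simplices (nerve M) n"
      using bij_betw_imp_surj_on[OF local_triv_bij[OF ntriv(1)[OF b] top_simplex]] by (simp del: upt_Suc)
    then obtain w where "w \<in> simplices (nerve M) n" "e = ntriv b n (w, [0..<Suc n])" by (rule imageE)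
    then show "e \<in> untwist n ` simplices (twisted_product H M monodromy) n"
      using b by (intro image_eqI[of _ _ "(w, b)"]) (simp_all add: untwist_def twisted_simplices del: upt_Suc)
  next
    fix e assume "e \<in> untwist n ` simplices (twisted_product H M monodromy) n"
    then show "e \<in> simplices (total \<E>) n" using simplicial_map_closed[OF simplicial_map_untwist] by auto
  qed
qed

lemma untwist_incl:
  assumes w: "w \<in> simplices (nerve M) n" shows "untwist n (w, vertex_degen (nerve H) [] n) = incl \<E> n w"
proof -
  have b: "[] \<in> simplices (nerve H) 0" by (simp add: nerve_simplices H.nil_dom)
  have \<theta>: "mono_on {..n} (\<lambda>_. 0 :: nat)" "(\<lambda>_. 0 :: nat) ` {..n} \<subseteq> {..0}" "(\<lambda>_. 0 :: nat) n = 0"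
    by (auto simp: mono_on_def)
  have m: "map (\<lambda>_. 0) [0..<Suc n] = replicate (Suc n) (0::nat)" by (simp add: map_replicate_const del: upt_Suc replicate_Suc)
  have c: "vertex_degen (nerve H) [] n = pull H [] (map (\<lambda>_. 0) [0..<Suc n])"
    using base_constant[OF H.simplicial_map_pull[OF H.nil_dom], of 0 0 n] unfolding m by simp
  from ntriv_restrict_last[OF b \<theta> c w top_simplex] ntriv(2)[OF b w] show ?thesis
    unfolding untwist_def prod.case m by simp
qed

theorem equivalent_twisted_monodromy: "extension_equivalent M (twisted_extension H M monodromy) \<E>"
proof -
  interpret T: simplicial_set "twisted_product H M monodromy"
    by (rule simplicial_set_twisted_product[OF monodromy_hom])
  have "simplicial_iso (twisted_product H M monodromy) (total \<E>) untwist"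
    by (rule simplicial_isoI[OF T.face_closed T.degen_closed simplicial_map_untwist bij_untwist])
  then show ?thesis
    unfolding extension_equivalent_def
    by (intro exI[of _ untwist]) (auto simp: twisted_extension_def untwist_incl twisted_simplices untwist_closed)
qed

end

section \<open>Classification of extensions\<close>

context partial_group_pair
begin

text \<open>
An equivalence \<open>\<psi>\<close> is the identity on the fibre over the base vertex.  Suitable triangles with one
degenerate base edge show, with rigidity, that it fixes \<open>([1], [x])\<close> and hence all edges over \<open>x\<close>.  The last
face of a triangle over \<open>(1, x)\<close> lies over the base vertex and compares \<open>t x y\<close> with \<open>t' x y\<close>.
\<close>

lemma twisted_equivalent_imp_eq:
  assumes rigid: "rigid M" and t: "t \<in> aut_homs H M" and t': "t' \<in> aut_homs H M"
    and eq: "extension_equivalent M (twisted_extension H M t) (twisted_extension H M t')"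
  shows "t = t'"
proof -
  let ?T = "twisted_product H M t" and ?T' = "twisted_product H M t'"
  obtain \<psi> where iso: "simplicial_iso ?T ?T' \<psi>"
    and incl: "\<And>n w. w \<in> simplices (nerve M) n \<Longrightarrow> \<psi> n (w, vertex_degen (nerve H) [] n) = (w, vertex_degen (nerve H) [] n)"
    and proj: "\<And>n e. e \<in> simplices ?T n \<Longrightarrow> snd (\<psi> n e) = snd e"
    using eq by (auto simp: extension_equivalent_def twisted_extension_def)
  note \<psi> = simplicial_iso_map[OF iso]
  have fibre: "\<psi> 1 ([y], [pg_one H]) = ([y], [pg_one H])" if "y \<in> pg_carrier M" for y
    using incl[of "[y]" 1] that M.letter_simplex H.vertex_degen_nerve[of 1] by (simp del: vertex_degen.simps)
  have tri: "\<exists>p q. [p, q] \<in> pg_dom M \<and> \<psi> 1 ([v], [y]) = ([q], [y]) \<and> \<psi> 1 ([t y u], [x]) = ([t' y p], [x]) \<and>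
      \<psi> 1 ([pg_prod M [u, v]], [pg_prod H [x, y]]) = ([pg_prod M [p, q]], [pg_prod H [x, y]])"
    if "[u, v] \<in> pg_dom M" "[x, y] \<in> pg_dom H" for u v x y
  proof -
    have s: "([u, v], [x, y]) \<in> simplices ?T (Suc 1)" using that by (simp add: twisted_simplices nerve_simplices)
    have "\<psi> (Suc 1) ([u, v], [x, y]) \<in> simplices ?T' (Suc 1)" by (rule simplicial_map_closed[OF \<psi> s])
    then obtain p q where pq: "\<psi> (Suc 1) ([u, v], [x, y]) = ([p, q], [x, y])" "[p, q] \<in> pg_dom M"
      using proj[OF s] by (cases "\<psi> (Suc 1) ([u, v], [x, y])") (auto simp: twisted_simplices nerve_simplices length_Suc_conv)
    have f: "\<psi> 1 (face ?T (Suc 1) i ([u, v], [x, y])) = face ?T' (Suc 1) i ([p, q], [x, y])" if "i \<le> Suc 1" for i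
      using simplicial_map_face[OF \<psi> s that] pq(1) by simp
    note fl = nerve_face_last[of _ 1]
    have "\<psi> 1 ([v], [y]) = ([q], [y])" using f[of 0] by (simp add: twisted_face nerve_face_first)
    moreover have "\<psi> 1 ([t y u], [x]) = ([t' y p], [x])"
      using f[of "Suc 1"] fl[of M "[u, v]"] fl[of M "[p, q]"] fl[of H "[x, y]"] by (simp add: twisted_face_last)
    moreover have "\<psi> 1 ([pg_prod M [u, v]], [pg_prod H [x, y]]) = ([pg_prod M [p, q]], [pg_prod H [x, y]])"
      using f[of 1] by (simp add: twisted_face nerve_face_middle)
    ultimately show ?thesis using pq(2) by blast
  qed
  have "t x = t' x" if x: "x \<in> pg_carrier H" for x
  proof -
    note tx = hom_aut[OF t x] and tx' = hom_aut[OF t' x]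
    note o = H.one_closed M.one_closed
    obtain c where c: "\<psi> 1 ([pg_one M], [x]) = ([c], [x])" "c \<in> pg_carrier M"
      using tri[OF M.one_right_dom[OF o(2)] H.one_left_dom[OF x]] M.dom_carrier by force
    have "[z, c] \<in> pg_dom M" if z: "z \<in> pg_carrier M" for z
    proof -
      \<comment> \<open>The triangle \<open>([y, 1], [1, x])\<close>, with \<open>y\<close> such that its image has first letter \<open>z\<close>, puts \<open>(z, c)\<close> into the domain.\<close>
      define y where "y = inv (t x) (t' x z)"
      have ty: "t x y = t' x z" using permutes_inverses(1)[OF M.aut_permutes[OF tx]] by (simp add: y_def)
      have "t' x z \<in> pg_carrier M" using M.aut_closed[OF tx' z] .
      then have y: "y \<in> pg_carrier M" unfolding y_def using M.aut_closed[OF M.inv_aut[OF tx]] by simp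
      obtain p q where pq: "[p, q] \<in> pg_dom M" "\<psi> 1 ([pg_one M], [x]) = ([q], [x])"
        "\<psi> 1 ([t x y], [pg_one H]) = ([t' x p], [pg_one H])"
        using tri[OF M.one_right_dom[OF y] H.one_left_dom[OF x]] by blast
      have "t' x p = t' x z" using pq(3) fibre[of "t x y"] ty M.aut_closed[OF tx' z] by simp
      then have "p = z" using permutes_inj[OF M.aut_permutes[OF tx']] by (simp add: inj_eq)
      then show ?thesis using pq c(1) by simp
    qed
    then have c1: "c = pg_one M" using rigid c(2) by (simp add: rigid_def)
    \<comment> \<open>Now the triangle \<open>([1, y], [x, 1])\<close> is fixed, as two of its faces are.\<close>
    have over_x: "\<psi> 1 ([y], [x]) = ([y], [x])" if y: "y \<in> pg_carrier M" for y
    proof -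
      obtain p q where pq: "[p, q] \<in> pg_dom M" "\<psi> 1 ([y], [pg_one H]) = ([q], [pg_one H])"
        "\<psi> 1 ([t (pg_one H) (pg_one M)], [x]) = ([t' (pg_one H) p], [x])"
        "\<psi> 1 ([pg_prod M [pg_one M, y]], [pg_prod H [x, pg_one H]]) = ([pg_prod M [p, q]], [pg_prod H [x, pg_one H]])"
        using tri[OF M.one_left_dom[OF y] H.one_right_dom[OF x]] by blast
      have "p = pg_one M" "q = y" using pq c c1 fibre[OF y] by (simp_all add: hom_one[OF t] hom_one[OF t'])
      then show ?thesis using pq(4) y x by (simp add: M.prod_one_left H.prod_one_right)
    qed
    have "t x y = t' x y" if y: "y \<in> pg_carrier M" for y
    proof -
      obtain p q where pq: "[p, q] \<in> pg_dom M" "\<psi> 1 ([pg_one M], [x]) = ([q], [x])"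
        "\<psi> 1 ([t x y], [pg_one H]) = ([t' x p], [pg_one H])"
        "\<psi> 1 ([pg_prod M [y, pg_one M]], [pg_prod H [pg_one H, x]]) = ([pg_prod M [p, q]], [pg_prod H [pg_one H, x]])"
        using tri[OF M.one_right_dom[OF y] H.one_left_dom[OF x]] by blast
      have "q = pg_one M" "p \<in> pg_carrier M" using pq c c1 M.dom_carrier[OF pq(1)] by auto
      then have "p = y" using pq(4) over_x[OF y] y x by (simp add: M.prod_one_right H.prod_one_left)
      then show ?thesis using pq(3) fibre[of "t x y"] M.aut_closed[OF tx y] by simp
    qed
    moreover have "t x y = t' x y" if "y \<notin> pg_carrier M" for y
      using that permutes_not_in[OF M.aut_permutes] tx tx' by metis
    ultimately show ?thesis by (metis ext)
  qed
  then show ?thesis using t t' by (intro PiE_ext[of t "pg_carrier H" _ t']) (auto simp: aut_homs_def)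
qed

text \<open>
The type \<open>'e\<close> of simplices only has to be large enough to contain the twisted products, which is what the
map \<open>j\<close> provides.
\<close>

theorem card_extension_classes:
  fixes j :: "'m list \<times> 'h list \<Rightarrow> 'e"
  assumes rigid: "rigid M" and j: "inj_on j (pg_dom M \<times> pg_dom H)"
  shows "card (extension_classes H M :: ('m, 'h, 'e) extension set set) = card (aut_homs H M)"
proof -
  have "\<exists>\<E> :: ('m, 'h, 'e) extension. is_extension H M \<E> \<and> extension_equivalent M (twisted_extension H M t) \<E>"
    if t: "t \<in> aut_homs H M" for t
  proof (rule exists_relabelled_extension[OF is_extension_twisted[OF t]])
    have "(\<Union>n. simplices (total (twisted_extension H M t)) n) \<subseteq> pg_dom M \<times> pg_dom H"
      by (auto simp: twisted_extension_def twisted_simplices nerve_simplices)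
    then show "inj_on j (\<Union>n. simplices (total (twisted_extension H M t)) n)" using j by (rule inj_on_subset[rotated])
  qed
  then obtain E :: "_ \<Rightarrow> ('m, 'h, 'e) extension" where
    E: "\<And>t. t \<in> aut_homs H M \<Longrightarrow> is_extension H M (E t)"
      "\<And>t. t \<in> aut_homs H M \<Longrightarrow> extension_equivalent M (twisted_extension H M t) (E t)" by metis
  let ?R = "extension_rel H M :: ('m, 'h, 'e) extension rel"
  note equiv = equiv_extension_rel[of H M]
  have inE: "E t \<in> extensions H M" if "t \<in> aut_homs H M" for t using E(1)[OF that] by (simp add: extensions_def)
  have "bij_betw (\<lambda>t. ?R `` {E t}) (aut_homs H M) (extension_classes H M)"
  proof (rule bij_betw_imageI)
    show "inj_on (\<lambda>t. ?R `` {E t}) (aut_homs H M)"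
    proof (rule inj_onI)
      fix t t' assume t: "t \<in> aut_homs H M" and t': "t' \<in> aut_homs H M" and eq: "?R `` {E t} = ?R `` {E t'}"
      have "(E t, E t') \<in> ?R" using eq_equiv_class[OF eq equiv inE[OF t']] .
      then have "extension_equivalent M (E t) (E t')" by (simp add: extension_rel_def)
      from extension_equivalent_trans[OF extension_equivalent_trans[OF E(2)[OF t] this]
          extension_equivalent_sym[OF is_extension_twisted[OF t'] E(2)[OF t']]]
      show "t = t'" by (rule twisted_equivalent_imp_eq[OF rigid t t'])
    qed
    show "(\<lambda>t. ?R `` {E t}) ` aut_homs H M = extension_classes H M"
    proof (intro equalityI subsetI)
      fix C assume "C \<in> (\<lambda>t. ?R `` {E t}) ` aut_homs H M"
      then show "C \<in> extension_classes H M" unfolding extension_classes_def by (auto intro: quotientI inE)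
    next
      fix C assume "C \<in> (extension_classes H M :: ('m, 'h, 'e) extension set set)"
      then obtain \<E> :: "('m, 'h, 'e) extension" where \<E>: "\<E> \<in> extensions H M" "C = ?R `` {\<E>}"
        unfolding extension_classes_def by (rule quotientE)
      interpret rigid_extension H M \<E>
        by unfold_locales (use \<E>(1) rigid in \<open>simp_all add: extensions_def\<close>)
      have "extension_equivalent M (E monodromy) \<E>"
        using extension_equivalent_trans[OF extension_equivalent_sym[OF is_extension_twisted[OF monodromy_hom]
              E(2)[OF monodromy_hom]] equivalent_twisted_monodromy] .
      then have "(E monodromy, \<E>) \<in> ?R" using inE[OF monodromy_hom] \<E>(1) by (simp add: extension_rel_def)
      then have "?R `` {E monodromy} = C" using equiv_class_eq[OF equiv] \<E>(2) by simp
      then show "C \<in> (\<lambda>t. ?R `` {E t}) ` aut_homs H M" using monodromy_hom by blast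
    qed
  qed
  then show ?thesis using bij_betw_same_card by metis
qed

end

section \<open>Free partial groups\<close>

fun weight :: "'a free_elem \<Rightarrow> int" where
  "weight One = 0" | "weight (Gen x) = 1" | "weight (Bar x) = -1"

abbreviation total_weight :: "'a free_elem list \<Rightarrow> int" where
  "total_weight u \<equiv> sum_list (map weight u)"

text \<open>
Words over one generator are read as paths in the groupoid with objects 0 and 1, in which \<open>Gen x\<close> is an
isomorphism from 0 to 1, \<open>Bar x\<close> its inverse and \<open>One\<close> an identity.  A word alternates, up to insertion of
\<open>One\<close>, iff it can be composed from some starting object.  In this form the domain is visibly closed under
multiplying out a subword and under inversion.
\<close>

fun walk :: "int \<Rightarrow> 'a free_elem list \<Rightarrow> bool" where
  "walk s [] \<longleftrightarrow> s \<in> {0, 1}"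
| "walk s (a # u) \<longleftrightarrow> s \<in> {0, 1} \<and> walk (s + weight a) u"

lemma walk_start: "walk s u \<Longrightarrow> s \<in> {0, 1}"
  by (cases u) auto

lemma walk_append: "walk s (u @ v) \<longleftrightarrow> walk s u \<and> walk (s + total_weight u) v"
  by (induction u arbitrary: s) (auto dest: walk_start simp: add.assoc)

lemma walk_end: "walk s u \<Longrightarrow> s + total_weight u \<in> {0, 1}"
  using walk_append[of s u "[]"] by simp

definition letters :: "'a \<Rightarrow> 'a free_elem set" where
  "letters x = {One, Gen x, Bar x}"

lemma alternating_iff_walk:
  assumes "set u \<subseteq> letters x" "s \<in> {0, 1}"
  shows "walk s u \<longleftrightarrow> distinct_adj (filter (\<lambda>a. a \<noteq> One) u) \<and>
    (filter (\<lambda>a. a \<noteq> One) u = [] \<or> hd (filter (\<lambda>a. a \<noteq> One) u) = (if s = 0 then Gen x else Bar x))"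
  using assms
proof (induction u arbitrary: s)
  case (Cons a u)
  have a: "a = One \<or> a = Gen x \<or> a = Bar x" and u: "set u \<subseteq> letters x" using Cons.prems by (auto simp: letters_def)
  show ?case
  proof (cases "s + weight a \<in> {0, 1}")
    case True
    have h: "b = Gen x \<or> b = Bar x" if "filter (\<lambda>a. a \<noteq> One) u = b # v" for b v
    proof -
      have "b \<in> set (filter (\<lambda>a. a \<noteq> One) u)" using that by simp
      then show ?thesis using u by (auto simp: letters_def)
    qed
    with True Cons.IH[OF u True] a Cons.prems(2) show ?thesis
      by (cases "filter (\<lambda>a. a \<noteq> One) u") auto
  next
    case False
    then have "\<not> walk (s + weight a) u" using walk_start by blast
    with False a Cons.prems(2) show ?thesis by auto
  qed
qed simp

lemma alternating_iff_ex_walk: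
  assumes "set u \<subseteq> letters x"
  shows "distinct_adj (filter (\<lambda>a. a \<noteq> One) u) \<longleftrightarrow> (\<exists>s. walk s u)"
proof
  assume d: "distinct_adj (filter (\<lambda>a. a \<noteq> One) u)"
  have "hd (filter (\<lambda>a. a \<noteq> One) u) \<in> {Gen x, Bar x}" if "filter (\<lambda>a. a \<noteq> One) u \<noteq> []"
    using hd_in_set[OF that] assms by (auto simp: letters_def)
  then have "walk 0 u \<or> walk 1 u"
    using d alternating_iff_walk[OF assms, of 0] alternating_iff_walk[OF assms, of 1] by auto
  then show "\<exists>s. walk s u" by blast
next
  assume "\<exists>s. walk s u"
  then show "distinct_adj (filter (\<lambda>a. a \<noteq> One) u)" using alternating_iff_walk[OF assms] walk_start by metis
qed

text \<open>
Inverse to the weight on the letters of one generator.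
\<close>

definition weight_elem :: "'a \<Rightarrow> int \<Rightarrow> 'a free_elem" where
  "weight_elem x d = (if d > 0 then Gen x else if d < 0 then Bar x else One)"

lemma free_prod_eq:
  assumes "set u \<subseteq> letters x" shows "free_prod u = weight_elem x (total_weight u)"
proof -
  have w: "int (count_list u (Gen x)) - int (count_list u (Bar x)) = total_weight u"
    using assms by (induction u) (auto simp: letters_def)
  have z: "count_list u (Gen y) = 0 \<and> count_list u (Bar y) = 0" if "y \<noteq> x" for y
    using assms that by (auto simp: letters_def count_list_0_iff)
  have gt: "count_list u (Gen y) > count_list u (Bar y) \<longleftrightarrow> y = x \<and> total_weight u > 0" for y
    using w z[of y] by (cases "y = x") auto
  have lt: "count_list u (Gen y) < count_list u (Bar y) \<longleftrightarrow> y = x \<and> total_weight u < 0" for y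
    using w z[of y] by (cases "y = x") auto
  show ?thesis by (auto simp: free_prod_def weight_elem_def gt lt)
qed

lemma weight_weight_elem: "d \<in> {-1, 0, 1} \<Longrightarrow> weight (weight_elem x d) = d"
  by (auto simp: weight_elem_def)

lemma total_weight_range: "walk s u \<Longrightarrow> total_weight u \<in> {-1, 0, 1}"
  using walk_start[of s u] walk_end[of s u] by auto

lemma weight_free_prod:
  "set u \<subseteq> letters x \<Longrightarrow> walk s u \<Longrightarrow> weight (free_prod u) = total_weight u"
  using weight_weight_elem[OF total_weight_range] free_prod_eq by metis

text \<open>
For words in \<open>One\<close> alone the generator \<open>x\<close> is arbitrary; this covers the case without non-trivial
generators.
\<close>

lemma free_dom_iff:
  "u \<in> free_dom X x\<^sub>0 \<longleftrightarrow> (\<exists>x s. (x \<in> X - {x\<^sub>0} \<or> set u \<subseteq> {One}) \<and> set u \<subseteq> letters x \<and> walk s u)"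
proof
  assume u: "u \<in> free_dom X x\<^sub>0"
  show "\<exists>x s. (x \<in> X - {x\<^sub>0} \<or> set u \<subseteq> {One}) \<and> set u \<subseteq> letters x \<and> walk s u"
  proof (cases "u \<in> lists {One}")
    case True
    then have "set u \<subseteq> {One}" by auto
    moreover from this have "walk 0 u" by (induction u) auto
    ultimately show ?thesis by (intro exI[of _ x\<^sub>0] exI[of _ 0]) (auto simp: letters_def)
  next
    case False
    then obtain x where "x \<in> X - {x\<^sub>0}" "set u \<subseteq> letters x" "distinct_adj (filter (\<lambda>a. a \<noteq> One) u)"
      using u by (auto simp: free_dom_def letters_def)
    with alternating_iff_ex_walk[of u x] obtain s where "x \<in> X - {x\<^sub>0} \<and> set u \<subseteq> letters x \<and> walk s u" by blast
    then show ?thesis by blast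
  qed
next
  assume "\<exists>x s. (x \<in> X - {x\<^sub>0} \<or> set u \<subseteq> {One}) \<and> set u \<subseteq> letters x \<and> walk s u"
  then obtain x s where x: "x \<in> X - {x\<^sub>0} \<or> set u \<subseteq> {One}" "set u \<subseteq> letters x" "walk s u" by blast
  show "u \<in> free_dom X x\<^sub>0"
  proof (cases "set u \<subseteq> {One}")
    case True
    then have "u \<in> lists {One}" by auto
    then show ?thesis unfolding free_dom_def by (rule UnI1)
  next
    case False
    then show ?thesis using x alternating_iff_ex_walk[of u x] by (auto simp: free_dom_def letters_def)
  qed
qed

lemma free_domE:
  assumes "u \<in> free_dom X x\<^sub>0"
  obtains x s where "x \<in> X - {x\<^sub>0} \<or> set u \<subseteq> {One}" "set u \<subseteq> letters x" "walk s u"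
  using assms unfolding free_dom_iff by blast

lemma free_inv_inv [simp]: "free_inv (free_inv a) = a"
  by (cases a) auto

lemma weight_free_inv [simp]: "weight (free_inv a) = - weight a"
  by (cases a) auto

lemma free_inv_letters: "a \<in> letters x \<Longrightarrow> free_inv a \<in> letters x"
  by (auto simp: letters_def)

lemma total_weight_inverse: "total_weight (rev (map free_inv u)) = - total_weight u"
  by (induction u) auto

lemma walk_inverse: "walk s u \<Longrightarrow> walk (s + total_weight u) (rev (map free_inv u))"
proof (induction u arbitrary: s)
  case (Cons a u)
  then have s: "s \<in> {0, 1}" "s + weight a \<in> {0, 1}" "walk (s + weight a) u" using walk_start by auto
  show ?case using Cons.IH[OF s(3)] s(1,2) by (simp add: walk_append total_weight_inverse add.assoc)
qed simp

fun generator :: "'a free_elem \<Rightarrow> 'a" where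
  "generator (Gen x) = x" | "generator (Bar x) = x" | "generator One = undefined"

lemma partial_group_free: "partial_group (free_pgroup X x\<^sub>0)"
proof -
  have car: "set u \<subseteq> free_carrier X x\<^sub>0" if "u \<in> free_dom X x\<^sub>0" for u
    using that by (elim free_domE) (auto simp: free_carrier_def letters_def)
  have one: "set [a] \<subseteq> {One} \<longleftrightarrow> a = One" for a :: "'a free_elem" by auto
  have prod_letters: "free_prod u \<in> letters x" if "set u \<subseteq> letters x" for u and x :: 'a
    using free_prod_eq[OF that] by (auto simp: weight_elem_def letters_def)
  have prod_one: "free_prod u = One" if "set u \<subseteq> {One}" for u :: "'a free_elem list"
  proof -
    have "total_weight u = 0" using that by (induction u) auto
    then show ?thesis using free_prod_eq[of u x\<^sub>0] that by (auto simp: letters_def weight_elem_def)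
  qed
  have contract: "u @ [free_prod v] @ w \<in> free_dom X x\<^sub>0 \<and> free_prod (u @ v @ w) = free_prod (u @ [free_prod v] @ w)"
    if "u @ v @ w \<in> free_dom X x\<^sub>0" for u v w
    using that
  proof (rule free_domE)
    fix x s assume x: "x \<in> X - {x\<^sub>0} \<or> set (u @ v @ w) \<subseteq> {One}" "set (u @ v @ w) \<subseteq> letters x" "walk s (u @ v @ w)"
    then have wt: "weight (free_prod v) = total_weight v" using weight_free_prod[of v x] by (auto simp: walk_append)
    have l: "set (u @ [free_prod v] @ w) \<subseteq> letters x" using x(2) prod_letters[of v x] by auto
    have "x \<in> X - {x\<^sub>0} \<or> set (u @ [free_prod v] @ w) \<subseteq> {One}" using x(1) prod_one[of v] by auto
    moreover have "walk s (u @ [free_prod v] @ w)"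
      using x(3) by (auto simp: walk_append wt dest: walk_start)
    ultimately have "u @ [free_prod v] @ w \<in> free_dom X x\<^sub>0" using l by (auto simp: free_dom_iff)
    moreover have "free_prod (u @ v @ w) = free_prod (u @ [free_prod v] @ w)"
      using free_prod_eq[OF x(2)] free_prod_eq[OF l] wt by simp
    ultimately show ?thesis by blast
  qed
  have inverse: "rev (map free_inv u) @ u \<in> free_dom X x\<^sub>0 \<and> free_prod (rev (map free_inv u) @ u) = One"
    if "u \<in> free_dom X x\<^sub>0" for u
    using that
  proof (rule free_domE)
    fix x s assume x: "x \<in> X - {x\<^sub>0} \<or> set u \<subseteq> {One}" "set u \<subseteq> letters x" "walk s u"
    have l: "set (rev (map free_inv u) @ u) \<subseteq> letters x" using x(2) by (auto intro!: free_inv_letters)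
    have "x \<in> X - {x\<^sub>0} \<or> set (rev (map free_inv u) @ u) \<subseteq> {One}" using x(1) by force
    moreover have "walk (s + total_weight u) (rev (map free_inv u) @ u)"
      using walk_inverse[OF x(3)] x(3) by (simp add: walk_append total_weight_inverse)
    ultimately have "rev (map free_inv u) @ u \<in> free_dom X x\<^sub>0" using l by (auto simp: free_dom_iff)
    then show ?thesis using free_prod_eq[OF l] by (simp add: total_weight_inverse weight_elem_def)
  qed
  have letter: "[a] \<in> free_dom X x\<^sub>0 \<and> free_prod [a] = a" if "a \<in> free_carrier X x\<^sub>0" for a
  proof -
    have "generator a \<in> X - {x\<^sub>0} \<or> a = One" "a \<in> letters (generator a)"
      using that by (auto simp: free_carrier_def letters_def)
    then obtain x where x: "a \<in> letters x" "x \<in> X - {x\<^sub>0} \<or> a = One" by blast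
    then have "walk (if a = Bar x then 1 else 0) [a]" by (auto simp: letters_def)
    then show ?thesis using x free_prod_eq[of "[a]" x] unfolding free_dom_iff one
      by (auto simp: letters_def weight_elem_def)
  qed
  have emp: "free_prod [] = (One :: 'a free_elem)" by (simp add: free_prod_def)
  show ?thesis
  proof (unfold_locales, goal_cases)
    case (4 u v)
    then have "u @ v \<in> free_dom X x\<^sub>0" by (simp add: free_pgroup_def)
    then show ?case
    proof (rule free_domE)
      fix x s assume "x \<in> X - {x\<^sub>0} \<or> set (u @ v) \<subseteq> {One}" "set (u @ v) \<subseteq> letters x" "walk s (u @ v)"
      then show ?thesis unfolding free_pgroup_def free_dom_iff pgroup.simps by (auto simp: walk_append)
    qed
  next
    case (5 u)
    then have "u \<in> free_dom X x\<^sub>0" by (simp add: free_pgroup_def)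
    then have "[free_prod u] \<in> free_dom X x\<^sub>0" using contract[of "[]" u "[]"] by simp
    from car[OF this] show ?case by (simp add: free_pgroup_def)
  next
    case (2)
    then show ?case using car by (auto simp: free_pgroup_def)
  next
    case (9 x)
    then show ?case by (auto simp: free_pgroup_def free_carrier_def)
  qed (use letter contract inverse in \<open>simp_all add: free_pgroup_def free_carrier_def pg_inv_word_def pg_one_def emp\<close>)
qed

lemma free_pgroup_simps:
  "pg_carrier (free_pgroup X x\<^sub>0) = free_carrier X x\<^sub>0" "pg_dom (free_pgroup X x\<^sub>0) = free_dom X x\<^sub>0"
  "pg_prod (free_pgroup X x\<^sub>0) = free_prod" "pg_one (free_pgroup X x\<^sub>0) = One"
  by (simp_all add: free_pgroup_def pg_one_def free_prod_def)

lemma free_dom_pair: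
  "[a, b] \<in> free_dom X x\<^sub>0 \<longleftrightarrow> a \<in> free_carrier X x\<^sub>0 \<and> b \<in> free_carrier X x\<^sub>0 \<and> (a = One \<or> b = One \<or> b = free_inv a)"
proof
  assume "[a, b] \<in> free_dom X x\<^sub>0"
  then show "a \<in> free_carrier X x\<^sub>0 \<and> b \<in> free_carrier X x\<^sub>0 \<and> (a = One \<or> b = One \<or> b = free_inv a)"
    by (elim free_domE) (auto simp: letters_def free_carrier_def)
next
  interpret partial_group "free_pgroup X x\<^sub>0" by (rule partial_group_free)
  assume ab: "a \<in> free_carrier X x\<^sub>0 \<and> b \<in> free_carrier X x\<^sub>0 \<and> (a = One \<or> b = One \<or> b = free_inv a)"
  then consider "a = One" | "b = One" | "b = free_inv a" by blast
  then show "[a, b] \<in> free_dom X x\<^sub>0"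
  proof cases
    case 1
    then show ?thesis using one_left_dom[of b] ab by (simp add: free_pgroup_simps)
  next
    case 2
    then show ?thesis using one_right_dom[of a] ab by (simp add: free_pgroup_simps)
  next
    case 3
    then have "a = free_inv b" by simp
    then show ?thesis using inv_word_dom[OF dom_letter[of b]] ab
      by (simp add: free_pgroup_def pg_inv_word_def)
  qed
qed

lemma free_prod_inverse [simp]: "free_prod [a, free_inv a] = One"
  by (cases a) (simp_all add: free_prod_def)

lemma rigid_free: "rigid (free_pgroup X x\<^sub>0)"
  unfolding rigid_def free_pgroup_simps
proof (intro ballI impI)
  fix c assume "c \<in> free_carrier X x\<^sub>0" "\<forall>y\<in>free_carrier X x\<^sub>0. [y, c] \<in> free_dom X x\<^sub>0"
  then have "c = One \<or> c = free_inv c" by (auto simp: free_dom_pair)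
  then show "c = One" by (cases c) auto
qed

lemma free_inv_closed: "y \<in> free_carrier X x\<^sub>0 \<Longrightarrow> free_inv y \<in> free_carrier X x\<^sub>0"
  by (auto simp: free_carrier_def)

section \<open>Automorphisms and homomorphisms of free partial groups\<close>

definition signed_perms :: "'a set \<Rightarrow> 'a \<Rightarrow> ('a free_elem \<Rightarrow> 'a free_elem) set" where
  "signed_perms X x\<^sub>0 = {a. a permutes free_carrier X x\<^sub>0 \<and> a One = One \<and>
     (\<forall>y\<in>free_carrier X x\<^sub>0. a (free_inv y) = free_inv (a y))}"

lemma inv_signed_perm: assumes "a \<in> signed_perms X x\<^sub>0" shows "inv a \<in> signed_perms X x\<^sub>0"
proof -
  have p: "a permutes free_carrier X x\<^sub>0" and a1: "a One = One"
    and ai: "\<And>y. y \<in> free_carrier X x\<^sub>0 \<Longrightarrow> a (free_inv y) = free_inv (a y)"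
    using assms by (auto simp: signed_perms_def)
  note ii = permutes_inverses[OF p]
  have "inv a One = One" using ii(2)[of One] a1 by simp
  moreover have "inv a (free_inv y) = free_inv (inv a y)" if "y \<in> free_carrier X x\<^sub>0" for y
  proof -
    have "inv a y \<in> free_carrier X x\<^sub>0" using permutes_in_image[OF permutes_inv[OF p]] that by simp
    from ai[OF this] have "a (free_inv (inv a y)) = free_inv y" using ii(1) by simp
    then show ?thesis using ii(2)[of "free_inv (inv a y)"] by simp
  qed
  ultimately show ?thesis using permutes_inv[OF p] by (simp add: signed_perms_def)
qed

text \<open>
On the letters of a generator \<open>x\<close> the map \<open>a\<close> multiplies all weights by the same sign \<open>e\<close>, so it takes a walk
either to a walk with the same steps or, if \<open>e = -1\<close>, to its reflection exchanging 0 and 1.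
\<close>

lemma signed_perm_hom:
  assumes a: "a \<in> signed_perms X x\<^sub>0" and u: "u \<in> free_dom X x\<^sub>0"
  shows "map a u \<in> free_dom X x\<^sub>0 \<and> a (free_prod u) = free_prod (map a u)"
  using u
proof (rule free_domE)
  have p: "a permutes free_carrier X x\<^sub>0" and a1: "a One = One"
    and ai: "\<And>y. y \<in> free_carrier X x\<^sub>0 \<Longrightarrow> a (free_inv y) = free_inv (a y)"
    using a by (auto simp: signed_perms_def)
  fix x s assume x: "x \<in> X - {x\<^sub>0} \<or> set u \<subseteq> {One}" "set u \<subseteq> letters x" "walk s u"
  show ?thesis
  proof (cases "set u \<subseteq> {One}")
    case True
    then have "map a u = u" using a1 by (induction u) auto
    moreover have "total_weight u = 0" using True by (induction u) auto
    then have "free_prod u = One" using free_prod_eq[OF x(2)] by (simp add: weight_elem_def)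
    ultimately show ?thesis using u a1 by simp
  next
    case False
    then have xX: "x \<in> X - {x\<^sub>0}" using x(1) by blast
    then have g: "Gen x \<in> free_carrier X x\<^sub>0" by (simp add: free_carrier_def)
    have "a (Gen x) \<noteq> One" using permutes_inj[OF p] a1 by (metis injD free_elem.distinct(1))
    moreover have "a (Gen x) \<in> free_carrier X x\<^sub>0" using permutes_in_image[OF p] g by blast
    ultimately obtain x' where "x' \<in> X - {x\<^sub>0}" "a (Gen x) = Gen x' \<or> a (Gen x) = Bar x'"
      by (auto simp: free_carrier_def)
    then have "\<exists>e. x' \<in> X - {x\<^sub>0} \<and> e \<in> {1, -1} \<and> a (Gen x) = weight_elem x' e"
      by (intro exI[of _ "weight (a (Gen x))"]) (auto simp: weight_elem_def)
    then obtain e where x': "x' \<in> X - {x\<^sub>0}" "e \<in> {1, -1}" "a (Gen x) = weight_elem x' e" by blast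
    have aB: "a (Bar x) = weight_elem x' (- e)" using ai[OF g] x'(2,3) by (auto simp: weight_elem_def)
    have l: "set (map a u) \<subseteq> letters x'" using x(2) x' aB a1 by (auto simp: letters_def weight_elem_def)
    have wa: "weight (a y) = e * weight y" if "y \<in> letters x" for y
      using that x' aB a1 by (auto simp: letters_def weight_elem_def)
    have tw: "total_weight (map a u) = e * total_weight u"
      using x(2) wa by (induction u) (auto simp: algebra_simps)
    \<comment> \<open>A negative sign reflects the walk, so it starts at the other object.\<close>
    have "walk (if e = 1 then s else 1 - s) (map a u)"
      using x(2,3)
    proof (induction u arbitrary: s)
      case (Cons y u)
      then show ?case using wa[of y] x'(2) by (cases "e = 1") (force simp: algebra_simps)+
    qed (use x'(2) in auto)
    then have "map a u \<in> free_dom X x\<^sub>0" using l x'(1) by (auto simp: free_dom_iff)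
    moreover have "a (weight_elem x d) = weight_elem x' (e * d)" for d
      using x' aB a1 by (auto simp: weight_elem_def)
    ultimately show ?thesis using free_prod_eq[OF l] free_prod_eq[OF x(2)] tw by simp
  qed
qed

text \<open>
An automorphism commutes with inversion because \<open>y\<close> and its inverse have product 1.  The converse applies
\<open>signed_perm_hom\<close> to the map and to its inverse.
\<close>

lemma pg_aut_free: "pg_aut (free_pgroup X x\<^sub>0) = signed_perms X x\<^sub>0"
proof (intro equalityI subsetI)
  interpret partial_group "free_pgroup X x\<^sub>0" by (rule partial_group_free)
  fix a assume a: "a \<in> pg_aut (free_pgroup X x\<^sub>0)"
  have a1: "a One = One" using aut_one[OF a] by (simp add: free_pgroup_simps)
  have "a (free_inv y) = free_inv (a y)" if y: "y \<in> free_carrier X x\<^sub>0" for y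
  proof -
    have d: "[y, free_inv y] \<in> free_dom X x\<^sub>0" using free_inv_closed y by (simp add: free_dom_pair)
    have "[a y, a (free_inv y)] \<in> free_dom X x\<^sub>0" using aut_dom[OF a, of "[y, free_inv y]"] d by (simp add: free_pgroup_simps)
    moreover have "a y \<in> free_carrier X x\<^sub>0" "a (free_inv y) \<in> free_carrier X x\<^sub>0"
      using aut_closed[OF a] y free_inv_closed[OF y] by (simp_all add: free_pgroup_simps)
    moreover have "free_prod [a y, a (free_inv y)] = One"
      using aut_prod[OF a, of "[y, free_inv y]"] d a1 by (simp add: free_pgroup_simps)
    moreover have "free_prod [One, z] = z" "free_prod [z, One] = z" if "z \<in> free_carrier X x\<^sub>0" for z
      using prod_one_left[of z] prod_one_right[of z] that by (simp_all add: free_pgroup_simps)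
    ultimately show ?thesis by (auto simp: free_dom_pair)
  qed
  then show "a \<in> signed_perms X x\<^sub>0" using aut_permutes[OF a] a1 by (simp add: signed_perms_def free_pgroup_simps)
next
  fix a assume a: "a \<in> signed_perms X x\<^sub>0"
  then have p: "a permutes free_carrier X x\<^sub>0" by (simp add: signed_perms_def)
  have "u \<in> free_dom X x\<^sub>0" if "map a u \<in> free_dom X x\<^sub>0" for u
    using signed_perm_hom[OF inv_signed_perm[OF a] that] permutes_inverses(2)[OF p] by (simp add: comp_def)
  then show "a \<in> pg_aut (free_pgroup X x\<^sub>0)"
    using p signed_perm_hom[OF a] by (auto simp: pg_aut_def free_pgroup_simps)
qed

text \<open>
The elements of \<open>S\<close> are those at which the permutation changes the sign.
\<close>

fun signed_perm :: "('a \<Rightarrow> 'a) \<Rightarrow> 'a set \<Rightarrow> 'a free_elem \<Rightarrow> 'a free_elem" where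
  "signed_perm p S One = One"
| "signed_perm p S (Gen x) = (if x \<in> S then Bar (p x) else Gen (p x))"
| "signed_perm p S (Bar x) = (if x \<in> S then Gen (p x) else Bar (p x))"

lemma signed_perm_inv: "signed_perm p S (free_inv y) = free_inv (signed_perm p S y)"
  by (cases y) auto

lemma bij_signed_perm:
  assumes "finite X"
  shows "bij_betw (\<lambda>(p, S). signed_perm p S) ({p. p permutes (X - {x\<^sub>0})} \<times> Pow (X - {x\<^sub>0})) (signed_perms X x\<^sub>0)"
proof (rule bij_betw_imageI)
  let ?X = "X - {x\<^sub>0}" and ?C = "free_carrier X x\<^sub>0"
  show "inj_on (\<lambda>(p, S). signed_perm p S) ({p. p permutes ?X} \<times> Pow ?X)"
  proof (rule inj_onI, clarify)
    fix p S q T assume eq: "signed_perm p S = signed_perm q T"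
    have "p x = q x \<and> (x \<in> S \<longleftrightarrow> x \<in> T)" for x
      using fun_cong[OF eq, of "Gen x"] by (simp split: if_splits)
    then show "p = q \<and> S = T" by auto
  qed
  show "(\<lambda>(p, S). signed_perm p S) ` ({p. p permutes ?X} \<times> Pow ?X) = signed_perms X x\<^sub>0"
  proof (intro equalityI subsetI)
    fix a assume "a \<in> (\<lambda>(p, S). signed_perm p S) ` ({p. p permutes ?X} \<times> Pow ?X)"
    then obtain p S where pS: "p permutes ?X" "S \<subseteq> ?X" and a: "a = signed_perm p S" by auto
    have p: "p x = p y \<longleftrightarrow> x = y" "p x \<in> ?X \<longleftrightarrow> x \<in> ?X" for x y
      using permutes_inj[OF pS(1)] permutes_in_image[OF pS(1)] by (auto dest: injD)
    have inj: "inj_on a ?C"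
      by (auto simp: inj_on_def free_carrier_def a p split: if_splits)
    have "a y \<in> ?C" if "y \<in> ?C" for y
      using that p(2)[of "generator y"] by (cases y) (auto simp: free_carrier_def a)
    then have "a ` ?C \<subseteq> ?C" by auto
    then have "a ` ?C = ?C"
      using inj assms by (intro endo_inj_surj) (auto simp: free_carrier_def)
    moreover have "a y = y" if "y \<notin> ?C" for y
      using that pS permutes_not_in[OF pS(1)] by (cases y) (auto simp: free_carrier_def a)
    ultimately have "a permutes ?C" using inj by (intro bij_imp_permutes) (auto simp: bij_betw_def)
    then show "a \<in> signed_perms X x\<^sub>0"
      by (simp add: signed_perms_def a signed_perm_inv)
  next
    fix a assume "a \<in> signed_perms X x\<^sub>0"
    then have pa: "a permutes ?C" and a1: "a One = One"
      and ai: "\<And>y. y \<in> ?C \<Longrightarrow> a (free_inv y) = free_inv (a y)" by (auto simp: signed_perms_def)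
    have inj: "a y = a z \<Longrightarrow> y = z" for y z using permutes_inj[OF pa] by (auto dest: injD)
    define p where "p x = generator (a (Gen x))" for x
    define S where "S = {x \<in> ?X. a (Gen x) = Bar (p x)}"
    have gen: "a (Gen x) \<in> {Gen (p x), Bar (p x)} \<and> p x \<in> ?X" if "x \<in> ?X" for x
    proof -
      have "Gen x \<in> ?C" using that by (simp add: free_carrier_def)
      then have "a (Gen x) \<in> ?C" using permutes_in_image[OF pa] by blast
      moreover have "a (Gen x) \<noteq> One" using inj[of "Gen x" One] a1 by auto
      ultimately show ?thesis by (auto simp: free_carrier_def p_def)
    qed
    have bar: "a (Bar x) = free_inv (a (Gen x))" if "x \<in> ?X" for x
      using ai[of "Gen x"] that by (simp add: free_carrier_def)
    have out: "a (Gen x) = Gen x" "a (Bar x) = Bar x" if "x \<notin> ?X" for x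
      using permutes_not_in[OF pa] that by (auto simp: free_carrier_def)
    have "inj_on p ?X"
    proof (rule inj_onI)
      fix x y assume xy: "x \<in> ?X" "y \<in> ?X" "p x = p y"
      then have "a (Gen x) = a (Gen y) \<or> a (Gen x) = a (Bar y)" using gen[of x] gen[of y] bar[of y] by auto
      then show "x = y" using inj by blast
    qed
    moreover have "p ` ?X \<subseteq> ?X" using gen by auto
    ultimately have "p ` ?X = ?X" using assms by (intro endo_inj_surj) auto
    moreover have p_out: "p x = x" if "x \<notin> ?X" for x using out[OF that] by (simp add: p_def)
    ultimately have pp: "p permutes ?X" using \<open>inj_on p ?X\<close> by (intro bij_imp_permutes) (auto simp: bij_betw_def)
    have gen_eq: "a (Gen x) = signed_perm p S (Gen x)" for x
      using gen[of x] out(1)[of x] p_out[of x] by (cases "x \<in> ?X") (auto simp: S_def)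
    have "a y = signed_perm p S y" for y
    proof (cases y)
      case (Bar x)
      show ?thesis
      proof (cases "x \<in> ?X")
        case True
        then show ?thesis using bar[OF True] gen_eq[of x] by (simp add: Bar)
      next
        case False
        then show ?thesis using out(2)[OF False] p_out[OF False] by (simp add: Bar S_def)
      qed
    qed (simp_all only: a1 gen_eq signed_perm.simps(1))
    then have "a = (\<lambda>(p, S). signed_perm p S) (p, S)" by auto
    then show "a \<in> (\<lambda>(p, S). signed_perm p S) ` ({p. p permutes ?X} \<times> Pow ?X)"
      using pp by (intro image_eqI[of _ _ "(p, S)"]) (auto simp: S_def)
  qed
qed

lemma card_pg_aut_free:
  assumes "finite X"
  shows "card (pg_aut (free_pgroup X x\<^sub>0)) = fact (card (X - {x\<^sub>0})) * 2 ^ card (X - {x\<^sub>0})"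
proof -
  have "card (pg_aut (free_pgroup X x\<^sub>0)) = card ({p. p permutes (X - {x\<^sub>0})} \<times> Pow (X - {x\<^sub>0}))"
    using bij_betw_same_card[OF bij_signed_perm[OF assms, of x\<^sub>0]] by (simp add: pg_aut_free)
  then show ?thesis using assms card_permutations[OF refl, of "X - {x\<^sub>0}"]
    by (simp add: card_cartesian_product card_Pow)
qed

text \<open>
Words of length 2 in a free partial group are of the form \<open>(1, y)\<close>, \<open>(y, 1)\<close> or \<open>(y, y\<^sup>-\<^sup>1)\<close>, so the values on
the generators can be chosen freely and determine the values on their inverses.
\<close>

lemma bij_aut_homs_free:
  assumes "partial_group M"
  shows "bij_betw (\<lambda>t. \<lambda>x\<in>X - {x\<^sub>0}. t (Gen x)) (aut_homs (free_pgroup X x\<^sub>0) M) (X - {x\<^sub>0} \<rightarrow>\<^sub>E pg_aut M)"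
proof (rule bij_betw_imageI)
  let ?H = "free_pgroup X x\<^sub>0" and ?X = "X - {x\<^sub>0}" and ?C = "free_carrier X x\<^sub>0"
  interpret partial_group_pair ?H M by (intro partial_group_pair.intro partial_group_free assms)
  have C: "One \<in> ?C" "x \<in> ?X \<Longrightarrow> Gen x \<in> ?C" "x \<in> ?X \<Longrightarrow> Bar x \<in> ?C" for x by (auto simp: free_carrier_def)
  have t1: "t One = id" if "t \<in> aut_homs ?H M" for t using hom_one[OF that] by (simp add: free_pgroup_simps)
  have bar: "t (Bar x) = inv (t (Gen x))" if t: "t \<in> aut_homs ?H M" and x: "x \<in> ?X" for t x
  proof -
    have "[Bar x, Gen x] \<in> free_dom X x\<^sub>0" using C(2,3)[OF x] by (simp add: free_dom_pair)
    then have "t (Bar x) \<circ> t (Gen x) = id"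
      using hom_mult[OF t, of "Bar x" "Gen x"] t1[OF t] free_prod_inverse[of "Bar x"] by (simp add: free_pgroup_simps)
    moreover have "t (Gen x) permutes pg_carrier M"
      using M.aut_permutes hom_aut[OF t] C(2)[OF x] by (simp add: free_pgroup_simps)
    ultimately show ?thesis by (metis bij_is_surj inv_unique_comp permutes_bij permutes_inv_o(1) comp_assoc comp_id id_comp)
  qed
  show "inj_on (\<lambda>t. \<lambda>x\<in>?X. t (Gen x)) (aut_homs ?H M)"
  proof (rule inj_onI)
    fix t t' assume t: "t \<in> aut_homs ?H M" and t': "t' \<in> aut_homs ?H M"
      and eq: "(\<lambda>x\<in>?X. t (Gen x)) = (\<lambda>x\<in>?X. t' (Gen x))"
    have gen: "t (Gen x) = t' (Gen x)" if "x \<in> ?X" for x using fun_cong[OF eq, of x] that by simp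
    have "t c = t' c" if "c \<in> ?C" for c
      using that gen bar[OF t] bar[OF t'] t1[OF t] t1[OF t'] by (auto simp: free_carrier_def)
    then show "t = t'" using t t' by (intro PiE_ext[of t ?C _ t']) (auto simp: aut_homs_def free_pgroup_simps)
  qed
  show "(\<lambda>t. \<lambda>x\<in>?X. t (Gen x)) ` aut_homs ?H M = ?X \<rightarrow>\<^sub>E pg_aut M"
  proof (intro equalityI subsetI)
    fix s assume "s \<in> (\<lambda>t. \<lambda>x\<in>?X. t (Gen x)) ` aut_homs ?H M"
    then obtain t where t: "t \<in> aut_homs ?H M" "s = (\<lambda>x\<in>?X. t (Gen x))" by blast
    have "t (Gen x) \<in> pg_aut M" if "x \<in> ?X" for x using hom_aut[OF t(1)] C(2)[OF that] by (simp add: free_pgroup_simps)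
    then show "s \<in> ?X \<rightarrow>\<^sub>E pg_aut M" by (simp add: t(2) restrict_PiE_iff)
  next
    fix s assume s: "s \<in> ?X \<rightarrow>\<^sub>E pg_aut M"
    define t where "t = (\<lambda>c\<in>?C. case c of One \<Rightarrow> id | Gen x \<Rightarrow> s x | Bar x \<Rightarrow> inv (s x))"
    have sx: "s x \<in> pg_aut M" if "x \<in> ?X" for x using PiE_mem[OF s that] .
    have io: "s x \<circ> inv (s x) = id" "inv (s x) \<circ> s x = id" if "x \<in> ?X" for x
      using permutes_inv_o[OF M.aut_permutes[OF sx[OF that]]] by auto
    have tc: "t One = id" "x \<in> ?X \<Longrightarrow> t (Gen x) = s x" "x \<in> ?X \<Longrightarrow> t (Bar x) = inv (s x)" for x
      using C by (simp_all add: t_def)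
    have "t c \<in> pg_aut M" if "c \<in> ?C" for c
    proof -
      consider "c = One" | x where "c = Gen x" "x \<in> ?X" | x where "c = Bar x" "x \<in> ?X"
        using \<open>c \<in> ?C\<close> by (auto simp: free_carrier_def)
      then show ?thesis using sx M.inv_aut M.id_aut tc by cases simp_all
    qed
    moreover have "t (free_prod [a, b]) = t a \<circ> t b" if ab: "[a, b] \<in> free_dom X x\<^sub>0" for a b
    proof -
      have c: "a \<in> ?C" "b \<in> ?C" and "a = One \<or> b = One \<or> b = free_inv a" using ab by (auto simp: free_dom_pair)
      then consider "a = One" | "b = One" | "b = free_inv a" by blast
      then show ?thesis
      proof cases
        case 1
        then show ?thesis using H.prod_one_left[of b] c tc(1) by (simp add: free_pgroup_simps)
      next
        case 2
        then show ?thesis using H.prod_one_right[of a] c tc(1) by (simp add: free_pgroup_simps)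
      next
        case 3
        then show ?thesis using c tc io by (auto simp: free_carrier_def)
      qed
    qed
    ultimately have "t \<in> aut_homs ?H M" by (simp add: aut_homs_def free_pgroup_simps t_def restrict_PiE_iff)
    moreover have "s = (\<lambda>x\<in>?X. t (Gen x))" 
    proof -
      have "(\<lambda>x\<in>?X. t (Gen x)) = restrict s ?X" by (rule restrict_ext) (rule tc(2))
      then show ?thesis by (simp only: PiE_restrict[OF s])
    qed
    ultimately show "s \<in> (\<lambda>t. \<lambda>x\<in>?X. t (Gen x)) ` aut_homs ?H M" by blast
  qed
qed

lemma countable_free_dom: "finite X \<Longrightarrow> countable (free_dom X x\<^sub>0)"
proof -
  assume "finite X"
  then have "countable (lists (free_carrier X x\<^sub>0))"
    by (intro countable_lists countable_finite) (simp add: free_carrier_def)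
  moreover have "free_dom X x\<^sub>0 \<subseteq> lists (free_carrier X x\<^sub>0)"
    using partial_group.dom_words[OF partial_group_free[of X x\<^sub>0]] by (simp add: free_pgroup_simps)
  ultimately show ?thesis by (rule countable_subset[rotated])
qed

theorem proposition3p9:
  fixes X :: "'a set" and x\<^sub>0 :: 'a and Y :: "'b set" and y\<^sub>0 :: 'b
  assumes "finite X" and "x\<^sub>0 \<in> X"
    and "finite Y" and "y\<^sub>0 \<in> Y"
    and "infinite (UNIV :: 'e set)"
  shows "card (extension_classes (free_pgroup X x\<^sub>0) (free_pgroup Y y\<^sub>0) ::
            ('b free_elem, 'a free_elem, 'e) extension set set) =
         (fact (card (Y - {y\<^sub>0})) * 2 ^ card (Y - {y\<^sub>0})) ^ card (X - {x\<^sub>0})"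
proof -
  let ?H = "free_pgroup X x\<^sub>0" and ?M = "free_pgroup Y y\<^sub>0"
  interpret partial_group_pair ?H ?M by (intro partial_group_pair.intro partial_group_free)
  \<comment> \<open>The twisted products are countable, so they fit into any infinite type.\<close>
  obtain f :: "nat \<Rightarrow> 'e" where f: "inj f"
    using assms(5) infinite_countable_subset by blast
  have "countable (pg_dom ?M \<times> pg_dom ?H)"
    unfolding free_pgroup_simps by (intro countable_SIGMA countable_free_dom assms(1,3))
  then have "inj_on (f \<circ> to_nat_on (pg_dom ?M \<times> pg_dom ?H)) (pg_dom ?M \<times> pg_dom ?H)"
    by (intro comp_inj_on inj_on_to_nat_on inj_on_subset[OF f]) auto
  from card_extension_classes[OF rigid_free this]
  have "card (extension_classes ?H ?M :: ('b free_elem, 'a free_elem, 'e) extension set set) = card (aut_homs ?H ?M)" .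
  also have "\<dots> = card (X - {x\<^sub>0} \<rightarrow>\<^sub>E pg_aut ?M)"
    by (rule bij_betw_same_card[OF bij_aut_homs_free[OF partial_group_free]])
  also have "\<dots> = card (pg_aut ?M) ^ card (X - {x\<^sub>0})"
    using assms(1) by (simp add: card_PiE)
  finally show ?thesis by (simp add: card_pg_aut_free[OF assms(3)])
qed

end
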